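(* Let $\hat d\in\{2,3\}$, let $\widehat{\mathcal Q}\in\widehat{\mathbb Q}$ be an admissible parametric T-mesh of $\widehat\Omega=(0,1)^{\hat d}$ and let $\widehat Q\in\widehat{\mathcal Q}$. Then $\widehat Q$ consists either of one Bézier element equal to $\widehat Q$, or of two Bézier elements of measure $|\widehat Q|/2$.
   Context: Setting: $\hat d\in\{2,3\}$; odd degrees $p_j\ge3$, integers $n_j$, $j=1,\dots,\hat d$; open knot vectors $T_j^0=(t_{j,1},\dots,t_{j,n_j+p_j+1})$ with $t_{j,1}=\dots=t_{j,p_j+1}=0$, $t_{j,n_j+1}=\dots=t_{j,n_j+p_j+1}=1$, $t_{j,i}<t_{j,i+1}$ for $p_j+1\le i\le n_j$. For dyadic rational $r=i+\rho$ with $p_j+1\le i\le n_j$, $0<\rho<1$, put $t_{j,r}=(1-\rho)t_{j,i}+\rho t_{j,i+1}$ (i.e. recursive midpoints). Index T-meshes: $\check{\mathcal Q}_0$ is the set of all open unit cubes $\prod_j(l_j,l_j+1)$, $1\le l_j\le n_j+p_j$, all of level $0$, partitioning $\check\Omega_{\rm ind}=\prod_j(1,n_j+p_j+1)$. Let $\check\Omega_{\rm ip}=\prod_j(p_j+1,n_j+1)$. Bisecting an index element $\check Q=\prod_j(a_j,b_j)$ of level $\ell$: in direction $j=(\ell\bmod\hat d)+1$, replace it by its two halves in direction $j$ if $t_{j,a_j}\ne t_{j,b_j}$, otherwise keep it; the resulting element(s) get level $\ell+1$. An index T-mesh $\check{\mathcal Q}$ arises from $\check{\mathcal Q}_0$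 by successive bisections. The parametric image of $\check Q$ is $\prod_j(t_{j,a_j},t_{j,b_j})$, and the parametric T-mesh $\widehat{\mathcal Q}$ associated with $\check{\mathcal Q}$ is the set of all parametric images of positive measure. Blending functions: anchors are the vertices $\mathbf z$ of elements of $\check{\mathcal Q}$ lying in $\prod_j[\lceil p_j/2\rceil+1,\,n_j+p_j+1-\lceil p_j/2\rceil]$. For an anchor $\mathbf z$ and direction $j$, consider all $s\in[1,n_j+p_j+1]$ such that $\mathbf z$ with $j$-th coordinate replaced by $s$ lies in $\bigcup_{\check Q\in\check{\mathcal Q}}\{x\in\overline{\check Q}:x_j\in\{a_j,b_j\}\}$ (where $\check Q=\prod_i(a_i,b_i)$); the local index vector consists of the $p_j+2$ consecutive such $s$ with $z_j$ in the middle, and the local knot vector $T_j(\mathbf z)$ of the corresponding $t_{j,s}$. $\widehat B_{\mathbf z}(t)=\prod_j\widehat B[T_j(\mathbf z)](t_j)$, with $\widehat B[T]$ the univariate B-spline of degree $p_j$ with the $p_j+2$ knots $T$. Bézier elements: the Bézier mesh is the collection of maximal open sets $\widehat Q_B\subset\widehat\Omega$ such that every $\widehat B_{\mathbf z}$ restricted to $\widehat Q_B$ is a polynomial of (coordinate) degree $\mathbf p=(p_1,\dots,p_{\hat d})$; its members are the Bézier elements. Admissible refinement: for $\check Q\in\check{\mathcal Q}$, $\check Q\subseteq\check\Omega_{\rm ip}$, with midpoint $x_{\check Q}$ and level $k$, the neighbors $\mathcal N(\check Q)$ are the $\check Q'\in\check{\mathcal Q}$ with $\check Q'\subseteq\check\Omega_{\rm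 ip}$, level $<k$, containing a point $x$ with $|x_j-(x_{\check Q})_j|<(\mathbf D_{\mathbf p}(k))_j$ for all $j$. Here, for $\hat d=2$: $\mathbf D_{\mathbf p}(k)=2^{-k/2}(\lfloor\frac{p_1}2\rfloor+\frac12,\lceil\frac{p_2}2\rceil+\frac12)$ for $k$ even, $2^{-(k+1)/2}(\lceil\frac{p_1}2\rceil+\frac12,2\lfloor\frac{p_2}2\rfloor+1)$ for $k$ odd; for $\hat d=3$: $\mathbf D_{\mathbf p}(k)=2^{-k/3}(p_1+\frac32,p_2+\frac32,p_3+\frac32)$ if $k\equiv0$, $2^{-(k-1)/3}(\frac{p_1+3/2}2,p_2+\frac32,p_3+\frac32)$ if $k\equiv1$, $2^{-(k-2)/3}(\frac{p_1+3/2}2,\frac{p_2+3/2}2,p_3+\frac32)$ if $k\equiv2\pmod 3$. The boundary prolongation of $\check Q\subseteq\check\Omega_{\rm ip}$ is the set of $\check Q'\in\check{\mathcal Q}$ such that the coordinatewise projection of the midpoint of $\check Q'$ onto $\overline{\check\Omega_{\rm ip}}$ lies in $\partial\check Q$. $\mathtt{refine}(\widehat{\mathcal Q},\widehat{\mathcal M})$ for $\widehat{\mathcal M}\subseteq\widehat{\mathcal Q}$: take the index preimages of $\widehat{\mathcal M}$ in $\check{\mathcal Q}$, add neighbors of the elements in the set until nothing is added, add the boundary prolongations of all elements in the set, bisect every element of the resulting set once; return the parametric T-mesh of the new index T-mesh. $\widehat{\mathbb Q}$ is the set of all parametric T-meshes obtained by finitely many applications of $\mathtt{refine}$ starting from the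 parametric T-mesh of $\check{\mathcal Q}_0$; each has a unique associated index T-mesh. *)

theory Defs
  imports "HOL-Analysis.Analysis"
begin

text \<open>
  Vectors live in \<open>real ^ 'd\<close>, where the index type \<open>'d\<close> is finite and linearly ordered: the
  order says which coordinate is the first, second, third direction. Throughout, \<open>p\<close>, \<open>n\<close> and
  \<open>t\<close> give for every direction the degree, the number of splines and the knots of the initial
  knot vector; knots are numbered from 1, so \<open>t j 0\<close> plays no role.
\<close>

section \<open>Knots\<close>

definition open_knots :: "nat \<Rightarrow> nat \<Rightarrow> (nat \<Rightarrow> real) \<Rightarrow> bool" where
  "open_knots q m \<tau> \<longleftrightarrow>
     (\<forall>i\<in>{1..q + 1}. \<tau> i = 0) \<and>
     (\<forall>i\<in>{m + 1..m + q + 1}. \<tau> i = 1) \<and>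
     (\<forall>i\<in>{q + 1..m}. \<tau> i < \<tau> (i + 1))"

text \<open>The knot \<open>t\<^sub>j\<^sub>,\<^sub>r\<close> with \<open>r = i + \<rho>\<close>, \<open>0 \<le> \<rho> < 1\<close>; for \<open>\<rho> = 0\<close> this is \<open>t j i\<close>.\<close>

definition knot :: "('d \<Rightarrow> nat \<Rightarrow> real) \<Rightarrow> 'd \<Rightarrow> real \<Rightarrow> real" where
  "knot t j r = (1 - frac r) * t j (nat \<lfloor>r\<rfloor>) + frac r * t j (nat \<lfloor>r\<rfloor> + 1)"

section \<open>Index T-meshes\<close>

text \<open>
  An index element is an open box with corners \<open>lo\<close> and \<open>hi\<close>, together with its level. The level
  cannot be read off the box, because bisecting an element with coinciding end knots keeps the box
  and increases the level.
\<close>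

datatype 'd elem = Elem (lo: "real ^ 'd") (hi: "real ^ 'd") (level: nat)

definition elem_box :: "'d::finite elem \<Rightarrow> (real ^ 'd) set" where
  "elem_box Q = box (lo Q) (hi Q)"

definition midpt :: "'d::finite elem \<Rightarrow> real ^ 'd" where
  "midpt Q = (1 / 2) *\<^sub>R (lo Q + hi Q)"

definition initial_index_mesh :: "('d::finite \<Rightarrow> nat) \<Rightarrow> ('d \<Rightarrow> nat) \<Rightarrow> 'd elem set" where
  "initial_index_mesh p n =
     {Elem (\<chi> j. real (l j)) (\<chi> j. real (l j) + 1) 0 | l :: 'd \<Rightarrow> nat.
        \<forall>j. 1 \<le> l j \<and> l j \<le> n j + p j}"

definition ip_domain :: "('d::finite \<Rightarrow> nat) \<Rightarrow> ('d \<Rightarrow> nat) \<Rightarrow> (real ^ 'd) set" where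
  "ip_domain p n = box (\<chi> j. real (p j) + 1) (\<chi> j. real (n j) + 1)"

text \<open>Position of a direction, counted from 0.\<close>

definition pos :: "'d::{finite,linorder} \<Rightarrow> nat" where
  "pos j = card {i. i < j}"

definition split_dir :: "nat \<Rightarrow> 'd::{finite,linorder}" where
  "split_dir l = (THE j. pos j = l mod CARD('d))"

definition bisect :: "('d::{finite,linorder} \<Rightarrow> nat \<Rightarrow> real) \<Rightarrow> 'd elem \<Rightarrow> 'd elem set" where
  "bisect t Q =
     (let j = split_dir (level Q); m = midpt Q $ j in
      if knot t j (lo Q $ j) \<noteq> knot t j (hi Q $ j)
      then {Elem (lo Q) (\<chi> i. if i = j then m else hi Q $ i) (level Q + 1),
            Elem (\<chi> i. if i = j then m else lo Q $ i) (hi Q) (level Q + 1)}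
      else {Elem (lo Q) (hi Q) (level Q + 1)})"

section \<open>Parametric T-meshes\<close>

definition param_domain :: "(real ^ 'd::finite) set" where
  "param_domain = box 0 1"

definition param_image :: "('d::finite \<Rightarrow> nat \<Rightarrow> real) \<Rightarrow> 'd elem \<Rightarrow> (real ^ 'd) set" where
  "param_image t Q = box (\<chi> j. knot t j (lo Q $ j)) (\<chi> j. knot t j (hi Q $ j))"

definition param_mesh :: "('d::finite \<Rightarrow> nat \<Rightarrow> real) \<Rightarrow> 'd elem set \<Rightarrow> (real ^ 'd) set set" where
  "param_mesh t M = {param_image t Q | Q. Q \<in> M \<and> measure lborel (param_image t Q) > 0}"

section \<open>Blending functions\<close>

definition anchors ::
    "('d::finite \<Rightarrow> nat) \<Rightarrow> ('d \<Rightarrow> nat) \<Rightarrow> 'd elem set \<Rightarrow> (real ^ 'd) set" where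
  "anchors p n M =
     {z. (\<exists>Q\<in>M. \<forall>j. z $ j \<in> {lo Q $ j, hi Q $ j}) \<and>
         (\<forall>j. z $ j \<in> {\<lceil>real (p j) / 2\<rceil> + 1 .. real (n j) + real (p j) + 1 - \<lceil>real (p j) / 2\<rceil>})}"

definition skeleton :: "'d::finite elem set \<Rightarrow> 'd \<Rightarrow> (real ^ 'd) set" where
  "skeleton M j = (\<Union>Q\<in>M. {x \<in> closure (elem_box Q). x $ j \<in> {lo Q $ j, hi Q $ j}})"

definition global_indices ::
    "('d::finite \<Rightarrow> nat) \<Rightarrow> ('d \<Rightarrow> nat) \<Rightarrow> 'd elem set \<Rightarrow> 'd \<Rightarrow> real ^ 'd \<Rightarrow> real set" where
  "global_indices p n M j z =
     {s. 1 \<le> s \<and> s \<le> real (n j + p j + 1) \<and> (\<chi> i. if i = j then s else z $ i) \<in> skeleton M j}"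

text \<open>
  The \<open>p\<^sub>j + 2\<close> consecutive global indices around \<open>z $ j\<close>. As \<open>p\<^sub>j\<close> is odd, \<open>z $ j\<close> has
  \<open>(p\<^sub>j + 1) / 2\<close> neighbours on either side. The set of global indices is finite and contains all
  integers of its range, so for an anchor the subtraction does not truncate and there are enough
  entries to take.
\<close>

definition local_indices ::
    "('d::finite \<Rightarrow> nat) \<Rightarrow> ('d \<Rightarrow> nat) \<Rightarrow> 'd elem set \<Rightarrow> 'd \<Rightarrow> real ^ 'd \<Rightarrow> real list" where
  "local_indices p n M j z =
     (let S = global_indices p n M j z; k = card {s \<in> S. s < z $ j} in
      take (p j + 2) (drop (k - (p j + 1) div 2) (sorted_list_of_set S)))"

definition local_knots ::
    "('d::finite \<Rightarrow> nat) \<Rightarrow> ('d \<Rightarrow> nat) \<Rightarrow> ('d \<Rightarrow> nat \<Rightarrow> real) \<Rightarrow> 'd elem set \<Rightarrow> 'd \<Rightarrow>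
     real ^ 'd \<Rightarrow> real list" where
  "local_knots p n t M j z = map (knot t j) (local_indices p n M j z)"

text \<open>
  The Cox-de Boor recursion for the B-spline with knots \<open>\<tau> i, \<dots>, \<tau> (i + q + 1)\<close>. The usual
  convention that terms with vanishing denominator are dropped is division by zero in HOL.
\<close>

fun bspline :: "nat \<Rightarrow> (nat \<Rightarrow> real) \<Rightarrow> nat \<Rightarrow> real \<Rightarrow> real" where
  "bspline 0 \<tau> i x = (if \<tau> i \<le> x \<and> x < \<tau> (i + 1) then 1 else 0)"
| "bspline (Suc q) \<tau> i x =
     (x - \<tau> i) / (\<tau> (i + q + 1) - \<tau> i) * bspline q \<tau> i x +
     (\<tau> (i + q + 2) - x) / (\<tau> (i + q + 2) - \<tau> (i + 1)) * bspline q \<tau> (i + 1) x"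

definition blending ::
    "('d::finite \<Rightarrow> nat) \<Rightarrow> ('d \<Rightarrow> nat) \<Rightarrow> ('d \<Rightarrow> nat \<Rightarrow> real) \<Rightarrow> 'd elem set \<Rightarrow>
     real ^ 'd \<Rightarrow> real ^ 'd \<Rightarrow> real" where
  "blending p n t M z x =
     (\<Prod>j\<in>UNIV. bspline (p j) (\<lambda>k. local_knots p n t M j z ! k) 0 (x $ j))"

section \<open>Bezier elements\<close>

definition polynomial_on ::
    "('d::finite \<Rightarrow> nat) \<Rightarrow> (real ^ 'd) set \<Rightarrow> (real ^ 'd \<Rightarrow> real) \<Rightarrow> bool" where
  "polynomial_on p U f \<longleftrightarrow>
     (\<exists>c :: ('d \<Rightarrow> nat) \<Rightarrow> real. \<forall>x\<in>U.
        f x = (\<Sum>\<alpha> | \<forall>j. \<alpha> j \<le> p j. c \<alpha> * (\<Prod>j\<in>UNIV. (x $ j) ^ \<alpha> j)))"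

definition bezier_candidate ::
    "('d::finite \<Rightarrow> nat) \<Rightarrow> ('d \<Rightarrow> nat) \<Rightarrow> ('d \<Rightarrow> nat \<Rightarrow> real) \<Rightarrow> 'd elem set \<Rightarrow>
     (real ^ 'd) set \<Rightarrow> bool" where
  "bezier_candidate p n t M U \<longleftrightarrow>
     open U \<and> U \<subseteq> param_domain \<and>
     (\<forall>z\<in>anchors p n M. polynomial_on p U (blending p n t M z))"

definition bezier_mesh ::
    "('d::finite \<Rightarrow> nat) \<Rightarrow> ('d \<Rightarrow> nat) \<Rightarrow> ('d \<Rightarrow> nat \<Rightarrow> real) \<Rightarrow> 'd elem set \<Rightarrow>
     (real ^ 'd) set set" where
  "bezier_mesh p n t M =
     {U. bezier_candidate p n t M U \<and>
         (\<forall>V. bezier_candidate p n t M V \<and> U \<subseteq> V \<longrightarrow> V = U)}"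

text \<open>
  A set \<open>Q\<close> consists of the Bezier elements in \<open>F\<close>: these are pairwise disjoint subsets of \<open>Q\<close> that
  fill \<open>Q\<close> up to their boundaries, and no other Bezier element meets \<open>Q\<close>.
\<close>

definition consists_of_bezier ::
    "('d::finite \<Rightarrow> nat) \<Rightarrow> ('d \<Rightarrow> nat) \<Rightarrow> ('d \<Rightarrow> nat \<Rightarrow> real) \<Rightarrow> 'd elem set \<Rightarrow>
     (real ^ 'd) set \<Rightarrow> (real ^ 'd) set set \<Rightarrow> bool" where
  "consists_of_bezier p n t M Q F \<longleftrightarrow>
     F = {B \<in> bezier_mesh p n t M. B \<inter> Q \<noteq> {}} \<and>
     disjoint F \<and> \<Union>F \<subseteq> Q \<and> Q \<subseteq> (\<Union>B\<in>F. closure B)"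

section \<open>Admissible refinement\<close>

text \<open>
  The components of \<open>D\<^sub>p(k)\<close>. In dimension 3, passing from \<open>k \<equiv> 0\<close> to \<open>k \<equiv> 1\<close> and \<open>k \<equiv> 2\<close>
  modulo 3 halves the first and then the second component.
\<close>

definition nb_dist :: "('d::{finite,linorder} \<Rightarrow> nat) \<Rightarrow> nat \<Rightarrow> 'd \<Rightarrow> real" where
  "nb_dist p k j =
     (if CARD('d) = 2 then
        if even k then
          (1 / 2) ^ (k div 2) *
          (if pos j = 0 then \<lfloor>real (p j) / 2\<rfloor> + 1 / 2 else \<lceil>real (p j) / 2\<rceil> + 1 / 2)
        else
          (1 / 2) ^ ((k + 1) div 2) *
          (if pos j = 0 then \<lceil>real (p j) / 2\<rceil> + 1 / 2 else 2 * \<lfloor>real (p j) / 2\<rfloor> + 1)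
      else
        (1 / 2) ^ (k div 3) *
        (if pos j < k mod 3 then (real (p j) + 3 / 2) / 2 else real (p j) + 3 / 2))"

definition neighbors ::
    "('d::{finite,linorder} \<Rightarrow> nat) \<Rightarrow> ('d \<Rightarrow> nat) \<Rightarrow> 'd elem set \<Rightarrow> 'd elem \<Rightarrow> 'd elem set" where
  "neighbors p n M Q =
     {Q' \<in> M. elem_box Q' \<subseteq> ip_domain p n \<and> level Q' < level Q \<and>
        (\<exists>x\<in>elem_box Q'. \<forall>j. \<bar>x $ j - midpt Q $ j\<bar> < nb_dist p (level Q) j)}"

inductive_set neighbor_closure ::
    "('d::{finite,linorder} \<Rightarrow> nat) \<Rightarrow> ('d \<Rightarrow> nat) \<Rightarrow> 'd elem set \<Rightarrow> 'd elem set \<Rightarrow> 'd elem set"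
  for p n M S where
  base: "Q \<in> S \<Longrightarrow> Q \<in> neighbor_closure p n M S"
| step: "Q \<in> neighbor_closure p n M S \<Longrightarrow> Q' \<in> neighbors p n M Q \<Longrightarrow>
         Q' \<in> neighbor_closure p n M S"

definition proj_ip :: "('d::finite \<Rightarrow> nat) \<Rightarrow> ('d \<Rightarrow> nat) \<Rightarrow> real ^ 'd \<Rightarrow> real ^ 'd" where
  "proj_ip p n x = (\<chi> j. max (real (p j) + 1) (min (real (n j) + 1) (x $ j)))"

definition prolongation ::
    "('d::finite \<Rightarrow> nat) \<Rightarrow> ('d \<Rightarrow> nat) \<Rightarrow> 'd elem set \<Rightarrow> 'd elem \<Rightarrow> 'd elem set" where
  "prolongation p n M Q = {Q' \<in> M. proj_ip p n (midpt Q') \<in> frontier (elem_box Q)}"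

text \<open>
  The index T-mesh of \<open>refine (param_mesh t M) N\<close>; it is given on the index level because
  refinement depends on the levels of the elements.
\<close>

definition refine ::
    "('d::{finite,linorder} \<Rightarrow> nat) \<Rightarrow> ('d \<Rightarrow> nat) \<Rightarrow> ('d \<Rightarrow> nat \<Rightarrow> real) \<Rightarrow> 'd elem set \<Rightarrow>
     (real ^ 'd::{finite,linorder}) set set \<Rightarrow> 'd elem set" where
  "refine p n t M N =
     (let C = neighbor_closure p n M {Q \<in> M. param_image t Q \<in> N};
          R = C \<union> (\<Union>Q\<in>C. prolongation p n M Q)
      in (M - R) \<union> (\<Union>Q\<in>R. bisect t Q))"

inductive admissible_index_mesh ::
    "('d::{finite,linorder} \<Rightarrow> nat) \<Rightarrow> ('d \<Rightarrow> nat) \<Rightarrow> ('d \<Rightarrow> nat \<Rightarrow> real) \<Rightarrow> 'd elem set \<Rightarrow> bool"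
  for p n t where
  init: "admissible_index_mesh p n t (initial_index_mesh p n)"
| refine: "admissible_index_mesh p n t M \<Longrightarrow> N \<subseteq> param_mesh t M \<Longrightarrow>
           admissible_index_mesh p n t (refine p n t M N)"

definition admissible_meshes ::
    "('d::{finite,linorder} \<Rightarrow> nat) \<Rightarrow> ('d \<Rightarrow> nat) \<Rightarrow> ('d \<Rightarrow> nat \<Rightarrow> real) \<Rightarrow>
     (real ^ 'd::{finite,linorder}) set set set" where
  "admissible_meshes p n t = {param_mesh t M | M. admissible_index_mesh p n t M}"

definition associated_index_mesh ::
    "('d::{finite,linorder} \<Rightarrow> nat) \<Rightarrow> ('d \<Rightarrow> nat) \<Rightarrow> ('d \<Rightarrow> nat \<Rightarrow> real) \<Rightarrow>
     (real ^ 'd::{finite,linorder}) set set \<Rightarrow> 'd elem set \<Rightarrow> bool" where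
  "associated_index_mesh p n t \<Q> M \<longleftrightarrow> admissible_index_mesh p n t M \<and> param_mesh t M = \<Q>"

end

theory Submission
  imports Defs
begin

text \<open>
  An inner element of level \<open>k\<close> is bisected only after all elements near it have reached level \<open>k\<close>,
  and these neighbourhoods are nested along refinement, so every ancestor \<open>P\<close> of an element has
  only elements of level at least \<open>level P\<close> in its neighbourhood. Suppose that a blending function
  does not vanish on an element \<open>Q\<close> and that one of its local indices \<open>s\<close> lies inside \<open>Q\<close>. Then \<open>s\<close>
  arose by bisecting some \<open>P\<close>. If \<open>P\<close> is finer than \<open>Q\<close>, the grid lines of level \<open>level P\<close>
  in the neighbourhood of \<open>P\<close> are so many that the anchor, and then the whole support of the
  function, cannot leave this neighbourhood; hence \<open>Q\<close> meets it although its level is too small.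
  So \<open>s\<close> can only be the midpoint of \<open>Q\<close> in its next split direction, and all blending functions
  are polynomial on the two halves of \<open>Q\<close>.

  No Bezier element that meets \<open>Q\<close> leaves \<open>Q\<close>: a vertex of \<open>Q\<close> is an anchor, and its knot
  hyperplane separates \<open>Q\<close> from a given point outside, while the polynomial pieces of a univariate
  B-spline on different knot spans are not proportional.
\<close>

section \<open>Univariate B-splines\<close>

text \<open>The radii of the neighbourhoods come from counting. Put c = (p + 1) / 2, the number of
  local indices on either side of an anchor, and let h be the size of \<open>P\<close> in some
  direction. In dimension 2 the radius is (c - 1/2) h in the split direction of \<open>P\<close> and
  (c + 1/2) h in the other one. From the midpoint of \<open>P\<close> the c-th grid line of its
  level in split direction is (c - 1/2) h away; beyond a face, itself h/2 off the midpoint, c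
  further lines reach to (c + 1/2) h. So c lines just fit, the last one on the boundary of the
  neighbourhood. In dimension 3 the radius is (2 c + 1/2) h. Nestedness uses p >= 3 and is sharp for
  p = 3 in dimension 2. The other obstacle is the part of the mesh outside \<open>ip_domain\<close>,
  where knots coincide, bisection may keep the box, and prolongation is given by projected
  midpoints. Its elements are treated as copies of cells at the boundary, so that the inner cells
  determine the mesh and grading concerns only them. The counting then has to follow projected
  anchors.\<close>

lemma bspline_cong:
  assumes "\<And>k. i \<le> k \<Longrightarrow> k \<le> i + q + 1 \<Longrightarrow> \<tau> k = \<sigma> k"
  shows "bspline q \<tau> i x = bspline q \<sigma> i x"
  using assms
proof (induction q arbitrary: i)
  case 0
  then show ?case by simp
next
  case (Suc q)
  have "bspline q \<tau> i x = bspline q \<sigma> i x" "bspline q \<tau> (i + 1) x = bspline q \<sigma> (i + 1) x"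
    by (rule Suc.IH; simp add: Suc.prems)+
  moreover have "\<tau> i = \<sigma> i" "\<tau> (i + 1) = \<sigma> (i + 1)" "\<tau> (i + q + 1) = \<sigma> (i + q + 1)"
      "\<tau> (i + q + 2) = \<sigma> (i + q + 2)"
    by (rule Suc.prems; simp)+
  ultimately show ?case by simp
qed

lemma bspline_eq_0:
  assumes "mono \<tau>" "x < \<tau> i \<or> \<tau> (i + q + 1) \<le> x"
  shows "bspline q \<tau> i x = 0"
  using assms(2)
proof (induction q arbitrary: i)
  case 0
  then show ?case by auto
next
  case (Suc q)
  have "\<tau> i \<le> \<tau> (i + 1)" "\<tau> (i + q + 1) \<le> \<tau> (i + Suc q + 1)"
    using assms(1) by (auto simp: mono_def)
  then have "bspline q \<tau> i x = 0" "bspline q \<tau> (i + 1) x = 0"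
    using Suc.prems by (auto intro!: Suc.IH)
  then show ?case by simp
qed

text \<open>The Cox-de Boor weights are affine, so a recursion step raises the degree by at most
  one; the indicator at the bottom is constant on a half-open interval with no knot strictly inside.
  Knots at \<open>l\<close> or \<open>r\<close> are allowed.\<close>

lemma bspline_polynomial_between_knots:
  assumes "\<And>k. i \<le> k \<Longrightarrow> k \<le> i + q + 1 \<Longrightarrow> \<not> (l < \<tau> k \<and> \<tau> k < r)"
  shows "\<exists>P. degree P \<le> q \<and> (\<forall>x. l \<le> x \<and> x < r \<longrightarrow> bspline q \<tau> i x = poly P x)"
  using assms
proof (induction q arbitrary: i)
  case 0
  have "\<not> (l < \<tau> i \<and> \<tau> i < r)" "\<not> (l < \<tau> (i + 1) \<and> \<tau> (i + 1) < r)"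
    by (rule 0; simp)+
  then have "\<forall>x. l \<le> x \<and> x < r \<longrightarrow>
      bspline 0 \<tau> i x = poly [:if \<tau> i \<le> l \<and> r \<le> \<tau> (i + 1) then 1 else 0:] x"
    by auto
  then show ?case by (metis degree_pCons_0 order.refl)
next
  case (Suc q)
  obtain P where P: "degree P \<le> q" "\<And>x. l \<le> x \<and> x < r \<Longrightarrow> bspline q \<tau> i x = poly P x"
    using Suc.IH[of i] Suc.prems by force
  obtain R where R: "degree R \<le> q" "\<And>x. l \<le> x \<and> x < r \<Longrightarrow> bspline q \<tau> (i + 1) x = poly R x"
    using Suc.IH[of "i + 1"] Suc.prems by force
  define S where "S = [: - \<tau> i / (\<tau> (i + q + 1) - \<tau> i), 1 / (\<tau> (i + q + 1) - \<tau> i) :] * P +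
    [: \<tau> (i + q + 2) / (\<tau> (i + q + 2) - \<tau> (i + 1)), - 1 / (\<tau> (i + q + 2) - \<tau> (i + 1)) :] * R"
  have "degree S \<le> Suc q"
    unfolding S_def using P(1) R(1)
    by (intro degree_add_le order.trans[OF degree_mult_le]) (auto simp: order.trans[OF degree_pCons_le])
  moreover have "bspline (Suc q) \<tau> i x = poly S x" if "l \<le> x \<and> x < r" for x
    using P(2)[OF that] R(2)[OF that] by (simp add: S_def diff_divide_distrib algebra_simps)
  ultimately show ?case by blast
qed

text \<open>The polynomial that \<open>bspline q \<tau> i\<close> equals on the span from
  \<open>\<tau> m\<close> to \<open>\<tau> (m + 1)\<close>: the same recursion carried out on
  polynomials, with the indicator replaced by a comparison of span numbers. Derivatives thus become
  algebraic.\<close>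

fun bspline_piece :: "nat \<Rightarrow> (nat \<Rightarrow> real) \<Rightarrow> nat \<Rightarrow> nat \<Rightarrow> real poly" where
  "bspline_piece 0 \<tau> m i = (if i = m then 1 else 0)"
| "bspline_piece (Suc q) \<tau> m i =
     smult (1 / (\<tau> (i + q + 1) - \<tau> i)) ([:- \<tau> i, 1:] * bspline_piece q \<tau> m i) +
     smult (1 / (\<tau> (i + q + 2) - \<tau> (i + 1))) ([:\<tau> (i + q + 2), - 1:] * bspline_piece q \<tau> m (i + 1))"

lemma degree_bspline_piece: "degree (bspline_piece q \<tau> m i) \<le> q"
proof (induction q arbitrary: i)
  case (Suc q)
  have "degree (bspline_piece q \<tau> m k) \<le> q" for k
    by (rule Suc)
  then show ?case
    by (auto intro!: degree_add_le order.trans[OF degree_smult_le] order.trans[OF degree_mult_le]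
        simp: order.trans[OF degree_pCons_le] simp del: mult_pCons_left)
qed auto

lemma bspline_piece_eq_0: "m < i \<or> i + q < m \<Longrightarrow> bspline_piece q \<tau> m i = 0"
  by (induction q arbitrary: i) auto

lemma bspline_eq_piece:
  assumes "mono \<tau>" "\<tau> m \<le> x" "x < \<tau> (m + 1)"
  shows "bspline q \<tau> i x = poly (bspline_piece q \<tau> m i) x"
proof (induction q arbitrary: i)
  case 0
  have "m = i" if "\<tau> i \<le> x" "x < \<tau> (i + 1)"
  proof -
    have "\<not> m + 1 \<le> i" "\<not> i + 1 \<le> m"
      using assms that by (meson monoD not_le order.trans)+
    then show ?thesis by simp
  qed
  then show ?case using assms(2,3) by (cases "i = m") auto
next
  case (Suc q)
  then show ?case by (simp add: algebra_simps diff_divide_distrib)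
qed

declare bspline_piece.simps(2)[simp del]

text \<open>The classical derivative formula, as a polynomial identity that also covers repeated
  knots. The product rule leaves two multiples of the middle spline of lower degree, and these have
  to cancel.\<close>

lemma pderiv_bspline_piece:
  assumes "mono \<tau>"
  shows "pderiv (bspline_piece (Suc q) \<tau> m i) = smult (real (Suc q))
    (smult (1 / (\<tau> (i + q + 1) - \<tau> i)) (bspline_piece q \<tau> m i) -
     smult (1 / (\<tau> (i + q + 2) - \<tau> (i + 1))) (bspline_piece q \<tau> m (i + 1)))"
proof (induction q arbitrary: i)
  case 0
  then show ?case by (simp add: bspline_piece.simps pderiv_pCons)
next
  case (Suc q)
  define e where "e k = \<tau> (k + q + 1) - \<tau> k" for k
  define f where "f k = \<tau> (k + q + 2) - \<tau> k" for k
  define b where "b k = bspline_piece q \<tau> m k" for k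
  define b' where "b' k = bspline_piece (Suc q) \<tau> m k" for k
  have IH: "pderiv (b' k) = smult (real (Suc q)) (smult (1 / e k) (b k) - smult (1 / e (k + 1)) (b (k + 1)))" for k
    using Suc[of k] by (simp add: e_def b_def b'_def add.commute add.left_commute)
  have rec: "b' k = smult (1 / e k) ([:- \<tau> k, 1:] * b k) +
      smult (1 / e (k + 1)) ([:\<tau> (k + q + 2), - 1:] * b (k + 1))" for k
    by (simp add: b'_def b_def e_def bspline_piece.simps)
  \<comment> \<open>A collapsed support of either spline of degree \<open>Suc q\<close> forces
    \<open>e (i + 1) = 0\<close>. Division by zero then makes \<open>B (i + 1)\<close> vanish, so
    the cancellation below survives repeated knots.\<close>
  have e: "e (i + 1) = 0 \<or> (f i \<noteq> 0 \<and> f (i + 1) \<noteq> 0)"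
  proof -
    have "e (i + 1) \<le> f i" "e (i + 1) \<le> f (i + 1)" "0 \<le> e (i + 1)"
      using assms by (auto simp: e_def f_def mono_def)
    then show ?thesis by auto
  qed
  have "bspline_piece (Suc (Suc q)) \<tau> m i = smult (1 / f i) ([:- \<tau> i, 1:] * b' i) +
      smult (1 / f (i + 1)) ([:\<tau> (i + q + 3), - 1:] * b' (i + 1))"
    by (simp add: b'_def f_def numeral_3_eq_3 bspline_piece.simps(2)[of "Suc q"])
  then have L: "pderiv (bspline_piece (Suc (Suc q)) \<tau> m i) =
      smult (1 / f i) (b' i + [:- \<tau> i, 1:] * pderiv (b' i)) +
      smult (1 / f (i + 1)) (- b' (i + 1) + [:\<tau> (i + q + 3), - 1:] * pderiv (b' (i + 1)))"
    by (simp only: pderiv_add pderiv_smult pderiv_mult) (simp add: pderiv_pCons smult_add_right)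
  have "poly (pderiv (bspline_piece (Suc (Suc q)) \<tau> m i)) x =
      real (Suc (Suc q)) * (1 / f i * poly (b' i) x - 1 / f (i + 1) * poly (b' (i + 1)) x)" for x
  proof -
    define B where "B k = poly (b k) x / e k" for k
    have r: "poly (b' k) x = (x - \<tau> k) * B k + (\<tau> (k + q + 2) - x) * B (k + 1)" for k
      unfolding rec B_def by (simp add: algebra_simps diff_divide_distrib)
    have d: "poly (pderiv (b' k)) x = real (Suc q) * (B k - B (k + 1))" for k
      unfolding IH B_def by simp
    have B1: "f i / f i * B (i + 1) = f (i + 1) / f (i + 1) * B (i + 1)"
      using e by (auto simp: B_def)
    have f: "\<tau> (i + q + 2) = \<tau> i + f i" "\<tau> (i + q + 3) = \<tau> (i + 1) + f (i + 1)"
      by (simp_all add: f_def numeral_3_eq_3)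
    define g h where "g = 1 / f i" and "h = 1 / f (i + 1)"
    have B1': "f i * g * B (i + 1) = f (i + 1) * h * B (i + 1)"
      using B1 by (simp add: g_def h_def)
    have ri: "poly (b' i) x = (x - \<tau> i) * B i + (\<tau> i + f i - x) * B (i + 1)"
      using r[of i] f by simp
    have ri1: "poly (b' (i + 1)) x = (x - \<tau> (i + 1)) * B (i + 1) + (\<tau> (i + 1) + f (i + 1) - x) * B (i + 2)"
      using r[of "i + 1"] f by (simp add: numeral_3_eq_3)
    have "poly (pderiv (bspline_piece (Suc (Suc q)) \<tau> m i)) x =
        g * (poly (b' i) x + (x - \<tau> i) * (real (Suc q) * (B i - B (i + 1)))) +
        h * (- poly (b' (i + 1)) x + (\<tau> (i + 1) + f (i + 1) - x) * (real (Suc q) * (B (i + 1) - B (i + 2))))"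
    proof -
      have "poly [:- \<tau> i, 1:] x = x - \<tau> i"
          "poly [:\<tau> (i + q + 3), - 1:] x = \<tau> (i + 1) + f (i + 1) - x"
        using f by simp_all
      then show ?thesis
        unfolding L g_def h_def poly_add poly_smult poly_mult poly_minus d
        by (simp add: numeral_2_eq_2 algebra_simps)
    qed
    also have "\<dots> = real (Suc (Suc q)) * (g * poly (b' i) x - h * poly (b' (i + 1)) x) +
        real (Suc q) * (f (i + 1) * h * B (i + 1) - f i * g * B (i + 1))"
      unfolding ri ri1 by (simp add: algebra_simps)
    also have "\<dots> = real (Suc (Suc q)) * (g * poly (b' i) x - h * poly (b' (i + 1)) x)"
      unfolding B1' by simp
    finally show ?thesis by (simp add: g_def h_def)
  qed
  then show ?case
    by (intro poly_ext) (simp add: b'_def f_def numeral_2_eq_2 numeral_3_eq_3)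
qed

text \<open>
  The derivative of order one less than the degree is affine on every knot span, and its zero
  identifies the span. This is what separates the pieces of a B-spline from each other.
\<close>

lemma higher_pderiv_bspline_piece_sign:
  fixes \<tau> :: "nat \<Rightarrow> real"
  assumes "mono \<tau>" "\<tau> m < \<tau> (m + 1)" "i \<le> m" "m \<le> i + Suc q"
  defines "v \<equiv> \<lambda>q i y. (- 1) ^ (m + i) * poly ((pderiv ^^ q) (bspline_piece (Suc q) \<tau> m i)) y"
  shows "v q i (\<tau> m) \<le> 0 \<and> (i < m \<longrightarrow> v q i (\<tau> m) < 0) \<and>
    0 \<le> v q i (\<tau> (m + 1)) \<and> (m < i + Suc q \<longrightarrow> 0 < v q i (\<tau> (m + 1)))"
  using assms(3,4)
proof (induction q arbitrary: i)
  case 0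
  \<comment> \<open>The hat function: a rising piece on the first span and a falling one on the
    second, whose sign is turned by the factor \<open>(- 1) ^ (m + i)\<close>.\<close>
  then have "m = i \<or> m = i + 1" by auto
  then show ?case
    using assms(2) by (auto simp: v_def bspline_piece.simps)
next
  case (Suc q)
  define d where "d = \<tau> (i + q + 2) - \<tau> i"
  define d' where "d' = \<tau> (i + q + 3) - \<tau> (i + 1)"
  have "0 \<le> d" "0 \<le> d'" using assms(1) by (auto simp: d_def d'_def mono_def)
  have d: "0 < d" if "m \<le> i + q + 1"
  proof -
    have "\<tau> i \<le> \<tau> m" "\<tau> (m + 1) \<le> \<tau> (i + q + 2)"
      using assms(1) that Suc.prems by (auto simp: mono_def)
    then show ?thesis using assms(2) by (simp add: d_def)
  qed
  have d': "0 < d'" if "i + 1 \<le> m"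
  proof -
    have "\<tau> (i + 1) \<le> \<tau> m" "\<tau> (m + 1) \<le> \<tau> (i + q + 3)"
      using assms(1) that Suc.prems by (auto simp: mono_def)
    then show ?thesis using assms(2) by (simp add: d'_def)
  qed
  have z: "v q k y = 0" if "m < k \<or> k + Suc q < m" for k y
    using bspline_piece_eq_0[of m k "Suc q" \<tau>] that by (simp add: v_def)
  \<comment> \<open>The minus sign of the derivative formula is absorbed, since the sign factor of
    \<open>v\<close> changes with \<open>i\<close>. Both summands have the same sign at each end of
    the span, so one strict inequality is enough.\<close>
  have v: "v (Suc q) i y = real (Suc (Suc q)) * (v q i y / d + v q (i + 1) y / d')" for y
  proof -
    have dd: "pderiv (bspline_piece (Suc (Suc q)) \<tau> m i) = smult (real (Suc (Suc q)))
      (smult (1 / d) (bspline_piece (Suc q) \<tau> m i) + smult (- 1 / d') (bspline_piece (Suc q) \<tau> m (i + 1)))"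
      using pderiv_bspline_piece[OF assms(1), of "Suc q" m i]
      by (simp add: d_def d'_def numeral_3_eq_3)
    show ?thesis
      unfolding v_def funpow_Suc_right o_apply dd higher_pderiv_smult higher_pderiv_add
      by (simp add: algebra_simps diff_divide_distrib)
  qed
  have 1: "v q i (\<tau> m) / d \<le> 0" "0 \<le> v q i (\<tau> (m + 1)) / d"
  proof -
    have "v q i (\<tau> m) \<le> 0 \<and> 0 \<le> v q i (\<tau> (m + 1))"
      using Suc.IH[of i] z[of i] Suc.prems by (cases "m \<le> i + Suc q") auto
    then show "v q i (\<tau> m) / d \<le> 0" "0 \<le> v q i (\<tau> (m + 1)) / d"
      using \<open>0 \<le> d\<close> by (auto simp: divide_le_0_iff)
  qed
  have 2: "v q (i + 1) (\<tau> m) / d' \<le> 0" "0 \<le> v q (i + 1) (\<tau> (m + 1)) / d'"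
  proof -
    have "v q (i + 1) (\<tau> m) \<le> 0 \<and> 0 \<le> v q (i + 1) (\<tau> (m + 1))"
      using Suc.IH[of "i + 1"] z[of "i + 1"] Suc.prems by (cases "i + 1 \<le> m") auto
    then show "v q (i + 1) (\<tau> m) / d' \<le> 0" "0 \<le> v q (i + 1) (\<tau> (m + 1)) / d'"
      using \<open>0 \<le> d'\<close> by (auto simp: divide_le_0_iff)
  qed
  have 3: "v q i (\<tau> m) / d + v q (i + 1) (\<tau> m) / d' < 0" if "i < m"
  proof (cases "m \<le> i + q + 1")
    case True
    then have "v q i (\<tau> m) / d < 0"
      using Suc.IH[of i] that d by (simp add: divide_neg_pos)
    then show ?thesis using 2 by simp
  next
    case False
    then have "v q (i + 1) (\<tau> m) / d' < 0"
      using Suc.IH[of "i + 1"] Suc.prems that d' by (simp add: divide_neg_pos)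
    then show ?thesis using 1 by simp
  qed
  have 4: "0 < v q i (\<tau> (m + 1)) / d + v q (i + 1) (\<tau> (m + 1)) / d'" if "m < i + Suc (Suc q)"
  proof (cases "m = i")
    case True
    then have "0 < v q i (\<tau> (m + 1)) / d"
      using Suc.IH[of i] that d by simp
    then show ?thesis using 2 by simp
  next
    case False
    then have "0 < v q (i + 1) (\<tau> (m + 1)) / d'"
      using Suc.IH[of "i + 1"] Suc.prems that d' by simp
    then show ?thesis using 1 by simp
  qed
  show ?case
    unfolding v using 1 2 3 4
    by (auto simp: mult_le_0_iff mult_less_0_iff zero_less_mult_iff simp del: of_nat_Suc)
qed

text \<open>After q - 1 derivatives both pieces are affine and, up to sign, increasing. The zero of
  the first lies in \<open>[\<tau> m, \<tau> (m + 1))\<close>, that of the second in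
  \<open>(\<tau> m', \<tau> (m' + 1)]\<close>. As \<open>m < m'\<close>, the zeros differ, so no
  nontrivial multiples agree.\<close>

lemma bspline_piece_not_proportional:
  fixes \<tau> :: "nat \<Rightarrow> real"
  assumes "mono \<tau>" "\<tau> m < \<tau> (m + 1)" "\<tau> m' < \<tau> (m' + 1)" "m < m'" "m' \<le> q"
    and eq: "smult a (bspline_piece q \<tau> m 0) = smult b (bspline_piece q \<tau> m' 0)"
  shows "a = 0 \<and> b = 0"
proof -
  obtain k where k: "q = Suc k" using assms(4,5) by (cases q) auto
  define P where "P j = (pderiv ^^ k) (bspline_piece (Suc k) \<tau> j 0)" for j
  define f where "f j y = (- 1) ^ j * poly (P j) y" for j y
  have deg: "degree (P j) \<le> 1" for j
    using degree_bspline_piece[of "Suc k" \<tau> j 0] unfolding P_def degree_higher_pderiv by simp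
  have "P j = [:coeff (P j) 0, coeff (P j) 1:]" for j
    by (auto intro!: poly_eqI coeff_eq_0 le_less_trans[OF deg] simp: coeff_pCons split: nat.split)
  then have "poly (P j) y = coeff (P j) 0 + y * coeff (P j) 1" for j y
    by (metis add.right_neutral mult_zero_right poly_0 poly_pCons)
  then have aff: "f j y = f j 0 + (f j 1 - f j 0) * y" for j y
    by (simp add: f_def algebra_simps)
  have f: "f m (\<tau> m) \<le> 0" "0 < f m (\<tau> (m + 1))" "f m' (\<tau> m') < 0" "0 \<le> f m' (\<tau> (m' + 1))"
    using higher_pderiv_bspline_piece_sign[of \<tau> m 0 k] higher_pderiv_bspline_piece_sign[of \<tau> m' 0 k] assms k
    by (auto simp: f_def P_def)
  define s s' where "s = f m 1 - f m 0" and "s' = f m' 1 - f m' 0"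
  have "0 < s * (\<tau> (m + 1) - \<tau> m)" "0 < s' * (\<tau> (m' + 1) - \<tau> m')"
    using f aff[of m "\<tau> m"] aff[of m "\<tau> (m + 1)"] aff[of m' "\<tau> m'"] aff[of m' "\<tau> (m' + 1)"]
    unfolding s_def[symmetric] s'_def[symmetric] right_diff_distrib by linarith+
  then have s: "0 < s" "0 < s'"
    using assms(2,3) by (auto simp: zero_less_mult_iff)
  define A B where "A = a * (- 1) ^ m" and "B = b * (- 1) ^ m'"
  have "(pderiv ^^ k) (smult a (bspline_piece q \<tau> m 0)) = (pderiv ^^ k) (smult b (bspline_piece q \<tau> m' 0))"
    using eq by simp
  then have "a * poly (P m) y = b * poly (P m') y" for y
    unfolding higher_pderiv_smult k P_def[symmetric] by (metis poly_smult)
  then have E: "A * f m y = B * f m' y" for y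
    by (auto simp: A_def B_def f_def minus_one_power_iff)
  \<comment> \<open>Equal slopes force \<open>A\<close> and \<open>B\<close> to have the same sign
    or both to vanish. At \<open>\<tau> m'\<close> the first affine function is positive and the
    second negative, which leaves only the latter.\<close>
  have "A * s = B * s'"
    using E[of 1] E[of 0] by (simp add: s_def s'_def right_diff_distrib)
  moreover have "\<tau> (m + 1) \<le> \<tau> m'" using assms(1,4) by (auto simp: mono_def)
  then have "s * \<tau> (m + 1) \<le> s * \<tau> m'" using s by simp
  then have "0 < f m (\<tau> m')"
    using f(2) aff[of m "\<tau> (m + 1)"] aff[of m "\<tau> m'"] unfolding s_def[symmetric] by linarith
  moreover note E[of "\<tau> m'"] f(3) s
  ultimately have "A = 0 \<and> B = 0"
    by (smt (verit) mult_pos_pos mult_neg_pos mult_pos_neg mult_neg_neg mult_eq_0_iff)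
  then show ?thesis by (simp add: A_def B_def)
qed

text \<open>Its derivative of order q - 1 does not vanish at the right end of the span if
  \<open>m = 0\<close>, and at the left end otherwise.\<close>

lemma bspline_piece_nonzero:
  assumes "mono \<tau>" "\<tau> m < \<tau> (m + 1)" "m \<le> q" "1 \<le> q"
  shows "bspline_piece q \<tau> m 0 \<noteq> 0"
proof
  assume *: "bspline_piece q \<tau> m 0 = 0"
  obtain k where k: "q = Suc k" using assms(4) by (cases q) auto
  show False
    using higher_pderiv_bspline_piece_sign[of \<tau> m 0 k] assms * k by (cases "m = 0") auto
qed

lemma knot_span_exists:
  fixes \<tau> :: "nat \<Rightarrow> real"
  assumes "\<tau> 0 \<le> x" "x < \<tau> (q + 1)"
  shows "\<exists>m\<le>q. \<tau> m \<le> x \<and> x < \<tau> (m + 1)"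
  using assms(2)
proof (induction q)
  case 0
  then show ?case using assms(1) by auto
next
  case (Suc q)
  then show ?case by (cases "x < \<tau> (q + 1)") (auto simp: le_Suc_eq)
qed

section \<open>Polynomials in several variables\<close>

definition mpoly_eval ::
    "('d::finite \<Rightarrow> nat) \<Rightarrow> (('d \<Rightarrow> nat) \<Rightarrow> real) \<Rightarrow> real ^ 'd \<Rightarrow> real" where
  "mpoly_eval p c x = (\<Sum>\<alpha> | \<forall>j. \<alpha> j \<le> p j. c \<alpha> * (\<Prod>j\<in>UNIV. (x $ j) ^ \<alpha> j))"

lemma polynomial_on_iff: "polynomial_on p U f \<longleftrightarrow> (\<exists>c. \<forall>x\<in>U. f x = mpoly_eval p c x)"
  by (simp add: polynomial_on_def mpoly_eval_def)

lemma polynomial_on_subset: "polynomial_on p U f \<Longrightarrow> V \<subseteq> U \<Longrightarrow> polynomial_on p V f"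
  by (auto simp: polynomial_on_iff)

lemma mpoly_eval_prod_poly:
  fixes P :: "'d::finite \<Rightarrow> real poly"
  assumes "\<And>j. degree (P j) \<le> p j"
  shows "\<exists>c. \<forall>x. (\<Prod>j\<in>UNIV. poly (P j) (x $ j)) = mpoly_eval p c x"
proof -
  have set_eq: "{\<alpha>. \<forall>j. \<alpha> j \<le> p j} = PiE UNIV (\<lambda>j. {..p j})"
    by (auto simp: PiE_def Pi_def extensional_def)
  have "poly (P j) y = (\<Sum>k\<le>p j. coeff (P j) k * y ^ k)" for j y
    unfolding poly_altdef using assms[of j]
    by (intro sum.mono_neutral_left) (auto simp: coeff_eq_0)
  then have "(\<Prod>j\<in>UNIV. poly (P j) (x $ j)) =
      mpoly_eval p (\<lambda>\<alpha>. \<Prod>j\<in>UNIV. coeff (P j) (\<alpha> j)) x" for x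
    by (simp add: prod_sum_PiE mpoly_eval_def set_eq prod.distrib)
  then show ?thesis by blast
qed

text \<open>On the line through \<open>y\<close> and a point of \<open>U\<close> both sides are
  univariate polynomials in the parameter. They agree on a nonempty open set of parameters, hence at
  infinitely many, and so at the parameter 1 that gives \<open>y\<close>.\<close>

lemma mpoly_eval_eq_on_open:
  assumes "open U" "U \<noteq> {}" "\<And>x. x \<in> U \<Longrightarrow> mpoly_eval p c x = mpoly_eval p c' x"
  shows "mpoly_eval p c y = mpoly_eval p c' y"
proof -
  obtain x where x: "x \<in> U" using assms(2) by auto
  define v where "v = y - x"
  have line: "\<exists>R. \<forall>s. mpoly_eval p c (x + s *\<^sub>R v) = poly R s" for c
  proof
    show "\<forall>s. mpoly_eval p c (x + s *\<^sub>R v) =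
        poly (\<Sum>\<alpha> | \<forall>j. \<alpha> j \<le> p j. smult (c \<alpha>) (\<Prod>j\<in>UNIV. [:x $ j, v $ j:] ^ \<alpha> j)) s"
      by (simp add: mpoly_eval_def poly_sum poly_prod)
  qed
  obtain R where R: "\<And>s. mpoly_eval p c (x + s *\<^sub>R v) = poly R s" using line by blast
  obtain R' where R': "\<And>s. mpoly_eval p c' (x + s *\<^sub>R v) = poly R' s" using line by blast
  have "open ((\<lambda>s. x + s *\<^sub>R v) -` U)"
    by (intro open_vimage assms(1) continuous_intros)
  moreover have "0 \<in> (\<lambda>s. x + s *\<^sub>R v) -` U" using x by simp
  ultimately have "infinite ((\<lambda>s. x + s *\<^sub>R v) -` U)"
    using finite_imp_not_open by blast
  moreover have "(\<lambda>s. x + s *\<^sub>R v) -` U \<subseteq> {s. poly (R - R') s = 0}"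
    using assms(3)[of "x + _ *\<^sub>R v"] R R' by (simp add: subset_iff)
  ultimately have "infinite {s. poly (R - R') s = 0}"
    using finite_subset by blast
  then have "R - R' = 0" using poly_roots_finite by blast
  then show ?thesis using R[of 1] R'[of 1] by (simp add: v_def)
qed

section \<open>Halving a box\<close>

lemma box_halves:
  fixes a b :: "real ^ 'd::finite" and j :: 'd
  assumes ne: "\<And>i. a $ i < b $ i"
  defines "m \<equiv> (a $ j + b $ j) / 2"
  defines "Q1 \<equiv> {x \<in> box a b. x $ j < m}" and "Q2 \<equiv> {x \<in> box a b. m < x $ j}"
  shows "open Q1" "open Q2" "Q1 \<noteq> {}" "Q2 \<noteq> {}"
    "{x \<in> box a b. x $ j \<le> m} \<subseteq> closure Q1" "{x \<in> box a b. m \<le> x $ j} \<subseteq> closure Q2"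
    "measure lborel Q1 = measure lborel (box a b) / 2"
    "measure lborel Q2 = measure lborel (box a b) / 2"
proof -
  define b' where "b' = (\<chi> i. if i = j then m else b $ i)"
  define a' where "a' = (\<chi> i. if i = j then m else a $ i)"
  have m: "a $ j < m" "m < b $ j" using ne[of j] by (auto simp: m_def)
  have Q1: "Q1 = box a b'"
    using m by (auto simp: Q1_def b'_def mem_box_cart split: if_splits) (metis order.strict_trans)
  have Q2: "Q2 = box a' b"
    using m by (auto simp: Q2_def a'_def mem_box_cart split: if_splits) (metis order.strict_trans)
  have ne1: "a $ i < b' $ i" and ne2: "a' $ i < b $ i" for i
    using m ne by (auto simp: a'_def b'_def)
  show "open Q1" "open Q2" "Q1 \<noteq> {}" "Q2 \<noteq> {}"
    using ne1 ne2 by (auto simp: Q1 Q2 interval_ne_empty_cart)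
  then have cl: "closure Q1 = cbox a b'" "closure Q2 = cbox a' b"
    by (simp_all add: Q1 Q2 closure_box)
  show "{x \<in> box a b. x $ j \<le> m} \<subseteq> closure Q1" "{x \<in> box a b. m \<le> x $ j} \<subseteq> closure Q2"
    unfolding cl by (auto simp: mem_box_cart a'_def b'_def less_imp_le)
  have meas: "measure lborel (box l u) = (\<Prod>i\<in>UNIV. u $ i - l $ i)"
    if "\<And>i. l $ i < u $ i" for l u :: "real ^ 'd"
  proof -
    have "cbox l u \<noteq> {}" using that by (auto simp: interval_ne_empty_cart less_imp_le)
    from content_cbox_cart[OF this] show ?thesis
      by (simp add: measure_lborel_box_eq measure_lborel_cbox_eq)
  qed
  have "measure lborel Q1 = (b' $ j - a $ j) * (\<Prod>i\<in>UNIV - {j}. b' $ i - a $ i)"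
    unfolding Q1 meas[OF ne1] by (subst prod.remove[of _ j]) auto
  also have "(\<Prod>i\<in>UNIV - {j}. b' $ i - a $ i) = (\<Prod>i\<in>UNIV - {j}. b $ i - a $ i)"
    by (intro prod.cong) (auto simp: b'_def)
  also have "(b' $ j - a $ j) * \<dots> = (b $ j - a $ j) * \<dots> / 2"
    by (simp add: b'_def m_def field_simps)
  also have "(b $ j - a $ j) * (\<Prod>i\<in>UNIV - {j}. b $ i - a $ i) = measure lborel (box a b)"
    unfolding meas[OF ne] by (subst prod.remove[of UNIV j]) auto
  finally show "measure lborel Q1 = measure lborel (box a b) / 2" .
  have "measure lborel Q2 = (b $ j - a' $ j) * (\<Prod>i\<in>UNIV - {j}. b $ i - a' $ i)"
    unfolding Q2 meas[OF ne2] by (subst prod.remove[of _ j]) auto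
  also have "(\<Prod>i\<in>UNIV - {j}. b $ i - a' $ i) = (\<Prod>i\<in>UNIV - {j}. b $ i - a $ i)"
    by (intro prod.cong) (auto simp: a'_def)
  also have "(b $ j - a' $ j) * \<dots> = (b $ j - a $ j) * \<dots> / 2"
    by (simp add: a'_def m_def field_simps)
  also have "(b $ j - a $ j) * (\<Prod>i\<in>UNIV - {j}. b $ i - a $ i) = measure lborel (box a b)"
    unfolding meas[OF ne] by (subst prod.remove[of UNIV j]) auto
  finally show "measure lborel Q2 = measure lborel (box a b) / 2" .
qed

section \<open>Bezier elements in a box\<close>

text \<open>
  B-splines are continuous from the right by definition. The upper half therefore includes the
  midplane, and continuity across the midplane is not needed.
\<close>

lemma one_or_two_bezier_elements:
  fixes a b :: "real ^ 'd::finite" and j :: 'd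
  assumes ne: "\<And>i. a $ i < b $ i" and dom: "box a b \<subseteq> param_domain"
    and inside: "\<And>V. bezier_candidate p n t M V \<Longrightarrow> V \<inter> box a b \<noteq> {} \<Longrightarrow> V \<subseteq> box a b"
    and lower: "\<And>z. z \<in> anchors p n M \<Longrightarrow>
      polynomial_on p {x \<in> box a b. x $ j < (a $ j + b $ j) / 2} (blending p n t M z)"
    and upper: "\<And>z. z \<in> anchors p n M \<Longrightarrow>
      polynomial_on p {x \<in> box a b. (a $ j + b $ j) / 2 \<le> x $ j} (blending p n t M z)"
  shows "consists_of_bezier p n t M (box a b) {box a b} \<or>
    (\<exists>B\<^sub>1 B\<^sub>2. B\<^sub>1 \<noteq> B\<^sub>2 \<and> consists_of_bezier p n t M (box a b) {B\<^sub>1, B\<^sub>2} \<and>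
       measure lborel B\<^sub>1 = measure lborel (box a b) / 2 \<and>
       measure lborel B\<^sub>2 = measure lborel (box a b) / 2)"
proof -
  define m where "m = (a $ j + b $ j) / 2"
  define Q where "Q = box a b"
  define Q1 where "Q1 = {x \<in> Q. x $ j < m}"
  define Q2 where "Q2 = {x \<in> Q. m < x $ j}"
  define cand where "cand = bezier_candidate p n t M"
  note halves = box_halves[OF ne, of j, folded m_def Q_def, folded Q1_def Q2_def]
  have inside: "V \<subseteq> Q" if "cand V" "V \<inter> Q \<noteq> {}" for V
    using inside that by (simp add: Q_def cand_def)
  have Q0: "open Q" "Q \<noteq> {}" using ne by (auto simp: Q_def interval_ne_empty_cart)
  have "Q1 \<subseteq> Q" "Q2 \<subseteq> Q" by (auto simp: Q1_def Q2_def)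
  have cand12: "cand Q1" "cand Q2"
    using halves lower upper dom
    by (auto simp: cand_def bezier_candidate_def Q1_def Q2_def m_def Q_def
        intro: polynomial_on_subset[of p "{x \<in> box a b. (a $ j + b $ j) / 2 \<le> x $ j}"])
  have maximal: "B \<in> bezier_mesh p n t M \<longleftrightarrow> cand B \<and> (\<forall>V. cand V \<and> B \<subseteq> V \<longrightarrow> V = B)" for B
    by (simp add: bezier_mesh_def cand_def)
  show ?thesis unfolding Q_def[symmetric]
  proof (cases "cand Q")
    case True
    have "B = Q" if "B \<in> bezier_mesh p n t M" "B \<inter> Q \<noteq> {}" for B
      using that inside True by (metis maximal)
    moreover have "Q \<in> bezier_mesh p n t M"
      using inside True Q0 unfolding maximal by (metis inf.absorb2 subset_antisym)
    ultimately have F: "{Q} = {B \<in> bezier_mesh p n t M. B \<inter> Q \<noteq> {}}"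
      using Q0 by auto
    have "consists_of_bezier p n t M Q {Q}"
      unfolding consists_of_bezier_def
      by (rule conjI, rule F) (use closure_subset[of Q] in \<open>simp add: disjoint_def\<close>)
    then show "consists_of_bezier p n t M Q {Q} \<or>
      (\<exists>B\<^sub>1 B\<^sub>2. B\<^sub>1 \<noteq> B\<^sub>2 \<and> consists_of_bezier p n t M Q {B\<^sub>1, B\<^sub>2} \<and>
       measure lborel B\<^sub>1 = measure lborel Q / 2 \<and> measure lborel B\<^sub>2 = measure lborel Q / 2)"
      by blast
  next
    case False
    \<comment> \<open>A candidate that meets both halves carries one polynomial, which by the
      identity theorem equals the polynomials of both halves. Then \<open>Q\<close> itself would be
      a candidate.\<close>
    have not_both: "V \<inter> Q1 = {} \<or> V \<inter> Q2 = {}" if V: "cand V" for V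
    proof (rule ccontr)
      assume *: "\<not> (V \<inter> Q1 = {} \<or> V \<inter> Q2 = {})"
      have "open V" using V by (simp add: cand_def bezier_candidate_def)
      have "polynomial_on p Q (blending p n t M z)" if z: "z \<in> anchors p n M" for z
      proof -
        obtain c where c: "\<And>x. x \<in> V \<Longrightarrow> blending p n t M z x = mpoly_eval p c x"
          using V z by (auto simp: cand_def bezier_candidate_def polynomial_on_iff)
        obtain c1 where c1: "\<And>x. x \<in> Q1 \<Longrightarrow> blending p n t M z x = mpoly_eval p c1 x"
          using lower[OF z] by (auto simp: Q1_def Q_def m_def polynomial_on_iff)
        obtain c2 where c2: "\<And>x. x \<in> Q \<Longrightarrow> m \<le> x $ j \<Longrightarrow> blending p n t M z x = mpoly_eval p c2 x"
          using upper[OF z] by (auto simp: Q_def m_def polynomial_on_iff)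
        have "mpoly_eval p c1 x = mpoly_eval p c x" for x
        proof (rule mpoly_eval_eq_on_open[of "V \<inter> Q1"])
          show "mpoly_eval p c1 y = mpoly_eval p c y" if "y \<in> V \<inter> Q1" for y
            using c[of y] c1[of y] that by simp
        qed (use * \<open>open V\<close> halves(1) in auto)
        moreover have "mpoly_eval p c2 x = mpoly_eval p c x" for x
        proof (rule mpoly_eval_eq_on_open[of "V \<inter> Q2"])
          show "mpoly_eval p c2 y = mpoly_eval p c y" if "y \<in> V \<inter> Q2" for y
            using c[of y] c2[of y] that by (simp add: Q2_def)
        qed (use * \<open>open V\<close> halves(2) in auto)
        ultimately have "blending p n t M z x = mpoly_eval p c x" if "x \<in> Q" for x
          using c1[of x] c2[of x] that by (cases "x $ j < m") (auto simp: Q1_def)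
        then show ?thesis by (auto simp: polynomial_on_iff)
      qed
      then have "cand Q" using dom Q0 by (simp add: cand_def bezier_candidate_def Q_def)
      then show False using False by simp
    qed
    have sub1: "V \<subseteq> Q1" if V: "cand V" "V \<inter> Q1 \<noteq> {}" for V
    proof -
      have "open V" using V by (simp add: cand_def bezier_candidate_def)
      \<comment> \<open>An open set that misses \<open>Q2\<close> misses its closure too, and with
        it the midplane.\<close>
      then have "V \<inter> closure Q2 = {}"
        using not_both[OF V(1)] V(2) open_Int_closure_eq_empty by blast
      moreover have "V \<subseteq> Q" using inside[OF V(1)] V(2) \<open>Q1 \<subseteq> Q\<close> by auto
      ultimately show ?thesis using halves(6) by (auto simp: Q1_def not_le[symmetric])
    qed
    have sub2: "V \<subseteq> Q2" if V: "cand V" "V \<inter> Q2 \<noteq> {}" for V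
    proof -
      have "open V" using V by (simp add: cand_def bezier_candidate_def)
      then have "V \<inter> closure Q1 = {}"
        using not_both[OF V(1)] V(2) open_Int_closure_eq_empty by blast
      moreover have "V \<subseteq> Q" using inside[OF V(1)] V(2) \<open>Q2 \<subseteq> Q\<close> by auto
      ultimately show ?thesis using halves(5) by (auto simp: Q2_def not_le[symmetric])
    qed
    have "B = Q1 \<or> B = Q2" if B: "B \<in> bezier_mesh p n t M" "B \<inter> Q \<noteq> {}" for B
    proof -
      have "cand B" using B maximal by blast
      then have "open B" by (simp add: cand_def bezier_candidate_def)
      have "Q \<subseteq> closure Q1 \<union> closure Q2" using halves(5,6) by fastforce
      then have "B \<inter> closure Q1 \<noteq> {} \<or> B \<inter> closure Q2 \<noteq> {}" using B by blast
      then have "B \<inter> Q1 \<noteq> {} \<or> B \<inter> Q2 \<noteq> {}"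
        using \<open>open B\<close> open_Int_closure_eq_empty by blast
      then show ?thesis
        using sub1[OF \<open>cand B\<close>] sub2[OF \<open>cand B\<close>] cand12 B(1) unfolding maximal by blast
    qed
    moreover have "Q1 \<in> bezier_mesh p n t M" "Q2 \<in> bezier_mesh p n t M"
      using cand12 sub1 sub2 halves(3,4) unfolding maximal by (metis inf.absorb2 subset_antisym)+
    ultimately have F: "{Q1, Q2} = {B \<in> bezier_mesh p n t M. B \<inter> Q \<noteq> {}}"
      using halves(3,4) \<open>Q1 \<subseteq> Q\<close> \<open>Q2 \<subseteq> Q\<close> by auto
    have "Q1 \<inter> Q2 = {}" by (auto simp: Q1_def Q2_def)
    moreover have "Q1 \<noteq> Q2" using calculation halves(3) by auto
    moreover have "Q \<subseteq> closure Q1 \<union> closure Q2" using halves(5,6) by fastforce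
    ultimately have "consists_of_bezier p n t M Q {Q1, Q2}"
      unfolding consists_of_bezier_def
      by (intro conjI F) (use \<open>Q1 \<subseteq> Q\<close> \<open>Q2 \<subseteq> Q\<close> in \<open>auto simp: disjoint_def\<close>)
    then show "consists_of_bezier p n t M Q {Q} \<or>
      (\<exists>B\<^sub>1 B\<^sub>2. B\<^sub>1 \<noteq> B\<^sub>2 \<and> consists_of_bezier p n t M Q {B\<^sub>1, B\<^sub>2} \<and>
       measure lborel B\<^sub>1 = measure lborel Q / 2 \<and> measure lborel B\<^sub>2 = measure lborel Q / 2)"
      using \<open>Q1 \<noteq> Q2\<close> halves(7,8) by blast
  qed
qed

section \<open>Directions\<close>

lemma pos_less_iff: "pos (i :: 'd::{finite,linorder}) < pos j \<longleftrightarrow> i < j"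
proof -
  have "pos i < pos j" if "i < j" for i j :: 'd
    unfolding pos_def using that by (intro psubset_card_mono) auto
  then show ?thesis by (metis less_asym' not_less_iff_gr_or_eq)
qed

lemma pos_eq_iff: "pos (i :: 'd::{finite,linorder}) = pos j \<longleftrightarrow> i = j"
  by (metis less_irrefl neq_iff pos_less_iff)

lemma pos_less_card: "pos (i :: 'd::{finite,linorder}) < CARD('d)"
  unfolding pos_def by (intro psubset_card_mono) auto

lemma range_pos: "range (pos :: 'd::{finite,linorder} \<Rightarrow> nat) = {..<CARD('d)}"
proof (rule card_subset_eq)
  show "card (range (pos :: 'd \<Rightarrow> nat)) = card {..<CARD('d)}"
    by (simp add: card_image inj_def pos_eq_iff)
qed (auto simp: pos_less_card)

lemma split_dir_eq_iff: "split_dir l = (j :: 'd::{finite,linorder}) \<longleftrightarrow> l mod CARD('d) = pos j"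
proof -
  have "l mod CARD('d) \<in> range (pos :: 'd \<Rightarrow> nat)" unfolding range_pos by simp
  then obtain i :: 'd where i: "pos i = l mod CARD('d)" by auto
  then have "split_dir l = i"
    unfolding split_dir_def by (intro the_equality) (auto simp flip: pos_eq_iff)
  then show ?thesis using i by (metis pos_eq_iff)
qed

section \<open>Cell sizes and dyadic grids\<close>

primrec halvings :: "nat \<Rightarrow> 'd::{finite,linorder} \<Rightarrow> nat" where
  "halvings 0 j = 0"
| "halvings (Suc k) j = halvings k j + (if split_dir k = j then 1 else 0)"

text \<open>The side length, in direction \<open>j\<close>, of a level-\<open>k\<close> element
  inside \<open>ip_domain\<close>, where the end knots differ and every bisection halves the
  box.\<close>

definition cell_size :: "nat \<Rightarrow> 'd::{finite,linorder} \<Rightarrow> real" where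
  "cell_size k j = (1 / 2) ^ halvings k j"

lemma cell_size_pos [simp]: "0 < cell_size k j"
  by (simp add: cell_size_def)

lemma cell_size_0 [simp]: "cell_size 0 j = 1"
  by (simp add: cell_size_def)

lemma cell_size_Suc: "cell_size (Suc k) j = (if split_dir k = j then cell_size k j / 2 else cell_size k j)"
  by (simp add: cell_size_def)

text \<open>The grid starts at 0, so at every level it contains all integers, in particular the
  indices of the initial mesh.\<close>

definition on_grid :: "nat \<Rightarrow> 'd::{finite,linorder} \<Rightarrow> real \<Rightarrow> bool" where
  "on_grid k j x \<longleftrightarrow> (\<exists>m::int. x = of_int m * cell_size k j)"

lemma on_grid_Suc: "on_grid k j x \<Longrightarrow> on_grid (Suc k) j x"
  unfolding on_grid_def cell_size_Suc
  by (auto intro: exI[of _ "2 * _ :: int"])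

lemma on_grid_mono:
  assumes "on_grid k j x" "k \<le> k'"
  shows "on_grid k' j x"
  using assms(2) by (induction k' rule: dec_induct) (auto intro: on_grid_Suc assms(1))

lemma on_grid_of_int: "on_grid k j (of_int m)"
  by (rule on_grid_mono[of 0]) (auto simp: on_grid_def)

lemma on_grid_add: "on_grid k j x \<Longrightarrow> on_grid k j (x + of_int m * cell_size k j)"
  unfolding on_grid_def by (auto simp flip: distrib_right of_int_add)

lemma on_grid_between:
  assumes "on_grid k j a" "on_grid k j x" "a \<le> x" "x \<le> a + cell_size k j"
  shows "x = a \<or> x = a + cell_size k j"
proof -
  obtain m m' where m: "a = of_int m * cell_size k j" "x = of_int m' * cell_size k j"
    using assms(1,2) by (auto simp: on_grid_def)
  have "of_int m * cell_size k j \<le> of_int m' * cell_size k j"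
    "of_int m' * cell_size k j \<le> of_int (m + 1) * cell_size k j"
    using assms(3,4) m by (auto simp: algebra_simps)
  then have "m \<le> m'" "m' \<le> m + 1"
    by (simp_all only: mult_le_cancel_right_pos[OF cell_size_pos] of_int_le_iff)
  then have "m' = m \<or> m' = m + 1" by auto
  then show ?thesis using m by (auto simp: algebra_simps)
qed

text \<open>In units of the cell size the radii depend on the level at most through the split
  direction. This is the form in which grid lines can be counted.\<close>

lemma nb_dist_eq:
  fixes p :: "'d::{finite,linorder} \<Rightarrow> nat"
  assumes dim: "CARD('d) \<in> {2, 3}" and p: "p j = 2 * f + 1"
  shows "nb_dist p k j = cell_size k j *
    (if CARD('d) = 2 then (if split_dir k = j then real f + 1 / 2 else real f + 3 / 2)
     else 2 * real f + 5 / 2)"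
proof -
  \<comment> \<open>The number of \<open>l < k\<close> with \<open>l mod CARD('d) = pos j\<close>,
    that is (k - pos j) / d rounded up. Adding d - 1 first keeps the subtraction from
    truncating.\<close>
  have halvings: "halvings k j = (k + CARD('d) - 1 - pos j) div CARD('d)" for k
  proof (induction k)
    case 0
    then show ?case using dim by auto
  next
    case (Suc k)
    have step: "(Suc k + d - 1 - q) div d = (k + d - 1 - q) div d + (if k mod d = q then 1 else 0)"
      if "d \<in> {2, 3}" "q < d" for d q
    proof -
      have "d = 2 \<and> (q = 0 \<or> q = 1) \<or> d = 3 \<and> (q = 0 \<or> q = 1 \<or> q = 2)"
        using that by auto
      then show ?thesis by (elim disjE conjE; hypsubst; simp; presburger)
    qed
    show ?case
      unfolding halvings.simps Suc split_dir_eq_iff step[OF dim pos_less_card] ..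
  qed
  have fc: "\<lfloor>real (p j) / 2\<rfloor> = int f" "\<lceil>real (p j) / 2\<rceil> = int f + 1"
    unfolding p by (auto simp: floor_eq_iff ceiling_eq_iff)
  have pos: "pos j < CARD('d)" by (rule pos_less_card)
  show ?thesis
  proof (cases "CARD('d) = 2")
    case True
    define u where "u = k div 2"
    have "k = 2 * u \<or> k = 2 * u + 1" unfolding u_def by presburger
    moreover have "pos j = 0 \<or> pos j = 1" using pos True by auto
    ultimately show ?thesis
      using True fc unfolding nb_dist_def cell_size_def halvings split_dir_eq_iff
      by (auto simp: field_simps mod_Suc div_Suc)
  next
    case False
    then have 3: "CARD('d) = 3" using dim by auto
    define u where "u = k div 3"
    have "k = 3 * u \<or> k = 3 * u + 1 \<or> k = 3 * u + 2" unfolding u_def by presburger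
    moreover have "pos j = 0 \<or> pos j = 1 \<or> pos j = 2" using pos 3 by auto
    ultimately show ?thesis
      using 3 p unfolding nb_dist_def cell_size_def halvings split_dir_eq_iff
      by (auto simp: field_simps mod_Suc div_Suc)
  qed
qed

section \<open>Knots\<close>

lemma mono_from_cells:
  fixes f :: "real \<Rightarrow> real"
  assumes cell: "\<And>i x y. a \<le> i \<Longrightarrow> i < b \<Longrightarrow> real i \<le> x \<Longrightarrow> x \<le> y \<Longrightarrow> y \<le> real i + 1 \<Longrightarrow> f x \<le> f y"
    and "real a \<le> x" "x \<le> y" "y \<le> real b"
  shows "f x \<le> f y"
  using assms
proof (induction b arbitrary: x y)
  case 0
  then have "x = y" using of_nat_0_le_iff[of a, where 'a = real] by linarith
  then show ?case by simp
next
  case (Suc b)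
  have IH: "f x \<le> f y" if "real a \<le> x" "x \<le> y" "y \<le> real b" for x y
  proof (rule Suc.IH[OF _ that])
    show "f u \<le> f v" if "a \<le> i" "i < b" "real i \<le> u" "u \<le> v" "v \<le> real i + 1" for i u v
      using Suc.prems(1)[of i u v] that by simp
  qed
  show ?case
  proof (cases "a \<le> b")
    case False
    then have "real (Suc b) \<le> real a" by simp
    then have "x = y" using Suc.prems by linarith
    then show ?thesis by simp
  next
    case True
    then have S: "f x \<le> f y" if "real b \<le> x" "x \<le> y" "y \<le> real b + 1" for x y
      using Suc.prems(1)[of b x y] True that by simp
    consider "y \<le> b" | "b \<le> x" | "x \<le> b" "b \<le> y" by linarith
    then show ?thesis
    proof cases
      case 1
      then show ?thesis using IH Suc.prems(2,3) by blast
    next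
      case 2
      then show ?thesis using S Suc.prems(3,4) by simp
    next
      case 3
      have "f x \<le> f b" by (rule IH) (use 3 Suc.prems(2) in auto)
      also have "\<dots> \<le> f y" by (rule S) (use 3 Suc.prems(4) in auto)
      finally show ?thesis .
    qed
  qed
qed

lemma strict_mono_from_cells:
  fixes f :: "real \<Rightarrow> real"
  assumes cell: "\<And>i x y. a \<le> i \<Longrightarrow> i < b \<Longrightarrow> real i \<le> x \<Longrightarrow> x < y \<Longrightarrow> y \<le> real i + 1 \<Longrightarrow> f x < f y"
    and xy: "real a \<le> x" "x < y" "y \<le> real b"
  shows "f x < f y"
proof -
  have mono: "f u \<le> f v" if "real a \<le> u" "u \<le> v" "v \<le> real b" for u v
  proof (rule mono_from_cells[OF _ that])
    show "f x \<le> f y" if "a \<le> i" "i < b" "real i \<le> x" "x \<le> y" "y \<le> real i + 1" for i x y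
      using cell[of i x y] that by (cases "x = y") auto
  qed
  define i where "i = nat \<lfloor>x\<rfloor>"
  have "0 \<le> x" using xy(1) by (meson of_nat_0_le_iff order.trans)
  then have i: "real i \<le> x" "x < real i + 1" by (auto simp: i_def)
  have "a \<le> i" unfolding i_def using xy(1) by (simp add: le_nat_floor)
  have "real i < real b" using i xy by linarith
  then have "i < b" by simp
  define w where "w = min y (real i + 1)"
  have "f x < f w"
    by (rule cell[OF \<open>a \<le> i\<close> \<open>i < b\<close>]) (use i xy in \<open>auto simp: w_def\<close>)
  also have "\<dots> \<le> f y"
    by (rule mono) (use i xy in \<open>auto simp: w_def\<close>)
  finally show ?thesis .
qed

text \<open>At \<open>r = real i + 1\<close> the definition of \<open>knot\<close> already refers to
  the next unit interval; both affine formulas give \<open>t j (i + 1)\<close> there, so closed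
  intervals may be used.\<close>

lemma knot_affine:
  assumes "real i \<le> r" "r \<le> real i + 1"
  shows "knot t j r = t j i + (r - real i) * (t j (i + 1) - t j i)"
proof (cases "r = real i + 1")
  case True
  then have r: "\<lfloor>r\<rfloor> = int i + 1" "frac r = 0" by (auto simp: frac_def)
  show ?thesis unfolding knot_def r by (simp add: True nat_add_distrib)
next
  case False
  then have "\<lfloor>r\<rfloor> = int i" using assms by (simp add: floor_eq_iff)
  then show ?thesis by (simp add: knot_def frac_def algebra_simps)
qed

locale spline_setting =
  fixes p n :: "'d::{finite,linorder} \<Rightarrow> nat" and t :: "'d \<Rightarrow> nat \<Rightarrow> real"
  assumes dim: "CARD('d) \<in> {2, 3}"
    and degree_odd: "odd (p j)" and degree_ge_3: "3 \<le> p j"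
    and open_knots: "open_knots (p j) (n j) (t j)"
begin

text \<open>Otherwise \<open>t j (n j + 1)\<close> would have to be 0 and 1 at once. So
  \<open>ip_domain\<close> is nonempty.\<close>

lemma degree_less_n: "p j + 1 \<le> n j"
proof (rule ccontr)
  assume "\<not> p j + 1 \<le> n j"
  then have "n j + 1 \<in> {1..p j + 1}" "n j + 1 \<in> {n j + 1..n j + p j + 1}" by auto
  then have "t j (n j + 1) = 0" "t j (n j + 1) = 1"
    using open_knots[of j] unfolding open_knots_def by blast+
  then show False by simp
qed

lemma
  shows knot_eq_0: "1 \<le> i \<Longrightarrow> i \<le> p j + 1 \<Longrightarrow> t j i = 0"
    and knot_eq_1: "n j + 1 \<le> i \<Longrightarrow> i \<le> n j + p j + 1 \<Longrightarrow> t j i = 1"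
    and knot_less_Suc: "p j + 1 \<le> i \<Longrightarrow> i \<le> n j \<Longrightarrow> t j i < t j (i + 1)"
  using open_knots[of j] unfolding open_knots_def by auto

lemma knot_le_Suc: "1 \<le> i \<Longrightarrow> i \<le> n j + p j \<Longrightarrow> t j i \<le> t j (i + 1)"
  using knot_eq_0[of i j] knot_eq_0[of "i + 1" j] knot_eq_1[of j i] knot_eq_1[of j "i + 1"]
    knot_less_Suc[of j i] by (cases "i \<le> p j"; cases "i \<le> n j") auto

lemma knot_mono:
  assumes "1 \<le> x" "x \<le> y" "y \<le> real (n j) + real (p j) + 1"
  shows "knot t j x \<le> knot t j y"
proof (rule mono_from_cells[of 1 "n j + p j + 1" "knot t j"])
  fix i x y assume i: "1 \<le> i" "i < n j + p j + 1" "real i \<le> x" "x \<le> y" "y \<le> real i + 1"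
  then have "t j i \<le> t j (i + 1)" using knot_le_Suc by simp
  then show "knot t j x \<le> knot t j y"
    using i by (simp add: knot_affine[of i] mult_right_mono)
qed (use assms in auto)

lemma knot_strict_mono:
  assumes "real (p j) + 1 \<le> x" "x < y" "y \<le> real (n j) + 1"
  shows "knot t j x < knot t j y"
proof (rule strict_mono_from_cells[of "p j + 1" "n j + 1" "knot t j"])
  fix i x y assume i: "p j + 1 \<le> i" "i < n j + 1" "real i \<le> x" "x < y" "y \<le> real i + 1"
  then have "t j i < t j (i + 1)" using knot_less_Suc by simp
  then show "knot t j x < knot t j y"
    using i by (simp add: knot_affine[of i] mult_strict_right_mono)
qed (use assms in auto)

lemma knot_left:
  assumes "1 \<le> k" "k \<le> p j"
  shows "knot t j (real k) = 0" "knot t j (real k + 1) = 0"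
  using assms knot_affine[of k "real k" t j] knot_affine[of k "real k + 1" t j]
  by (auto simp: knot_eq_0)

lemma knot_right:
  assumes "n j + 1 \<le> k" "k \<le> n j + p j"
  shows "knot t j (real k) = 1" "knot t j (real k + 1) = 1"
  using assms knot_affine[of k "real k" t j] knot_affine[of k "real k + 1" t j]
  by (auto simp: knot_eq_1)

lemma knot_ip_ends: "knot t j (real (p j) + 1) = 0" "knot t j (real (n j) + 1) = 1"
  using knot_affine[of "p j + 1" "real (p j) + 1" t j] knot_affine[of "n j + 1" "real (n j) + 1" t j]
  by (auto simp: knot_eq_0 knot_eq_1)

definition half_width :: "'d \<Rightarrow> nat" where
  "half_width j = (p j + 1) div 2"

lemma half_width: "p j = 2 * half_width j - 1" "p j + 1 = 2 * half_width j" "2 \<le> half_width j"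
  using degree_odd[of j] degree_ge_3[of j] by (auto simp: half_width_def elim!: oddE)

lemma nb_dist_eq':
  "nb_dist p k j = cell_size k j *
    (if CARD('d) = 2
     then (if split_dir k = j then real (half_width j) - 1 / 2 else real (half_width j) + 1 / 2)
     else 2 * real (half_width j) + 1 / 2)"
proof -
  have "p j = 2 * (half_width j - 1) + 1" "real (half_width j - 1) = real (half_width j) - 1"
    using half_width[of j] by auto
  then show ?thesis using nb_dist_eq[OF dim, of p j "half_width j - 1" k] by (auto simp: algebra_simps)
qed

text \<open>Room for \<open>half_width j\<close> grid lines beyond a face of the cell, which is half
  a cell away from the midpoint.\<close>

lemma nb_dist_other: "split_dir k \<noteq> j \<Longrightarrow> cell_size k j * (real (half_width j) + 1 / 2) \<le> nb_dist p k j"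
  unfolding nb_dist_eq' by (auto intro!: mult_left_mono simp: less_imp_le)

text \<open>Room for \<open>half_width j\<close> grid lines counted from the midpoint of the cell,
  the first of which is only half a cell away.\<close>

lemma nb_dist_ge: "cell_size k j * (real (half_width j) - 1 / 2) \<le> nb_dist p k j"
  unfolding nb_dist_eq' by (auto intro!: mult_left_mono simp: less_imp_le)

lemma nb_dist_ge_cell: "cell_size k j \<le> nb_dist p k j"
proof -
  have "cell_size k j * 1 \<le> cell_size k j * (real (half_width j) - 1 / 2)"
    using half_width(3)[of j] by (intro mult_left_mono) (auto simp: less_imp_le)
  then show ?thesis using nb_dist_ge[of k j] by linarith
qed

lemma nb_dist_pos: "0 < nb_dist p k j"
  using nb_dist_ge_cell[of k j] cell_size_pos[of k j] by linarith

text \<open>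
  The distance between the midpoints of an element and its child is at most half the difference of
  their sizes, so this makes the neighbourhoods nested along refinement.
\<close>

lemma nb_dist_Suc: "nb_dist p (Suc k) j + (cell_size k j - cell_size (Suc k) j) / 2 \<le> nb_dist p k j"
proof -
  define s where "s = cell_size k j"
  define c where "c = real (half_width j)"
  have s: "0 < s" by (simp add: s_def)
  have c: "2 \<le> c" using half_width(3)[of j] by (simp add: c_def)
  define X where "X = s * c"
  have X: "s * (c + 1 / 2) = X + s / 2" "s * (c - 1 / 2) = X - s / 2" "s * (2 * c + 1 / 2) = 2 * X + s / 2"
    "s / 2 * (c + 1 / 2) = X / 2 + s / 4" "s / 2 * (c - 1 / 2) = X / 2 - s / 4"
    "s / 2 * (2 * c + 1 / 2) = X + s / 4"
    by (simp_all add: X_def field_simps)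
  \<comment> \<open>This is where p >= 3 enters. In the split direction in dimension 2, half of (c +
    1/2) s, plus s/4 for the shift of the midpoint, must not exceed (c - 1/2) s, which amounts to c
    >= 2.\<close>
  have "s * 2 \<le> X" unfolding X_def using s c by (intro mult_left_mono) auto
  then have "(X + s / 2) / 2 + s / 4 \<le> X - s / 2" "(2 * X + s / 2) / 2 + s / 4 \<le> 2 * X + s / 2"
    using s by (simp_all add: field_simps)
  moreover have "split_dir (Suc k) \<noteq> j" if "split_dir k = j" "CARD('d) = 2"
    using that unfolding split_dir_eq_iff by presburger
  moreover have "split_dir (Suc k) = j" if "split_dir k \<noteq> j" "CARD('d) = 2"
    using that pos_less_card[of j] unfolding split_dir_eq_iff by presburger
  ultimately show ?thesis
    using s unfolding nb_dist_eq' cell_size_Suc s_def[symmetric] c_def[symmetric]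
    by (cases "CARD('d) = 2"; cases "split_dir k = j"; simp add: X)
qed

end

section \<open>Cells of the index mesh\<close>

lemma midpt_nth: "midpt Q $ j = (lo Q $ j + hi Q $ j) / 2"
  by (simp add: midpt_def)

lemma elem_eqI: "lo E = lo E' \<Longrightarrow> hi E = hi E' \<Longrightarrow> level E = level E' \<Longrightarrow> E = E'"
  by (cases E; cases E') simp

context spline_setting
begin

text \<open>A box of the uniform grid of its level inside the closure of \<open>ip_domain\<close>.
  It need not belong to the mesh, which admits ancestors that have already been bisected.\<close>

definition ip_cell :: "'d elem \<Rightarrow> bool" where
  "ip_cell E \<longleftrightarrow> (\<forall>j. on_grid (level E) j (lo E $ j) \<and>
     hi E $ j = lo E $ j + cell_size (level E) j \<and>
     real (p j) + 1 \<le> lo E $ j \<and> hi E $ j \<le> real (n j) + 1)"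

lemma ip_cellD:
  assumes "ip_cell E"
  shows "on_grid (level E) j (lo E $ j)" "hi E $ j = lo E $ j + cell_size (level E) j"
    "real (p j) + 1 \<le> lo E $ j" "hi E $ j \<le> real (n j) + 1" "lo E $ j < hi E $ j"
proof -
  have *: "on_grid (level E) j (lo E $ j) \<and> hi E $ j = lo E $ j + cell_size (level E) j \<and>
     real (p j) + 1 \<le> lo E $ j \<and> hi E $ j \<le> real (n j) + 1"
    using assms unfolding ip_cell_def by blast
  then show "on_grid (level E) j (lo E $ j)" "hi E $ j = lo E $ j + cell_size (level E) j"
    "real (p j) + 1 \<le> lo E $ j" "hi E $ j \<le> real (n j) + 1"
    by blast+
  show "lo E $ j < hi E $ j" using * cell_size_pos[of "level E" j] by linarith
qed

lemma ip_cell_knots_less: "ip_cell E \<Longrightarrow> knot t j (lo E $ j) < knot t j (hi E $ j)"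
  by (intro knot_strict_mono ip_cellD)

lemma ip_cell_grid_point:
  assumes "ip_cell E" "on_grid (level E) j x" "lo E $ j \<le> x" "x \<le> hi E $ j"
  shows "x = lo E $ j \<or> x = hi E $ j"
  using on_grid_between[of "level E" j "lo E $ j" x] assms ip_cellD(1,2)[OF assms(1)] by auto

definition lower_child :: "'d elem \<Rightarrow> 'd elem" where
  "lower_child E =
     Elem (lo E) (\<chi> i. if i = split_dir (level E) then midpt E $ i else hi E $ i) (level E + 1)"

definition upper_child :: "'d elem \<Rightarrow> 'd elem" where
  "upper_child E =
     Elem (\<chi> i. if i = split_dir (level E) then midpt E $ i else lo E $ i) (hi E) (level E + 1)"

lemma bisect_eq:
  "bisect t E =
     (if knot t (split_dir (level E)) (lo E $ split_dir (level E)) \<noteq>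
         knot t (split_dir (level E)) (hi E $ split_dir (level E))
      then {lower_child E, upper_child E} else {Elem (lo E) (hi E) (level E + 1)})"
proof -
  have "(\<chi> i. if i = split_dir (level E) then midpt E $ split_dir (level E) else v $ i) =
      (\<chi> i. if i = split_dir (level E) then midpt E $ i else v $ i)" for v :: "real ^ 'd::{finite,linorder}"
    by (simp add: vec_eq_iff)
  then show ?thesis by (simp add: bisect_def Let_def lower_child_def upper_child_def)
qed

lemma bisect_ip_cell: "ip_cell E \<Longrightarrow> bisect t E = {lower_child E, upper_child E}"
  unfolding bisect_eq using ip_cell_knots_less[of E] by (metis less_irrefl)

lemma child_ip_cell:
  assumes "ip_cell E" "E' \<in> {lower_child E, upper_child E}"
  shows "ip_cell E'" "level E' = Suc (level E)" "lo E $ j \<le> lo E' $ j" "hi E' $ j \<le> hi E $ j"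
proof -
  have D: "on_grid (level E) i (lo E $ i)" "hi E $ i = lo E $ i + cell_size (level E) i"
    "real (p i) + 1 \<le> lo E $ i" "hi E $ i \<le> real (n i) + 1" "lo E $ i < hi E $ i" for i
    using ip_cellD[OF assms(1)] by auto
  show "level E' = Suc (level E)" "lo E $ j \<le> lo E' $ j" "hi E' $ j \<le> hi E $ j"
    using assms(2) D(5)[of j] by (auto simp: lower_child_def upper_child_def midpt_nth)
  have mid: "midpt E $ i = lo E $ i + of_int 1 * cell_size (Suc (level E)) i" if "i = split_dir (level E)" for i
    using that D(2)[of i] by (simp add: midpt_nth cell_size_Suc field_simps)
  have grid: "on_grid (Suc (level E)) i (midpt E $ i)" if "i = split_dir (level E)" for i
    unfolding mid[OF that] by (intro on_grid_add on_grid_Suc D)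
  have bounds: "real (p i) + 1 \<le> midpt E $ i" "midpt E $ i \<le> real (n i) + 1" for i
    using D(3,4,5)[of i] by (auto simp: midpt_nth)
  have mid': "hi E $ i = midpt E $ i + cell_size (Suc (level E)) i \<and>
      midpt E $ i = lo E $ i + cell_size (Suc (level E)) i" if "i = split_dir (level E)" for i
    using that D(2)[of i] by (simp add: midpt_nth cell_size_Suc field_simps)
  have same: "hi E $ i = lo E $ i + cell_size (Suc (level E)) i" if "i \<noteq> split_dir (level E)" for i
    using that D(2)[of i] by (auto simp: cell_size_Suc)
  have grid_lo: "on_grid (Suc (level E)) i (lo E $ i)" for i
    by (intro on_grid_Suc D)
  consider "E' = lower_child E" | "E' = upper_child E" using assms(2) by blast
  then show "ip_cell E'"
  proof cases
    case 1
    show ?thesis unfolding ip_cell_def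
    proof
      fix i
      show "on_grid (level E') i (lo E' $ i) \<and> hi E' $ i = lo E' $ i + cell_size (level E') i \<and>
          real (p i) + 1 \<le> lo E' $ i \<and> hi E' $ i \<le> real (n i) + 1"
        using grid[of i] mid'[of i] same[of i] D(3,4)[of i] grid_lo[of i] bounds[of i] 1
        by (cases "i = split_dir (level E)") (simp_all add: lower_child_def)
    qed
  next
    case 2
    show ?thesis unfolding ip_cell_def
    proof
      fix i
      show "on_grid (level E') i (lo E' $ i) \<and> hi E' $ i = lo E' $ i + cell_size (level E') i \<and>
          real (p i) + 1 \<le> lo E' $ i \<and> hi E' $ i \<le> real (n i) + 1"
        using grid[of i] mid'[of i] same[of i] D(3,4)[of i] grid_lo[of i] bounds[of i] 2
        by (cases "i = split_dir (level E)") (simp_all add: upper_child_def)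
    qed
  qed
qed

section \<open>Nearness and grading\<close>

definition overlap :: "'d elem \<Rightarrow> 'd elem \<Rightarrow> bool" where
  "overlap E E' \<longleftrightarrow> (\<forall>j. lo E $ j < hi E' $ j \<and> lo E' $ j < hi E $ j)"

lemma overlap_sym: "overlap E E' \<Longrightarrow> overlap E' E"
  by (auto simp: overlap_def)

lemma overlap_mono:
  assumes "overlap E E'" "\<And>j. lo F $ j \<le> lo E $ j" "\<And>j. hi E $ j \<le> hi F $ j"
    "\<And>j. lo F' $ j \<le> lo E' $ j" "\<And>j. hi E' $ j \<le> hi F' $ j"
  shows "overlap F F'"
  using assms unfolding overlap_def by (meson le_less_trans less_le_trans)

definition near :: "'d elem \<Rightarrow> 'd elem \<Rightarrow> bool" where
  "near P E \<longleftrightarrow> (\<forall>j. lo E $ j < midpt P $ j + nb_dist p (level P) j \<and>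
     midpt P $ j - nb_dist p (level P) j < hi E $ j)"

lemma near_iff:
  assumes "\<And>j. lo E $ j < hi E $ j"
  shows "near P E \<longleftrightarrow> (\<exists>x\<in>elem_box E. \<forall>j. \<bar>x $ j - midpt P $ j\<bar> < nb_dist p (level P) j)"
proof
  assume near: "near P E"
  define l where "l j = max (lo E $ j) (midpt P $ j - nb_dist p (level P) j)" for j
  define h where "h j = min (hi E $ j) (midpt P $ j + nb_dist p (level P) j)" for j
  define x where "x = (\<chi> j. (l j + h j) / 2)"
  have "l j < h j" for j
    using near assms[of j] nb_dist_pos[of "level P" j] by (auto simp: near_def l_def h_def)
  then have "l j < x $ j" "x $ j < h j" for j by (auto simp: x_def)
  then have "x \<in> elem_box E" "\<forall>j. \<bar>x $ j - midpt P $ j\<bar> < nb_dist p (level P) j"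
    by (auto simp: elem_box_def mem_box_cart l_def h_def abs_less_iff) (smt (verit))+
  then show "\<exists>x\<in>elem_box E. \<forall>j. \<bar>x $ j - midpt P $ j\<bar> < nb_dist p (level P) j" by blast
next
  assume "\<exists>x\<in>elem_box E. \<forall>j. \<bar>x $ j - midpt P $ j\<bar> < nb_dist p (level P) j"
  then obtain x where x: "\<forall>j. lo E $ j < x $ j \<and> x $ j < hi E $ j"
    "\<forall>j. \<bar>x $ j - midpt P $ j\<bar> < nb_dist p (level P) j"
    by (auto simp: elem_box_def mem_box_cart)
  show "near P E" unfolding near_def
  proof
    fix j
    show "lo E $ j < midpt P $ j + nb_dist p (level P) j \<and> midpt P $ j - nb_dist p (level P) j < hi E $ j"
      using x(1)[rule_format, of j] x(2)[rule_format, of j] by linarith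
  qed
qed

lemma near_mono:
  assumes "near P E" "\<And>j. lo F $ j \<le> lo E $ j" "\<And>j. hi E $ j \<le> hi F $ j"
  shows "near P F"
  using assms unfolding near_def by (meson le_less_trans less_le_trans)

lemma near_ancestor:
  assumes "ip_cell P" "ip_cell P'" "level P' = Suc (level P)"
    "\<And>j. lo P $ j \<le> lo P' $ j" "\<And>j. hi P' $ j \<le> hi P $ j" "near P' E"
  shows "near P E"
  unfolding near_def
proof
  fix j
  have "\<bar>midpt P $ j - midpt P' $ j\<bar> \<le> (cell_size (level P) j - cell_size (level P') j) / 2"
    using assms(4,5)[of j] ip_cellD(2)[OF assms(1), of j] ip_cellD(2)[OF assms(2), of j]
    by (simp add: midpt_nth field_simps abs_le_iff)
  moreover have "nb_dist p (level P') j + (cell_size (level P) j - cell_size (level P') j) / 2 \<le> nb_dist p (level P) j"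
    unfolding assms(3) by (rule nb_dist_Suc)
  moreover have "lo E $ j < midpt P' $ j + nb_dist p (level P') j"
    "midpt P' $ j - nb_dist p (level P') j < hi E $ j"
    using assms(6) by (auto simp: near_def)
  ultimately show "lo E $ j < midpt P $ j + nb_dist p (level P) j \<and> midpt P $ j - nb_dist p (level P) j < hi E $ j"
    by linarith
qed

text \<open>The condition survives refinement: a new element lies in an old one, which is then near
  \<open>P\<close> as well, and levels never decrease.\<close>

definition graded :: "'d elem set \<Rightarrow> 'd elem \<Rightarrow> bool" where
  "graded A P \<longleftrightarrow> (\<forall>E\<in>A. near P E \<longrightarrow> level P \<le> level E)"

text \<open>
  The cells in the closure of \<open>ip_domain\<close>. Every ancestor \<open>P\<close> of a cell, which is recovered as the
  cell of level \<open>e\<close> that contains it, was bisected only after all cells near \<open>P\<close> had reached its level.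
\<close>

definition ip_mesh :: "'d elem set \<Rightarrow> bool" where
  "ip_mesh A \<longleftrightarrow> finite A \<and> (\<forall>E\<in>A. ip_cell E) \<and>
     (\<forall>E\<in>A. \<forall>E'\<in>A. overlap E E' \<longrightarrow> E = E') \<and>
     (\<forall>x. (\<forall>j. real (p j) + 1 \<le> x $ j \<and> x $ j \<le> real (n j) + 1) \<longrightarrow>
        (\<exists>E\<in>A. \<forall>j. lo E $ j \<le> x $ j \<and> x $ j \<le> hi E $ j)) \<and>
     (\<forall>E\<in>A. \<forall>e<level E. \<exists>P. ip_cell P \<and> level P = e \<and>
        (\<forall>j. lo P $ j \<le> lo E $ j \<and> hi E $ j \<le> hi P $ j) \<and> graded A P)"

lemma ip_meshD:
  assumes "ip_mesh A"
  shows "finite A" "E \<in> A \<Longrightarrow> ip_cell E" "E \<in> A \<Longrightarrow> E' \<in> A \<Longrightarrow> overlap E E' \<Longrightarrow> E = E'"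
    "(\<And>j. real (p j) + 1 \<le> x $ j \<and> x $ j \<le> real (n j) + 1) \<Longrightarrow>
        \<exists>E\<in>A. \<forall>j. lo E $ j \<le> x $ j \<and> x $ j \<le> hi E $ j"
    "E \<in> A \<Longrightarrow> e < level E \<Longrightarrow> \<exists>P. ip_cell P \<and> level P = e \<and>
        (\<forall>j. lo P $ j \<le> lo E $ j \<and> hi E $ j \<le> hi P $ j) \<and> graded A P"
proof -
  note * = conjunct1[OF assms[unfolded ip_mesh_def]]
    conjunct2[OF assms[unfolded ip_mesh_def]]
  note cells = conjunct1[OF *(2)]
  note disjoint = conjunct1[OF conjunct2[OF *(2)]]
  note cover = conjunct1[OF conjunct2[OF conjunct2[OF *(2)]]]
  note grading = conjunct2[OF conjunct2[OF conjunct2[OF *(2)]]]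
  show "finite A" by (rule *(1))
  show "E \<in> A \<Longrightarrow> ip_cell E" by (rule bspec[OF cells])
  show "E \<in> A \<Longrightarrow> E' \<in> A \<Longrightarrow> overlap E E' \<Longrightarrow> E = E'" using disjoint by simp
  show "(\<And>j. real (p j) + 1 \<le> x $ j \<and> x $ j \<le> real (n j) + 1) \<Longrightarrow>
        \<exists>E\<in>A. \<forall>j. lo E $ j \<le> x $ j \<and> x $ j \<le> hi E $ j"
    by (rule mp[OF spec[OF cover]]) simp
  show "E \<in> A \<Longrightarrow> e < level E \<Longrightarrow> \<exists>P. ip_cell P \<and> level P = e \<and>
        (\<forall>j. lo P $ j \<le> lo E $ j \<and> hi E $ j \<le> hi P $ j) \<and> graded A P"
    using grading by simp
qed

definition ip_refine :: "'d elem set \<Rightarrow> 'd elem set \<Rightarrow> 'd elem set" where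
  "ip_refine A C = (A - C) \<union> (\<Union>E\<in>C. bisect t E)"

text \<open>The new content is the grading at a cell \<open>P\<close> that is bisected now. A kept
  element near \<open>P\<close> cannot be coarser than \<open>P\<close>, as \<open>C\<close> is
  closed under neighbours. A new child gains one level over its parent \<open>F\<close>, and
  \<open>F\<close> is near the parent of \<open>P\<close> by nesting, hence at most one level
  coarser than \<open>P\<close>.\<close>

lemma ip_mesh_refine:
  assumes A: "ip_mesh A" and C: "C \<subseteq> A"
    and closed: "\<And>E E'. E \<in> C \<Longrightarrow> E' \<in> A \<Longrightarrow> level E' < level E \<Longrightarrow> near E E' \<Longrightarrow> E' \<in> C"
  shows "ip_mesh (ip_refine A C)"
proof -
  note D = ip_meshD[OF A]
  have origin: "\<exists>F\<in>A. (E = F \<and> F \<notin> C \<or> F \<in> C \<and> E \<in> {lower_child F, upper_child F} \<and> level E = Suc (level F)) \<and>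
      (\<forall>j. lo F $ j \<le> lo E $ j) \<and> (\<forall>j. hi E $ j \<le> hi F $ j) \<and> ip_cell E" if E: "E \<in> ip_refine A C" for E
  proof -
    consider "E \<in> A - C" | F where "F \<in> C" "E \<in> bisect t F"
      using E unfolding ip_refine_def by blast
    then show ?thesis
    proof cases
      case 1
      then show ?thesis using D(2) by (intro bexI[of _ E]) auto
    next
      case 2
      then have "F \<in> A" "ip_cell F" using C D(2) by auto
      with 2 have "E \<in> {lower_child F, upper_child F}" by (simp add: bisect_ip_cell)
      with child_ip_cell[OF \<open>ip_cell F\<close> this] 2 \<open>F \<in> A\<close> show ?thesis by blast
    qed
  qed
  have graded: "graded (ip_refine A C) P" if "graded A P" for P
    unfolding graded_def
  proof (intro ballI impI)
    fix E assume E: "E \<in> ip_refine A C" "near P E"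
    obtain F where F: "F \<in> A" "E = F \<and> F \<notin> C \<or> level E = Suc (level F)"
        "\<And>j. lo F $ j \<le> lo E $ j" "\<And>j. hi E $ j \<le> hi F $ j"
      using origin[OF E(1)] by blast
    have "near P F" by (rule near_mono[OF E(2) F(3,4)])
    then show "level P \<le> level E" using that F(1,2) by (auto simp: graded_def)
  qed
  have graded_C: "graded (ip_refine A C) P" if P: "P \<in> C" for P
    unfolding graded_def
  proof (intro ballI impI)
    fix E assume E: "E \<in> ip_refine A C" "near P E"
    obtain F where F: "F \<in> A" "E = F \<and> F \<notin> C \<or> level E = Suc (level F)"
        "\<And>j. lo F $ j \<le> lo E $ j" "\<And>j. hi E $ j \<le> hi F $ j"
      using origin[OF E(1)] by blast
    have near: "near P F" by (rule near_mono[OF E(2) F(3,4)])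
    have "P \<in> A" "ip_cell P" using P C D(2) by auto
    show "level P \<le> level E"
    proof (cases "level E = Suc (level F)")
      case False
      then show ?thesis using closed[OF P F(1) _ near] F(2) by (auto simp: not_less[symmetric])
    next
      case True
      show ?thesis
      proof (cases "level P")
        case (Suc k)
        then have "k < level P" by simp
        then obtain R where R: "ip_cell R" "level R = k" "graded A R"
            "\<And>j. lo R $ j \<le> lo P $ j \<and> hi P $ j \<le> hi R $ j"
          using D(5)[OF \<open>P \<in> A\<close>] by blast
        have "near R F"
          by (rule near_ancestor[OF R(1) \<open>ip_cell P\<close> _ _ _ near]) (use R Suc in auto)
        then have "k \<le> level F" using R F(1) by (auto simp: graded_def)
        then show ?thesis using True Suc by simp
      qed simp
    qed
  qed
  have "finite (ip_refine A C)"
  proof -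
    have "finite C" using C D(1) finite_subset by blast
    moreover have "finite (bisect t E)" for E by (simp add: bisect_eq)
    ultimately show ?thesis using D(1) by (simp add: ip_refine_def)
  qed
  moreover have "\<forall>E\<in>ip_refine A C. ip_cell E" using origin by blast
  moreover have "E = E'" if E: "E \<in> ip_refine A C" "E' \<in> ip_refine A C" "overlap E E'" for E E'
  proof -
    obtain F where F: "F \<in> A" "E = F \<and> F \<notin> C \<or> F \<in> C \<and> E \<in> {lower_child F, upper_child F}"
        "\<And>j. lo F $ j \<le> lo E $ j" "\<And>j. hi E $ j \<le> hi F $ j"
      using origin[OF E(1)] by blast
    obtain F' where F': "F' \<in> A" "E' = F' \<and> F' \<notin> C \<or> F' \<in> C \<and> E' \<in> {lower_child F', upper_child F'}"
        "\<And>j. lo F' $ j \<le> lo E' $ j" "\<And>j. hi E' $ j \<le> hi F' $ j"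
      using origin[OF E(2)] by blast
    have "overlap F F'" by (rule overlap_mono[OF E(3) F(3,4) F'(3,4)])
    then have "F = F'" using D(3) F(1) F'(1) by blast
    moreover have "\<not> overlap (lower_child F) (upper_child F)"
      by (auto simp: overlap_def lower_child_def upper_child_def intro!: exI[of _ "split_dir (level F)"])
    then have "\<not> overlap (upper_child F) (lower_child F)"
      using overlap_sym by blast
    ultimately show ?thesis
      using F(2) F'(2) E(3) \<open>\<not> overlap (lower_child F) (upper_child F)\<close> by auto
  qed
  moreover have "\<exists>E\<in>ip_refine A C. \<forall>j. lo E $ j \<le> x $ j \<and> x $ j \<le> hi E $ j"
    if x: "\<forall>j. real (p j) + 1 \<le> x $ j \<and> x $ j \<le> real (n j) + 1" for x
  proof -
    obtain F where F: "F \<in> A" "\<And>j. lo F $ j \<le> x $ j \<and> x $ j \<le> hi F $ j"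
      using D(4)[of x] x by auto
    show ?thesis
    proof (cases "F \<in> C")
      case False
      then show ?thesis using F by (auto simp: ip_refine_def)
    next
      case True
      define E where "E = (if x $ split_dir (level F) \<le> midpt F $ split_dir (level F)
        then lower_child F else upper_child F)"
      have "\<forall>j. lo E $ j \<le> x $ j \<and> x $ j \<le> hi E $ j"
        using F(2) by (auto simp: E_def lower_child_def upper_child_def)
      moreover have "E \<in> bisect t F" using D(2)[OF F(1)] by (simp add: bisect_ip_cell E_def)
      ultimately show ?thesis using True by (auto simp: ip_refine_def)
    qed
  qed
  moreover have "\<exists>P. ip_cell P \<and> level P = e \<and> (\<forall>j. lo P $ j \<le> lo E $ j \<and> hi E $ j \<le> hi P $ j) \<and>
      graded (ip_refine A C) P" if E: "E \<in> ip_refine A C" and e: "e < level E" for E e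
  proof -
    obtain F where F: "F \<in> A" "E = F \<and> F \<notin> C \<or> F \<in> C \<and> level E = Suc (level F)"
        "\<And>j. lo F $ j \<le> lo E $ j" "\<And>j. hi E $ j \<le> hi F $ j"
      using origin[OF E(1)] by blast
    show ?thesis
    proof (cases "e < level F")
      case True
      then obtain P where P: "ip_cell P" "level P = e" "graded A P"
          "\<And>j. lo P $ j \<le> lo F $ j \<and> hi F $ j \<le> hi P $ j"
        using D(5)[OF F(1)] by blast
      have "lo P $ j \<le> lo E $ j \<and> hi E $ j \<le> hi P $ j" for j
        using P(4)[of j] F(3,4)[of j] by linarith
      then show ?thesis using P graded by blast
    next
      case False
      then have "F \<in> C" "level F = e" using F(2) e by auto
      then show ?thesis using graded_C F D(2) by blast
    qed
  qed
  ultimately show ?thesis unfolding ip_mesh_def by blast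
qed

end

section \<open>The mesh outside the interior domain\<close>

context spline_setting
begin

text \<open>
  The elements outside \<open>ip_domain\<close> are copies of the cells that touch its boundary: in some
  directions the interval of the cell is replaced by a unit interval on which the knots coincide.
\<close>

definition left_copy :: "'d \<Rightarrow> real \<Rightarrow> real \<Rightarrow> real \<Rightarrow> bool" where
  "left_copy j l0 l h \<longleftrightarrow> l0 = real (p j) + 1 \<and> (\<exists>k. 1 \<le> k \<and> k \<le> p j \<and> l = real k \<and> h = real k + 1)"

definition right_copy :: "'d \<Rightarrow> real \<Rightarrow> real \<Rightarrow> real \<Rightarrow> bool" where
  "right_copy j h0 l h \<longleftrightarrow>
     h0 = real (n j) + 1 \<and> (\<exists>k. n j + 1 \<le> k \<and> k \<le> n j + p j \<and> l = real k \<and> h = real k + 1)"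

text \<open>Directions are replaced independently, which yields the elements beyond faces, edges and
  corners alike. The level is copied because \<open>prolongation\<close> bisects a copy together
  with its cell, even when only the level changes.\<close>

definition mirror :: "'d elem \<Rightarrow> 'd elem \<Rightarrow> bool" where
  "mirror E0 E \<longleftrightarrow> level E = level E0 \<and>
     (\<forall>j. lo E $ j = lo E0 $ j \<and> hi E $ j = hi E0 $ j \<or>
        left_copy j (lo E0 $ j) (lo E $ j) (hi E $ j) \<or>
        right_copy j (hi E0 $ j) (lo E $ j) (hi E $ j))"

text \<open>Recovers the index mesh from its cells in \<open>ip_domain\<close>. All admissible
  meshes have this form, so inductions can be run on the inner cells alone.\<close>

definition extension :: "'d elem set \<Rightarrow> 'd elem set" where
  "extension A = {E. \<exists>E0\<in>A. mirror E0 E}"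

lemma mirror_cases:
  assumes "mirror E0 E"
  obtains "lo E $ j = lo E0 $ j" "hi E $ j = hi E0 $ j"
  | "left_copy j (lo E0 $ j) (lo E $ j) (hi E $ j)"
  | "right_copy j (hi E0 $ j) (lo E $ j) (hi E $ j)"
  using assms unfolding mirror_def by blast

lemma mirror_refl: "mirror E E"
  by (simp add: mirror_def)

lemma extension_superset: "A \<subseteq> extension A"
  using mirror_refl by (auto simp: extension_def)

lemma left_copyD:
  assumes "left_copy j l0 l h"
  shows "l0 = real (p j) + 1" "1 \<le> l" "h = l + 1" "h \<le> real (p j) + 1" "knot t j l = knot t j h"
  using assms knot_left[of _ j] unfolding left_copy_def by (auto simp: of_nat_mono)

lemma right_copyD:
  assumes "right_copy j h0 l h"
  shows "h0 = real (n j) + 1" "real (n j) + 1 \<le> l" "h = l + 1" "h \<le> real (n j) + real (p j) + 1"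
    "knot t j l = knot t j h"
  using assms knot_right[of j] unfolding right_copy_def by auto

lemma proj_ip_nth: "proj_ip p n x $ j = max (real (p j) + 1) (min (real (n j) + 1) (x $ j))"
  by (simp add: proj_ip_def)

lemma ends_less: "real (p j) + 1 < real (n j) + 1"
  using degree_less_n[of j] by simp

lemma proj_ip_bounds: "real (p j) + 1 \<le> proj_ip p n x $ j \<and> proj_ip p n x $ j \<le> real (n j) + 1"
  using ends_less[of j] by (auto simp: proj_ip_nth)

text \<open>Projection clamps a copied direction to the end of the domain where the copy is
  attached, which is an end of the original interval. Hence the projected midpoint stays in the
  closed cell and reaches its boundary as soon as one direction is copied.\<close>

lemma proj_midpt_mirror:
  assumes "ip_cell E0" "mirror E0 E"
  shows "lo E0 $ j \<le> proj_ip p n (midpt E) $ j \<and> proj_ip p n (midpt E) $ j \<le> hi E0 $ j"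
    "lo E $ j = lo E0 $ j \<and> hi E $ j = hi E0 $ j \<or>
     proj_ip p n (midpt E) $ j = lo E0 $ j \<or> proj_ip p n (midpt E) $ j = hi E0 $ j"
proof -
  note c = ip_cellD(3-5)[OF assms(1), of j] ends_less[of j]
  have "(lo E0 $ j \<le> proj_ip p n (midpt E) $ j \<and> proj_ip p n (midpt E) $ j \<le> hi E0 $ j) \<and>
    (lo E $ j = lo E0 $ j \<and> hi E $ j = hi E0 $ j \<or>
     proj_ip p n (midpt E) $ j = lo E0 $ j \<or> proj_ip p n (midpt E) $ j = hi E0 $ j)"
    using assms(2)
  proof (cases rule: mirror_cases[of _ _ j])
    case 1
    then show ?thesis using c by (auto simp: proj_ip_nth midpt_nth)
  next
    case 2
    note d = left_copyD(1,3,4)[OF 2]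
    then have "proj_ip p n (midpt E) $ j = lo E0 $ j"
      using c by (auto simp: proj_ip_nth midpt_nth)
    then show ?thesis using c by auto
  next
    case 3
    note d = right_copyD(1-3)[OF 3]
    then have "proj_ip p n (midpt E) $ j = hi E0 $ j"
      using c by (auto simp: proj_ip_nth midpt_nth)
    then show ?thesis using c by auto
  qed
  then show "lo E0 $ j \<le> proj_ip p n (midpt E) $ j \<and> proj_ip p n (midpt E) $ j \<le> hi E0 $ j"
    "lo E $ j = lo E0 $ j \<and> hi E $ j = hi E0 $ j \<or>
     proj_ip p n (midpt E) $ j = lo E0 $ j \<or> proj_ip p n (midpt E) $ j = hi E0 $ j" by blast+
qed

text \<open>In an uncopied direction the projected midpoint is interior to the interval of
  \<open>E1\<close>. In a copied one it is an end of the domain, and every cell containing that end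
  begins or finishes there. Either way the intervals of \<open>E0\<close> and \<open>E1\<close>
  overlap.\<close>

lemma mirror_unique:
  assumes A: "ip_mesh A" and E: "E0 \<in> A" "E1 \<in> A" "mirror E1 E"
    and proj: "\<And>j. lo E0 $ j \<le> proj_ip p n (midpt E) $ j \<and> proj_ip p n (midpt E) $ j \<le> hi E0 $ j"
  shows "E0 = E1"
proof -
  have c: "ip_cell E0" "ip_cell E1" using ip_meshD(2)[OF A] E by auto
  have "lo E0 $ j < hi E1 $ j \<and> lo E1 $ j < hi E0 $ j" for j
  proof -
    note c' = ip_cellD(3-5)[OF c(1), of j] ip_cellD(3-5)[OF c(2), of j] ends_less[of j] proj[of j]
    show ?thesis using E(3)
    proof (cases rule: mirror_cases[of _ _ j])
      case 1
      then show ?thesis using c' by (auto simp: proj_ip_nth midpt_nth)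
    next
      case 2
      note left_copyD(1,3,4)[OF 2]
      moreover from this have "proj_ip p n (midpt E) $ j = real (p j) + 1"
        using c' by (auto simp: proj_ip_nth midpt_nth)
      ultimately show ?thesis using c' by auto
    next
      case 3
      note right_copyD(1-3)[OF 3]
      moreover from this have "proj_ip p n (midpt E) $ j = real (n j) + 1"
        using c' by (auto simp: proj_ip_nth midpt_nth)
      ultimately show ?thesis using c' by auto
    qed
  qed
  then show ?thesis using ip_meshD(3)[OF A E(1,2)] by (auto simp: overlap_def)
qed

lemma extension_inner:
  assumes A: "ip_mesh A" and E: "E \<in> extension A"
    and same: "\<And>j. \<not> left_copy j (real (p j) + 1) (lo E $ j) (hi E $ j)"
      "\<And>j. \<not> right_copy j (real (n j) + 1) (lo E $ j) (hi E $ j)"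
  shows "E \<in> A"
proof -
  obtain E0 where E0: "E0 \<in> A" "mirror E0 E" using E by (auto simp: extension_def)
  have "lo E $ j = lo E0 $ j \<and> hi E $ j = hi E0 $ j" for j
    using E0(2)
  proof (cases rule: mirror_cases[of _ _ j])
    case 2
    then show ?thesis using left_copyD(1)[OF 2] same(1)[of j] by simp
  next
    case 3
    then show ?thesis using right_copyD(1)[OF 3] same(2)[of j] by simp
  qed simp
  then have "E = E0" using E0(2) by (intro elem_eqI) (auto simp: vec_eq_iff mirror_def)
  then show ?thesis using E0 by simp
qed

text \<open>A copied direction puts the midpoint of the element outside
  \<open>ip_domain\<close>.\<close>

lemma extension_ip_domain_iff:
  assumes "ip_mesh A"
  shows "E \<in> extension A \<and> elem_box E \<subseteq> ip_domain p n \<longleftrightarrow> E \<in> A"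
proof
  assume E: "E \<in> extension A \<and> elem_box E \<subseteq> ip_domain p n"
  then obtain E0 where E0: "E0 \<in> A" "mirror E0 E" by (auto simp: extension_def)
  have c: "ip_cell E0" using ip_meshD(2)[OF assms E0(1)] .
  have less: "lo E $ j < hi E $ j" for j
    using E0(2) ip_cellD(5)[OF c, of j]
    by (cases rule: mirror_cases[of _ _ j]) (auto dest: left_copyD(3) right_copyD(3))
  then have "midpt E \<in> elem_box E"
    by (auto simp: elem_box_def mem_box_cart midpt_nth)
  then have "midpt E \<in> ip_domain p n" using E by blast
  then have m: "real (p j) + 1 < midpt E $ j" "midpt E $ j < real (n j) + 1" for j
    by (auto simp: ip_domain_def mem_box_cart)
  show "E \<in> A"
  proof (rule extension_inner[OF assms])
    show "\<not> left_copy j (real (p j) + 1) (lo E $ j) (hi E $ j)" for j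
      using left_copyD(3,4)[of j _ "lo E $ j" "hi E $ j"] m[of j] less[of j] by (force simp: midpt_nth)
    show "\<not> right_copy j (real (n j) + 1) (lo E $ j) (hi E $ j)" for j
      using right_copyD(2,3)[of j _ "lo E $ j" "hi E $ j"] m[of j] less[of j] by (force simp: midpt_nth)
  qed (use E in auto)
next
  assume E: "E \<in> A"
  then have c: "ip_cell E" using ip_meshD(2)[OF assms] by blast
  have "elem_box E \<subseteq> ip_domain p n"
    using ip_cellD(3,4)[OF c] unfolding elem_box_def ip_domain_def
    by (auto simp: mem_box_cart) (meson le_less_trans less_le_trans)+
  then show "E \<in> extension A \<and> elem_box E \<subseteq> ip_domain p n"
    using E extension_superset by auto
qed

section \<open>Compatibility of copying with bisection and refinement\<close>

lemma mirror_child_other: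
  assumes "mirror (lower_child E0) E \<or> mirror (upper_child E0) E" "j \<noteq> split_dir (level E0)"
  shows "lo E $ j = lo E0 $ j \<and> hi E $ j = hi E0 $ j \<or>
        left_copy j (lo E0 $ j) (lo E $ j) (hi E $ j) \<or> right_copy j (hi E0 $ j) (lo E $ j) (hi E $ j)"
  using assms unfolding mirror_def
  by (elim disjE conjE allE[of _ j]) (simp_all add: lower_child_def upper_child_def)

text \<open>In an uncopied split direction, cell and copy are cut at the same midpoint. In a copied
  one the knots coincide, the box stays, and the result is a copy of the child touching that end:
  the lower child on the left, the upper child on the right.\<close>

lemma bisect_mirror:
  assumes c: "ip_cell E0"
  shows "(\<Union>E\<in>{E. mirror E0 E}. bisect t E) = {E'. \<exists>E0'\<in>bisect t E0. mirror E0' E'}"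
proof (intro subset_antisym subsetI)
  let ?s = "split_dir (level E0)"
  note cs = ip_cellD(3-5)[OF c, of ?s] ip_cell_knots_less[OF c, of ?s]
  fix E' assume "E' \<in> (\<Union>E\<in>{E. mirror E0 E}. bisect t E)"
  then obtain E where E: "mirror E0 E" "E' \<in> bisect t E" by auto
  have l: "level E = level E0" using E by (simp add: mirror_def)
  have "mirror (lower_child E0) E' \<or> mirror (upper_child E0) E'" using E(1)
  proof (cases rule: mirror_cases[of _ _ ?s])
    case 1
    then have "E' = lower_child E \<or> E' = upper_child E" using E(2) cs(4) by (simp add: bisect_eq l)
    moreover have "mirror (lower_child E0) (lower_child E)" "mirror (upper_child E0) (upper_child E)"
      using E(1) 1 by (auto simp: mirror_def lower_child_def upper_child_def midpt_nth)
    ultimately show ?thesis by auto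
  next
    case 2
    then have "E' = Elem (lo E) (hi E) (level E + 1)"
      using E(2) left_copyD(5)[OF 2] by (simp add: bisect_eq l)
    then have "mirror (lower_child E0) E'"
      using E(1) 2 by (auto simp: mirror_def lower_child_def)
    then show ?thesis ..
  next
    case 3
    then have "E' = Elem (lo E) (hi E) (level E + 1)"
      using E(2) right_copyD(5)[OF 3] by (simp add: bisect_eq l)
    then have "mirror (upper_child E0) E'"
      using E(1) 3 by (auto simp: mirror_def upper_child_def)
    then show ?thesis ..
  qed
  then show "E' \<in> {E'. \<exists>E0'\<in>bisect t E0. mirror E0' E'}"
    by (auto simp: bisect_ip_cell[OF c])
next
  let ?s = "split_dir (level E0)"
  note cs = ip_cellD(3-5)[OF c, of ?s] ip_cell_knots_less[OF c, of ?s]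
  fix E' assume "E' \<in> {E'. \<exists>E0'\<in>bisect t E0. mirror E0' E'}"
  then consider "mirror (lower_child E0) E'" | "mirror (upper_child E0) E'"
    by (auto simp: bisect_ip_cell[OF c])
  then have "\<exists>E. mirror E0 E \<and> E' \<in> bisect t E"
  proof cases
    case 1
    then have l: "level E' = level E0 + 1" by (simp add: mirror_def lower_child_def)
    from 1 show ?thesis
    proof (cases rule: mirror_cases[of _ _ ?s])
      case a: 1
      define E where "E = Elem (lo E') (\<chi> i. if i = ?s then hi E0 $ i else hi E' $ i) (level E0)"
      have "mirror E0 E" unfolding mirror_def
      proof (intro conjI allI)
        show "lo E $ j = lo E0 $ j \<and> hi E $ j = hi E0 $ j \<or>
            left_copy j (lo E0 $ j) (lo E $ j) (hi E $ j) \<or> right_copy j (hi E0 $ j) (lo E $ j) (hi E $ j)" for j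
          using a mirror_child_other[of E0 E' j] 1
          by (cases "j = ?s") (simp_all add: E_def lower_child_def)
      qed (simp add: E_def)
      moreover have "E' = lower_child E"
        using a l by (intro elem_eqI) (auto simp: lower_child_def E_def vec_eq_iff midpt_nth)
      moreover have "lower_child E \<in> bisect t E"
        using a cs(4) by (simp add: bisect_eq E_def lower_child_def)
      ultimately show ?thesis by blast
    next
      case a: 2
      define E where "E = Elem (lo E') (hi E') (level E0)"
      have "mirror E0 E" unfolding mirror_def
      proof (intro conjI allI)
        show "lo E $ j = lo E0 $ j \<and> hi E $ j = hi E0 $ j \<or>
            left_copy j (lo E0 $ j) (lo E $ j) (hi E $ j) \<or> right_copy j (hi E0 $ j) (lo E $ j) (hi E $ j)" for j
          using a mirror_child_other[of E0 E' j] 1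
          by (cases "j = ?s") (simp_all add: E_def lower_child_def)
      qed (simp add: E_def)
      moreover have "E' \<in> bisect t E"
        using left_copyD(5)[OF a] l by (cases E') (simp add: bisect_eq E_def)
      ultimately show ?thesis by blast
    next
      case a: 3
      \<comment> \<open>The lower child ends at the midpoint and cannot reach the right end of the
        domain.\<close>
      then have "midpt E0 $ ?s = real (n ?s) + 1"
        using right_copyD(1)[OF a] by (simp add: lower_child_def)
      then show ?thesis using cs by (simp add: midpt_nth)
    qed
  next
    case 2
    then have l: "level E' = level E0 + 1" by (simp add: mirror_def upper_child_def)
    from 2 show ?thesis
    proof (cases rule: mirror_cases[of _ _ ?s])
      case a: 1
      define E where "E = Elem (\<chi> i. if i = ?s then lo E0 $ i else lo E' $ i) (hi E') (level E0)"
      have "mirror E0 E" unfolding mirror_def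
      proof (intro conjI allI)
        show "lo E $ j = lo E0 $ j \<and> hi E $ j = hi E0 $ j \<or>
            left_copy j (lo E0 $ j) (lo E $ j) (hi E $ j) \<or> right_copy j (hi E0 $ j) (lo E $ j) (hi E $ j)" for j
          using a mirror_child_other[of E0 E' j] 2
          by (cases "j = ?s") (simp_all add: E_def upper_child_def)
      qed (simp add: E_def)
      moreover have "E' = upper_child E"
        using a l by (intro elem_eqI) (auto simp: upper_child_def E_def vec_eq_iff midpt_nth)
      moreover have "upper_child E \<in> bisect t E"
        using a cs(4) by (simp add: bisect_eq E_def upper_child_def)
      ultimately show ?thesis by blast
    next
      case a: 2
      then have "midpt E0 $ ?s = real (p ?s) + 1"
        using left_copyD(1)[OF a] by (simp add: upper_child_def)
      then show ?thesis using cs by (simp add: midpt_nth)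
    next
      case a: 3
      define E where "E = Elem (lo E') (hi E') (level E0)"
      have "mirror E0 E" unfolding mirror_def
      proof (intro conjI allI)
        show "lo E $ j = lo E0 $ j \<and> hi E $ j = hi E0 $ j \<or>
            left_copy j (lo E0 $ j) (lo E $ j) (hi E $ j) \<or> right_copy j (hi E0 $ j) (lo E $ j) (hi E $ j)" for j
          using a mirror_child_other[of E0 E' j] 2
          by (cases "j = ?s") (simp_all add: E_def upper_child_def)
      qed (simp add: E_def)
      moreover have "E' \<in> bisect t E"
        using right_copyD(5)[OF a] l by (cases E') (simp add: bisect_eq E_def)
      ultimately show ?thesis by blast
    qed
  qed
  then show "E' \<in> (\<Union>E\<in>{E. mirror E0 E}. bisect t E)" by auto
qed

text \<open>By \<open>mirror_unique\<close> an element is a copy of only one cell, so removing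
  \<open>C\<close> removes exactly the copies of cells in \<open>C\<close>; the rest is
  \<open>bisect_mirror\<close>.\<close>

lemma extension_ip_refine:
  assumes A: "ip_mesh A" and C: "C \<subseteq> A"
  shows "extension (ip_refine A C) = (extension A - extension C) \<union> (\<Union>E\<in>extension C. bisect t E)"
proof -
  have "extension (A - C) = extension A - extension C"
  proof -
    have "E0 = E1" if "E0 \<in> A" "E1 \<in> A" "mirror E0 E" "mirror E1 E" for E0 E1 E
      using mirror_unique[OF A that(1,2,4)] proj_midpt_mirror(1)[OF ip_meshD(2)[OF A that(1)] that(3)] by blast
    then show ?thesis using C by (auto simp: extension_def)
  qed
  moreover have "extension (\<Union>E\<in>C. bisect t E) = (\<Union>E\<in>extension C. bisect t E)"
  proof -
    have "extension (\<Union>E\<in>C. bisect t E) = (\<Union>E0\<in>C. {E'. \<exists>E0'\<in>bisect t E0. mirror E0' E'})"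
      by (auto simp: extension_def)
    also have "\<dots> = (\<Union>E0\<in>C. \<Union>E\<in>{E. mirror E0 E}. bisect t E)"
    proof (rule SUP_cong[OF refl])
      fix E0 assume "E0 \<in> C"
      then have "ip_cell E0" using ip_meshD(2)[OF A] C by blast
      then show "{E'. \<exists>E0'\<in>bisect t E0. mirror E0' E'} = (\<Union>E\<in>{E. mirror E0 E}. bisect t E)"
        by (rule bisect_mirror[symmetric])
    qed
    also have "\<dots> = (\<Union>E\<in>extension C. bisect t E)" by (auto simp: extension_def)
    finally show ?thesis .
  qed
  moreover have "extension (B \<union> B') = extension B \<union> extension B'" for B B'
    by (auto simp: extension_def)
  ultimately show ?thesis by (simp add: ip_refine_def)
qed

text \<open>The elements whose projected midpoint lies on the boundary of an inner cell are exactly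
  its copies other than the cell itself, since a projected midpoint determines its cell.\<close>

lemma prolongation_union:
  assumes A: "ip_mesh A" and C: "C \<subseteq> A"
  shows "C \<union> (\<Union>E\<in>C. prolongation p n (extension A) E) = extension C"
proof (intro subset_antisym subsetI)
  fix E assume "E \<in> C \<union> (\<Union>E\<in>C. prolongation p n (extension A) E)"
  then consider "E \<in> C" | E0 where "E0 \<in> C" "E \<in> prolongation p n (extension A) E0" by auto
  then show "E \<in> extension C"
  proof cases
    case 1
    then show ?thesis using extension_superset by auto
  next
    case 2
    then obtain E1 where E1: "E1 \<in> A" "mirror E1 E" by (auto simp: prolongation_def extension_def)
    have "proj_ip p n (midpt E) \<in> cbox (lo E0) (hi E0)"
      using 2 frontier_subset_closed[OF closed_cbox] closure_minimal[OF box_subset_cbox closed_cbox]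
      by (auto simp: prolongation_def elem_box_def frontier_def)
    then have "E0 = E1"
      using mirror_unique[OF A _ E1] 2(1) C by (auto simp: mem_box_cart)
    then show ?thesis using E1 2 by (auto simp: extension_def)
  qed
next
  fix E assume "E \<in> extension C"
  then obtain E0 where E0: "E0 \<in> C" "mirror E0 E" by (auto simp: extension_def)
  have c: "ip_cell E0" using ip_meshD(2)[OF A] C E0(1) by auto
  show "E \<in> C \<union> (\<Union>E\<in>C. prolongation p n (extension A) E)"
  proof (cases "E = E0")
    case False
    have "\<exists>j. \<not> (lo E $ j = lo E0 $ j \<and> hi E $ j = hi E0 $ j)"
      using False E0(2) elem_eqI[of E E0] by (auto simp: vec_eq_iff mirror_def)
    then obtain j where "proj_ip p n (midpt E) $ j = lo E0 $ j \<or> proj_ip p n (midpt E) $ j = hi E0 $ j"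
      using proj_midpt_mirror(2)[OF c E0(2)] by blast
    then have "proj_ip p n (midpt E) \<notin> box (lo E0) (hi E0)"
      by (auto simp: mem_box_cart intro!: exI[of _ j])
    moreover have "proj_ip p n (midpt E) \<in> cbox (lo E0) (hi E0)"
      using proj_midpt_mirror(1)[OF c E0(2)] by (auto simp: mem_box_cart)
    moreover have "box (lo E0) (hi E0) \<noteq> {}" using ip_cellD(5)[OF c] by (simp add: interval_ne_empty_cart)
    ultimately have "proj_ip p n (midpt E) \<in> frontier (elem_box E0)"
      unfolding frontier_def elem_box_def interior_open[OF open_box] by simp
    then show ?thesis using E0 C by (auto simp: prolongation_def extension_def)
  qed (use E0 in auto)
qed

lemma neighbors_extension:
  assumes "ip_mesh A"
  shows "neighbors p n (extension A) P = {E \<in> A. level E < level P \<and> near P E}"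
proof -
  have "near P E \<longleftrightarrow> (\<exists>x\<in>elem_box E. \<forall>j. \<bar>x $ j - midpt P $ j\<bar> < nb_dist p (level P) j)" if "E \<in> A" for E
    using near_iff ip_cellD(5) ip_meshD(2)[OF assms that] by blast
  then show ?thesis
    using extension_ip_domain_iff[OF assms] unfolding neighbors_def by blast
qed

text \<open>In a copied direction both end knots coincide and the parametric image is empty.\<close>

lemma param_mesh_cell:
  assumes A: "ip_mesh A" and Q: "Q \<in> extension A" "measure lborel (param_image t Q) > 0"
  shows "Q \<in> A"
proof -
  have "param_image t Q \<noteq> {}" using Q(2) by auto
  then have "knot t j (lo Q $ j) < knot t j (hi Q $ j)" for j
    by (auto simp: param_image_def interval_ne_empty_cart)
  then show "Q \<in> A"
    using extension_inner[OF A Q(1)] left_copyD(5) right_copyD(5) by (metis less_irrefl)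
qed

text \<open>Marked elements have images of positive measure and neighbours lie in
  \<open>ip_domain\<close>, so the closure consists of inner cells only.\<close>

lemma refine_extension:
  assumes A: "ip_mesh A" and N: "N \<subseteq> param_mesh t (extension A)"
  shows "\<exists>A'. ip_mesh A' \<and> refine p n t (extension A) N = extension A'"
proof -
  define S where "S = {Q \<in> extension A. param_image t Q \<in> N}"
  define C where "C = neighbor_closure p n (extension A) S"
  have "S \<subseteq> A"
  proof
    fix Q assume Q: "Q \<in> S"
    then show "Q \<in> A"
      using N param_mesh_cell[OF A, of Q] by (auto simp: S_def param_mesh_def)
  qed
  have "C \<subseteq> A"
  proof
    fix E assume "E \<in> C"
    then show "E \<in> A" unfolding C_def
      by induction (use \<open>S \<subseteq> A\<close> neighbors_extension[OF A] in auto)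
  qed
  have "ip_mesh (ip_refine A C)"
  proof (rule ip_mesh_refine[OF A \<open>C \<subseteq> A\<close>])
    fix E E' assume "E \<in> C" "E' \<in> A" "level E' < level E" "near E E'"
    then show "E' \<in> C" unfolding C_def
      using neighbor_closure.step[of E p n "extension A" S E'] neighbors_extension[OF A] by simp
  qed
  moreover have "refine p n t (extension A) N = extension (ip_refine A C)"
    unfolding refine_def S_def[symmetric] C_def[symmetric] Let_def
      prolongation_union[OF A \<open>C \<subseteq> A\<close>] extension_ip_refine[OF A \<open>C \<subseteq> A\<close>] ..
  ultimately show ?thesis by blast
qed

section \<open>The initial mesh and the form of admissible meshes\<close>

definition initial_ip_mesh :: "'d elem set" where
  "initial_ip_mesh = {Elem (\<chi> j. real (l j)) (\<chi> j. real (l j) + 1) 0 | l :: 'd \<Rightarrow> nat.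
     \<forall>j. p j + 1 \<le> l j \<and> l j \<le> n j}"

lemma ip_mesh_initial: "ip_mesh initial_ip_mesh"
proof -
  have "initial_ip_mesh \<subseteq> (\<lambda>l. Elem (\<chi> j. real (l j)) (\<chi> j. real (l j) + 1) 0) ` (PiE UNIV (\<lambda>j. {..n j}))"
    by (auto simp: initial_ip_mesh_def)
  moreover have "finite ((\<lambda>l. Elem (\<chi> j. real (l j)) (\<chi> j. real (l j) + 1) 0 :: 'd elem) ` (PiE UNIV (\<lambda>j. {..n j})))"
    by (intro finite_imageI finite_PiE) auto
  ultimately have "finite initial_ip_mesh" by (rule finite_subset)
  moreover have "ip_cell E" if E: "E \<in> initial_ip_mesh" for E
  proof -
    obtain l where l: "E = Elem (\<chi> j. real (l j)) (\<chi> j. real (l j) + 1) 0" "\<forall>j. p j + 1 \<le> l j \<and> l j \<le> n j"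
      using E unfolding initial_ip_mesh_def by blast
    have "on_grid 0 j (real (l j))" for j using on_grid_of_int[of 0 j "int (l j)"] by simp
    moreover have "real (p j) + 1 \<le> real (l j)" "real (l j) \<le> real (n j)" for j
      using l(2)[rule_format, of j] by linarith+
    ultimately show ?thesis using l(1) by (simp add: ip_cell_def)
  qed
  moreover have "E = E'" if E: "E \<in> initial_ip_mesh" "E' \<in> initial_ip_mesh" "overlap E E'" for E E'
  proof -
    obtain l where l: "E = Elem (\<chi> j. real (l j)) (\<chi> j. real (l j) + 1) 0"
      using E unfolding initial_ip_mesh_def by blast
    obtain l' where l': "E' = Elem (\<chi> j. real (l' j)) (\<chi> j. real (l' j) + 1) 0"
      using E unfolding initial_ip_mesh_def by blast
    have "real (l j) < real (l' j) + 1 \<and> real (l' j) < real (l j) + 1" for j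
      using E(3) by (simp add: overlap_def l l')
    then have "l j = l' j" for j by (metis Suc_eq_plus1 less_Suc_eq_le nle_le of_nat_1 of_nat_add of_nat_less_iff)
    then show ?thesis by (simp add: l l')
  qed
  moreover have "\<exists>E\<in>initial_ip_mesh. \<forall>j. lo E $ j \<le> x $ j \<and> x $ j \<le> hi E $ j"
    if x: "\<forall>j. real (p j) + 1 \<le> x $ j \<and> x $ j \<le> real (n j) + 1" for x
  proof -
    \<comment> \<open>The minimum takes care of the right end \<open>x $ j = real (n j) + 1\<close>,
      whose floor is not the index of an inner cell.\<close>
    define l where "l j = min (n j) (nat \<lfloor>x $ j\<rfloor>)" for j
    have l: "p j + 1 \<le> l j \<and> l j \<le> n j \<and> real (l j) \<le> x $ j \<and> x $ j \<le> real (l j) + 1" for j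
    proof -
      have "real (p j) + 1 \<le> x $ j" "x $ j \<le> real (n j) + 1" using x by auto
      then have "int (p j) + 1 \<le> \<lfloor>x $ j\<rfloor>" by (simp add: le_floor_iff)
      then have "p j + 1 \<le> nat \<lfloor>x $ j\<rfloor>" by linarith
      moreover have "real (nat \<lfloor>x $ j\<rfloor>) \<le> x $ j" "x $ j \<le> real (nat \<lfloor>x $ j\<rfloor>) + 1"
      proof -
        have "0 \<le> \<lfloor>x $ j\<rfloor>" using \<open>int (p j) + 1 \<le> \<lfloor>x $ j\<rfloor>\<close> by linarith
        then have "real (nat \<lfloor>x $ j\<rfloor>) = of_int \<lfloor>x $ j\<rfloor>" by simp
        then show "real (nat \<lfloor>x $ j\<rfloor>) \<le> x $ j" "x $ j \<le> real (nat \<lfloor>x $ j\<rfloor>) + 1"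
          by linarith+
      qed
      ultimately show ?thesis
        using degree_less_n[of j] \<open>x $ j \<le> real (n j) + 1\<close> unfolding l_def
        by (cases "n j \<le> nat \<lfloor>x $ j\<rfloor>") (auto simp: min_def)
    qed
    show ?thesis
      by (rule bexI[of _ "Elem (\<chi> j. real (l j)) (\<chi> j. real (l j) + 1) 0"])
        (use l in \<open>auto simp: initial_ip_mesh_def\<close>)
  qed
  moreover have "\<not> e < level E" if "E \<in> initial_ip_mesh" for E e
    using that by (auto simp: initial_ip_mesh_def)
  ultimately show ?thesis unfolding ip_mesh_def by blast
qed

lemma initial_eq_extension: "initial_index_mesh p n = extension initial_ip_mesh"
proof (intro subset_antisym subsetI)
  fix E assume "E \<in> initial_index_mesh p n"
  then obtain l where l: "E = Elem (\<chi> j. real (l j)) (\<chi> j. real (l j) + 1) 0" "\<forall>j. 1 \<le> l j \<and> l j \<le> n j + p j"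
    unfolding initial_index_mesh_def by blast
  define l0 where "l0 j = max (p j + 1) (min (n j) (l j))" for j
  define E0 :: "'d elem" where "E0 = Elem (\<chi> j. real (l0 j)) (\<chi> j. real (l0 j) + 1) 0"
  have "E0 \<in> initial_ip_mesh"
    using degree_less_n by (auto simp: E0_def initial_ip_mesh_def l0_def)
  moreover have "mirror E0 E" unfolding mirror_def
  proof (intro conjI allI)
    fix j
    show "lo E $ j = lo E0 $ j \<and> hi E $ j = hi E0 $ j \<or>
        left_copy j (lo E0 $ j) (lo E $ j) (hi E $ j) \<or> right_copy j (hi E0 $ j) (lo E $ j) (hi E $ j)"
      using l(2)[rule_format, of j] degree_less_n[of j]
      by (cases "l j \<le> p j"; cases "n j < l j")
        (auto simp: l(1) E0_def l0_def left_copy_def right_copy_def)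
  qed (simp add: l E0_def)
  ultimately show "E \<in> extension initial_ip_mesh" by (auto simp: extension_def)
next
  fix E assume "E \<in> extension initial_ip_mesh"
  then obtain l where l: "\<forall>j. p j + 1 \<le> l j \<and> l j \<le> n j"
    and m: "mirror (Elem (\<chi> j. real (l j)) (\<chi> j. real (l j) + 1) 0) E"
    unfolding extension_def initial_ip_mesh_def by blast
  have "\<exists>k. 1 \<le> k \<and> k \<le> n j + p j \<and> lo E $ j = real k \<and> hi E $ j = real k + 1" for j
    using m
  proof (cases rule: mirror_cases[of _ _ j])
    case 1
    then show ?thesis using l[rule_format, of j] by (intro exI[of _ "l j"]) auto
  next
    case 2
    then obtain k where "1 \<le> k" "k \<le> p j" "lo E $ j = real k" "hi E $ j = real k + 1"
      by (auto simp: left_copy_def)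
    then show ?thesis by (intro exI[of _ k]) auto
  next
    case 3
    then obtain k where "n j + 1 \<le> k" "k \<le> n j + p j" "lo E $ j = real k" "hi E $ j = real k + 1"
      by (auto simp: right_copy_def)
    then show ?thesis by (intro exI[of _ k]) auto
  qed
  then obtain k where k: "\<And>j. 1 \<le> k j \<and> k j \<le> n j + p j \<and> lo E $ j = real (k j) \<and> hi E $ j = real (k j) + 1"
    by metis
  moreover have "E = Elem (\<chi> j. real (k j)) (\<chi> j. real (k j) + 1) 0"
    using k m by (intro elem_eqI) (auto simp: vec_eq_iff mirror_def)
  ultimately show "E \<in> initial_index_mesh p n" unfolding initial_index_mesh_def by blast
qed

lemma admissible_eq_extension:
  assumes "admissible_index_mesh p n t M"
  shows "finite M \<and> (\<exists>A. ip_mesh A \<and> M = extension A)"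
  using assms
proof induction
  case init
  have "initial_index_mesh p n \<subseteq>
      (\<lambda>l. Elem (\<chi> j. real (l j)) (\<chi> j. real (l j) + 1) 0) ` (PiE UNIV (\<lambda>j. {..n j + p j}))"
    by (auto simp: initial_index_mesh_def)
  moreover have "finite ((\<lambda>l. Elem (\<chi> j. real (l j)) (\<chi> j. real (l j) + 1) 0 :: 'd elem) ` (PiE UNIV (\<lambda>j. {..n j + p j})))"
    by (intro finite_imageI finite_PiE) auto
  ultimately have "finite (initial_index_mesh p n)" by (rule finite_subset)
  then show ?case using ip_mesh_initial initial_eq_extension by blast
next
  case (refine M N)
  then obtain A where A: "ip_mesh A" "M = extension A" by blast
  have "neighbor_closure p n M {Q \<in> M. param_image t Q \<in> N} \<subseteq> M"
  proof
    fix E assume "E \<in> neighbor_closure p n M {Q \<in> M. param_image t Q \<in> N}"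
    then show "E \<in> M" by induction (auto simp: neighbors_def)
  qed
  then have "finite (refine p n t M N)"
    using refine.IH unfolding refine_def Let_def
    by (auto simp: bisect_eq prolongation_def intro!: finite_UN_I elim: finite_subset rev_finite_subset)
  then show ?case using refine_extension[OF A(1)] refine.hyps A(2) by blast
qed

end

section \<open>Local index vectors\<close>

context
  fixes S :: "real set" and z :: real and c :: nat and L :: "real list"
  assumes finite_S: "finite S" and z_in: "z \<in> S"
    and below: "c \<le> card {s \<in> S. s < z}" and above: "c \<le> card {s \<in> S. z < s}"
    and L_def: "L = take (2 * c + 1) (drop (card {s \<in> S. s < z} - c) (sorted_list_of_set S))"
begin

text \<open>Sorting enumerates \<open>S\<close> increasingly by positions, so every cardinality here
  is the length of an interval of positions. The bounds \<open>below\<close> and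
  \<open>above\<close> keep \<open>drop\<close> and \<open>take\<close> within the list.\<close>

lemma
  shows consecutive_length: "length L = 2 * c + 1"
    and consecutive_strict: "i < j \<Longrightarrow> j \<le> 2 * c \<Longrightarrow> L ! i < L ! j"
    and consecutive_subset: "set L \<subseteq> S"
    and consecutive_middle: "L ! c = z"
    and consecutive_card_below: "card {s \<in> S. L ! 0 \<le> s \<and> s < z} = c"
    and consecutive_card_above: "card {s \<in> S. z < s \<and> s \<le> L ! (2 * c)} = c"
proof -
  define xs where "xs = sorted_list_of_set S"
  define k where "k = card {s \<in> S. s < z}"
  define N where "N = length xs"
  have xs: "set xs = S" "sorted_wrt (<) xs"
    using finite_S by (simp_all add: xs_def)
  have less_iff: "xs ! i < xs ! j \<longleftrightarrow> i < j" if "i < N" "j < N" for i j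
    using sorted_wrt_nth_less[OF xs(2)] that unfolding N_def
    by (metis less_asym linorder_neqE_nat less_irrefl)
  have le_iff: "xs ! i \<le> xs ! j \<longleftrightarrow> i \<le> j" if "i < N" "j < N" for i j
    using less_iff[of j i] that by (simp add: not_less[symmetric])
  have inj: "inj_on ((!) xs) {..<N}"
    by (rule inj_onI) (metis less_iff lessThan_iff linorder_neqE_nat less_irrefl)
  have S: "S = (!) xs ` {..<N}"
    using xs(1) by (auto simp: set_conv_nth N_def)
  have card_image: "card ((!) xs ` I) = card I" if "I \<subseteq> {..<N}" for I
    using inj that by (meson card_image inj_on_subset)
  obtain k' where k': "k' < N" "z = xs ! k'" using z_in S by auto
  have "{s \<in> S. s < z} = (!) xs ` {..<k'}"
    using k' by (auto simp: S less_iff)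
  then have "k = k'" using card_image[of "{..<k'}"] k' by (simp add: k_def)
  then have k: "k < N" "z = xs ! k" using k' by auto
  have "{s \<in> S. z < s} = (!) xs ` {k<..<N}"
    using k by (auto simp: S less_iff)
  moreover have "{k<..<N} \<subseteq> {..<N}" by auto
  ultimately have "c \<le> N - k - 1" using card_image[of "{k<..<N}"] above by simp
  then have ck: "c \<le> k" "k + c < N" using below k(1) unfolding k_def[symmetric] by linarith+
  have L: "L = take (2 * c + 1) (drop (k - c) xs)" by (simp add: L_def k_def xs_def)
  then show len: "length L = 2 * c + 1" using ck by (simp add: N_def)
  have nth: "L ! i = xs ! (k - c + i)" if "i \<le> 2 * c" for i
    using that ck by (simp add: L N_def)
  show "i < j \<Longrightarrow> j \<le> 2 * c \<Longrightarrow> L ! i < L ! j"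
    using nth[of i] nth[of j] less_iff[of "k - c + i" "k - c + j"] ck by simp
  show "set L \<subseteq> S"
    unfolding L using xs(1) set_take_subset set_drop_subset by (metis order.trans)
  show "L ! c = z" using nth[of c] k ck by simp
  have "{s \<in> S. L ! 0 \<le> s \<and> s < z} = (!) xs ` {k - c..<k}"
    using k ck nth[of 0] by (auto simp: S less_iff le_iff)
  moreover have "{k - c..<k} \<subseteq> {..<N}" using k by auto
  ultimately show "card {s \<in> S. L ! 0 \<le> s \<and> s < z} = c"
    using card_image[of "{k - c..<k}"] ck by simp
  have "{s \<in> S. z < s \<and> s \<le> L ! (2 * c)} = (!) xs ` {k<..k + c}"
    using k ck nth[of "2 * c"] by (auto simp: S less_iff le_iff)
  moreover have "{k<..k + c} \<subseteq> {..<N}" using ck by auto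
  ultimately show "card {s \<in> S. z < s \<and> s \<le> L ! (2 * c)} = c"
    using card_image[of "{k<..k + c}"] by simp
qed

lemma consecutive_sorted: "i \<le> j \<Longrightarrow> j \<le> 2 * c \<Longrightarrow> L ! i \<le> L ! j"
  using consecutive_strict[of i j] by (cases "i = j") auto

lemma consecutive_bounds: "s \<in> set L \<Longrightarrow> L ! 0 \<le> s \<and> s \<le> L ! (2 * c)"
  using consecutive_sorted[of 0] consecutive_sorted[of _ "2 * c"] consecutive_length
  by (auto simp: in_set_conv_nth)

lemma consecutive_ends: "L ! 0 \<in> S" "L ! (2 * c) \<in> S"
  using consecutive_subset consecutive_length by (auto intro!: subsetD[OF consecutive_subset] nth_mem)

text \<open>Otherwise \<open>T\<close> together with the last local index would give c + 1 indices
  where only c exist. This and \<open>first_ge\<close> bound the support once the anchor is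
  located.\<close>

lemma last_le:
  assumes "T \<subseteq> S" "c \<le> card T" "\<And>s. s \<in> T \<Longrightarrow> z < s \<and> s \<le> g" "z \<le> g"
  shows "L ! (2 * c) \<le> g"
proof (rule ccontr)
  assume *: "\<not> L ! (2 * c) \<le> g"
  have "finite T" using assms(1) finite_S finite_subset by blast
  moreover have "L ! (2 * c) \<notin> T" using assms(3) * by blast
  moreover have sub: "insert (L ! (2 * c)) T \<subseteq> {s \<in> S. z < s \<and> s \<le> L ! (2 * c)}"
    using assms * consecutive_ends by (fastforce simp: not_le)
  have "card (insert (L ! (2 * c)) T) \<le> c"
    using card_mono[OF _ sub] finite_S consecutive_card_above by simp
  ultimately show False using assms(2) by simp
qed

lemma first_ge:
  assumes "T \<subseteq> S" "c \<le> card T" "\<And>s. s \<in> T \<Longrightarrow> g \<le> s \<and> s < z" "g \<le> z"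
  shows "g \<le> L ! 0"
proof (rule ccontr)
  assume *: "\<not> g \<le> L ! 0"
  have "finite T" using assms(1) finite_S finite_subset by blast
  moreover have "L ! 0 \<notin> T" using assms(3) * by blast
  moreover have sub: "insert (L ! 0) T \<subseteq> {s \<in> S. L ! 0 \<le> s \<and> s < z}"
    using assms * consecutive_ends by (fastforce simp: not_le)
  have "card (insert (L ! 0) T) \<le> c"
    using card_mono[OF _ sub] finite_S consecutive_card_below by simp
  ultimately show False using assms(2) by simp
qed

text \<open>The same count with the roles exchanged: only c indices lie below the anchor and not
  below the first local index. This and \<open>middle_ge\<close> locate the anchor from a single
  local index \<open>s0\<close>.\<close>

lemma middle_le:
  assumes "T \<subseteq> S" "c \<le> card T" "\<And>s. s \<in> T \<Longrightarrow> s0 < s \<and> s \<le> g" "s0 \<in> set L" "s0 \<le> g"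
  shows "z \<le> g"
proof (rule ccontr)
  assume *: "\<not> z \<le> g"
  have "finite T" using assms(1) finite_S finite_subset by blast
  moreover have "s0 \<notin> T" using assms(3) by blast
  moreover have sub: "insert s0 T \<subseteq> {s \<in> S. L ! 0 \<le> s \<and> s < z}"
    using assms * consecutive_bounds[OF assms(4)] consecutive_subset by (fastforce simp: not_le)
  have "card (insert s0 T) \<le> c"
    using card_mono[OF _ sub] finite_S consecutive_card_below by simp
  ultimately show False using assms(2) by simp
qed

lemma middle_ge:
  assumes "T \<subseteq> S" "c \<le> card T" "\<And>s. s \<in> T \<Longrightarrow> g \<le> s \<and> s < s0" "s0 \<in> set L" "g \<le> s0"
  shows "g \<le> z"
proof (rule ccontr)
  assume *: "\<not> g \<le> z"
  have "finite T" using assms(1) finite_S finite_subset by blast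
  moreover have "s0 \<notin> T" using assms(3) by blast
  moreover have sub: "insert s0 T \<subseteq> {s \<in> S. z < s \<and> s \<le> L ! (2 * c)}"
    using assms * consecutive_bounds[OF assms(4)] consecutive_subset by (fastforce simp: not_le)
  have "card (insert s0 T) \<le> c"
    using card_mono[OF _ sub] finite_S consecutive_card_above by simp
  ultimately show False using assms(2) by simp
qed

end

section \<open>The skeleton\<close>

context spline_setting
begin

lemma extension_less:
  assumes "ip_mesh A" "E \<in> extension A"
  shows "lo E $ j < hi E $ j"
proof -
  obtain E0 where E0: "E0 \<in> A" "mirror E0 E" using assms by (auto simp: extension_def)
  from E0(2) show ?thesis
    using ip_cellD(5)[OF ip_meshD(2)[OF assms(1) E0(1)], of j]
    by (cases rule: mirror_cases[of _ _ j]) (auto dest: left_copyD(3) right_copyD(3))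
qed

lemma closure_elem_box:
  assumes "\<And>j. lo E $ j < hi E $ j"
  shows "x \<in> closure (elem_box E) \<longleftrightarrow> (\<forall>j. lo E $ j \<le> x $ j \<and> x $ j \<le> hi E $ j)"
proof -
  have "box (lo E) (hi E) \<noteq> {}" using assms by (simp add: interval_ne_empty_cart)
  then show ?thesis by (simp add: elem_box_def closure_box mem_box_cart)
qed

text \<open>The mesh element through \<open>w\<close> is assembled direction by direction: inside
  the domain the interval of \<open>E\<close>, outside a unit interval around \<open>w $ i\<close>.
  In direction \<open>j\<close> the point has to be an end of its interval, which holds on the grid
  inside and at integers outside.\<close>

lemma skeletonI:
  assumes A: "ip_mesh A" and E: "E \<in> A"
    and w: "\<And>i. 1 \<le> w $ i \<and> w $ i \<le> real (n i + p i + 1)"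
    and proj: "\<And>i. lo E $ i \<le> proj_ip p n w $ i \<and> proj_ip p n w $ i \<le> hi E $ i"
    and grid: "on_grid (level E) j (w $ j)"
    and inner: "w $ j \<in> \<int> \<or> (real (p j) + 1 \<le> w $ j \<and> w $ j \<le> real (n j) + 1)"
  shows "w \<in> skeleton (extension A) j"
proof -
  have c: "ip_cell E" using ip_meshD(2)[OF A E] .
  have "\<exists>l h. l \<le> w $ i \<and> w $ i \<le> h \<and> (l = lo E $ i \<and> h = hi E $ i \<or> left_copy i (lo E $ i) l h \<or>
      right_copy i (hi E $ i) l h) \<and> (i = j \<longrightarrow> w $ i = l \<or> w $ i = h)" for i
  proof -
    note ci = ip_cellD(3-5)[OF c, of i] ends_less[of i]
    consider "real (p i) + 1 \<le> w $ i" "w $ i \<le> real (n i) + 1" | "w $ i < real (p i) + 1" | "real (n i) + 1 < w $ i"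
      by linarith
    then show ?thesis
    proof cases
      case 1
      then have "proj_ip p n w $ i = w $ i" by (simp add: proj_ip_nth)
      then have "lo E $ i \<le> w $ i" "w $ i \<le> hi E $ i" using proj[of i] by auto
      then show ?thesis using ip_cell_grid_point[OF c, of j "w $ j"] grid by blast
    next
      case 2
      then have pr: "proj_ip p n w $ i = real (p i) + 1" using ci by (simp add: proj_ip_nth)
      then have lo: "lo E $ i = real (p i) + 1" using proj[of i] ci by simp
      define k where "k = nat \<lfloor>w $ i\<rfloor>"
      have "1 \<le> w $ i" using w by blast
      then have f: "1 \<le> \<lfloor>w $ i\<rfloor>" by simp
      then have k: "real k = of_int \<lfloor>w $ i\<rfloor>" by (simp add: k_def)
      have "real k < real (p i) + 1" using 2 k by linarith
      then have "left_copy i (lo E $ i) (real k) (real k + 1)"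
        using f lo k unfolding left_copy_def by (intro conjI exI[of _ k]) linarith+
      moreover have "real k \<le> w $ i" "w $ i \<le> real k + 1" using k by linarith+
      moreover have "w $ i = real k" if "i = j"
      proof -
        have "w $ i \<in> \<int>" using inner that 2 by auto
        then show ?thesis using k by (auto elim!: Ints_cases)
      qed
      ultimately show ?thesis by blast
    next
      case 3
      then have pr: "proj_ip p n w $ i = real (n i) + 1" using ci by (simp add: proj_ip_nth)
      then have hi: "hi E $ i = real (n i) + 1" using proj[of i] ci by simp
      \<comment> \<open>Rounding up rather than down: \<open>w $ i\<close> may be the last index n +
        p + 1, which is only the upper end of a unit interval.\<close>
      define k where "k = nat (\<lceil>w $ i\<rceil> - 1)"
      have f: "int (n i) + 1 < \<lceil>w $ i\<rceil>" using 3 by (simp add: less_ceiling_iff)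
      then have k: "real k = of_int \<lceil>w $ i\<rceil> - 1" "n i + 1 \<le> k" by (auto simp: k_def)
      have "w $ i \<le> of_int (int (n i + p i + 1))" using w[of i] by simp
      then have "\<lceil>w $ i\<rceil> \<le> int (n i + p i + 1)" by (simp only: ceiling_le_iff)
      then have "k \<le> n i + p i" unfolding k_def by linarith
      then have "right_copy i (hi E $ i) (real k) (real k + 1)"
        using k hi by (auto simp: right_copy_def)
      moreover have "real k \<le> w $ i" "w $ i \<le> real k + 1" using k by linarith+
      moreover have "w $ i = real k + 1" if "i = j"
      proof -
        have "w $ i \<in> \<int>" using inner that 3 by auto
        then show ?thesis using k by (auto elim!: Ints_cases)
      qed
      ultimately show ?thesis by blast
    qed
  qed
  then obtain l h where lh: "\<And>i. l i \<le> w $ i \<and> w $ i \<le> h i \<and> (l i = lo E $ i \<and> h i = hi E $ i \<or>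
      left_copy i (lo E $ i) (l i) (h i) \<or> right_copy i (hi E $ i) (l i) (h i)) \<and>
      (i = j \<longrightarrow> w $ i = l i \<or> w $ i = h i)"
    by metis
  define E' where "E' = Elem (\<chi> i. l i) (\<chi> i. h i) (level E)"
  have "mirror E E'" using lh by (auto simp: mirror_def E'_def)
  then have E': "E' \<in> extension A" using E by (auto simp: extension_def)
  moreover have "w \<in> closure (elem_box E')"
    unfolding closure_elem_box[OF extension_less[OF A E']] using lh by (simp add: E'_def)
  moreover have "w $ j \<in> {lo E' $ j, hi E' $ j}" using lh by (auto simp: E'_def)
  ultimately show ?thesis unfolding skeleton_def by blast
qed

lemma skeletonD:
  assumes A: "ip_mesh A" and w: "w \<in> skeleton (extension A) j"
    and j: "real (p j) + 1 < w $ j" "w $ j < real (n j) + 1"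
  shows "\<exists>E\<in>A. (\<forall>i. lo E $ i \<le> proj_ip p n w $ i \<and> proj_ip p n w $ i \<le> hi E $ i) \<and>
    w $ j \<in> {lo E $ j, hi E $ j}"
proof -
  obtain E where E: "E \<in> extension A" "w \<in> closure (elem_box E)" "w $ j \<in> {lo E $ j, hi E $ j}"
    using w by (auto simp: skeleton_def)
  have cl: "lo E $ i \<le> w $ i \<and> w $ i \<le> hi E $ i" for i
    using E(2) closure_elem_box[OF extension_less[OF A E(1)]] by blast
  obtain E0 where E0: "E0 \<in> A" "mirror E0 E" using E by (auto simp: extension_def)
  have c: "ip_cell E0" using ip_meshD(2)[OF A E0(1)] .
  have "lo E0 $ i \<le> proj_ip p n w $ i \<and> proj_ip p n w $ i \<le> hi E0 $ i" for i
    using E0(2)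
  proof (cases rule: mirror_cases[of _ _ i])
    case 1
    then show ?thesis using cl[of i] ip_cellD(3-5)[OF c, of i] by (auto simp: proj_ip_nth)
  next
    case 2
    then show ?thesis
      using cl[of i] ip_cellD(3-5)[OF c, of i] left_copyD[OF 2] ends_less[of i]
      by (auto simp: proj_ip_nth)
  next
    case 3
    then show ?thesis
      using cl[of i] ip_cellD(3-5)[OF c, of i] right_copyD[OF 3] ends_less[of i]
      by (auto simp: proj_ip_nth)
  qed
  moreover have "w $ j \<in> {lo E0 $ j, hi E0 $ j}" using E0(2)
  proof (cases rule: mirror_cases[of _ _ j])
    case 1
    then show ?thesis using E(3) by simp
  next
    case 2
    then show ?thesis using cl[of j] left_copyD(4)[OF 2] j by simp
  next
    case 3
    then show ?thesis using cl[of j] right_copyD(2)[OF 3] j by simp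
  qed
  ultimately show ?thesis using E0(1) by blast
qed

text \<open>In dimension 2 the outermost of the grid lines counted later may lie exactly at distance
  \<open>nb_dist\<close>, while \<open>near\<close> is an open condition. Finiteness of the mesh
  closes this gap.\<close>

lemma near_cell_exists:
  assumes A: "ip_mesh A" and P: "ip_cell P"
    and y: "\<And>i. real (p i) + 1 \<le> y $ i \<and> y $ i \<le> real (n i) + 1"
      "\<And>i. \<bar>y $ i - midpt P $ i\<bar> \<le> nb_dist p (level P) i"
  shows "\<exists>E\<in>A. near P E \<and> (\<forall>i. lo E $ i \<le> y $ i \<and> y $ i \<le> hi E $ i)"
proof -
  \<comment> \<open>\<open>y\<close> is approached from inside the open neighbourhood, where every covering cell is near \<open>P\<close>\<close>
  define U where "U = (\<Union>E\<in>{E \<in> A. near P E}. cbox (lo E) (hi E))"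
  define f where "f k = y + (1 / real (Suc k)) *\<^sub>R (midpt P - y)" for k
  have "f k \<in> U" for k
  proof -
    define e where "e = 1 / real (Suc k)"
    have e: "0 < e" "e \<le> 1" by (auto simp: e_def)
    have fk: "f k $ i = (1 - e) * y $ i + e * midpt P $ i" for i
      by (simp add: f_def e_def algebra_simps)
    have m: "real (p i) + 1 \<le> midpt P $ i" "midpt P $ i \<le> real (n i) + 1" for i
      using ip_cellD(3-5)[OF P, of i] by (auto simp: midpt_nth)
    have "real (p i) + 1 \<le> f k $ i \<and> f k $ i \<le> real (n i) + 1" for i
    proof -
      have "(1 - e) * (real (p i) + 1) \<le> (1 - e) * y $ i" "(1 - e) * y $ i \<le> (1 - e) * (real (n i) + 1)"
        "e * (real (p i) + 1) \<le> e * midpt P $ i" "e * midpt P $ i \<le> e * (real (n i) + 1)"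
        using e y(1)[of i] m[of i] by (auto intro!: mult_left_mono)
      then show ?thesis unfolding fk by (simp add: algebra_simps)
    qed
    then obtain E where E: "E \<in> A" "\<forall>i. lo E $ i \<le> f k $ i \<and> f k $ i \<le> hi E $ i"
      using ip_meshD(4)[OF A, of "f k"] by blast
    have "\<bar>f k $ i - midpt P $ i\<bar> < nb_dist p (level P) i" for i
    proof -
      have "f k $ i - midpt P $ i = (1 - e) * (y $ i - midpt P $ i)"
        unfolding fk by (simp add: algebra_simps)
      then have "\<bar>f k $ i - midpt P $ i\<bar> = (1 - e) * \<bar>y $ i - midpt P $ i\<bar>"
        using e by (simp add: abs_mult)
      also have "\<dots> \<le> (1 - e) * nb_dist p (level P) i"
        using e y(2) by (intro mult_left_mono) auto
      also have "\<dots> < nb_dist p (level P) i"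
        using e nb_dist_pos[of "level P" i] by (simp add: algebra_simps)
      finally show ?thesis .
    qed
    then have "near P E"
      unfolding near_def using E(2) by (smt (verit, best))
    then show "f k \<in> U" using E by (auto simp: U_def mem_box_cart)
  qed
  moreover have "f \<longlonglongrightarrow> y"
  proof -
    have "(\<lambda>k. y + (1 / real (Suc k)) *\<^sub>R (midpt P - y)) \<longlonglongrightarrow> y + 0 *\<^sub>R (midpt P - y)"
      by (intro tendsto_intros LIMSEQ_Suc lim_1_over_n)
    then show ?thesis by (simp add: f_def[abs_def])
  qed
  moreover have "closed U"
    unfolding U_def using ip_meshD(1)[OF A] by (intro closed_UN closed_cbox) auto
  ultimately have "y \<in> U" using closed_sequentially by blast
  then show ?thesis by (auto simp: U_def mem_box_cart)
qed

lemma midpt_unique: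
  assumes "ip_cell P" "split_dir (level P) = i" "on_grid (Suc (level P)) i s"
    "lo P $ i < s" "s < hi P $ i"
  shows "s = midpt P $ i"
proof -
  define h where "h = cell_size (Suc (level P)) i"
  have h: "hi P $ i = lo P $ i + 2 * h" "midpt P $ i = lo P $ i + h"
    using ip_cellD(2)[OF assms(1), of i] assms(2) by (auto simp: h_def cell_size_Suc midpt_nth)
  have g: "on_grid (Suc (level P)) i (lo P $ i)"
    by (intro on_grid_Suc ip_cellD(1) assms(1))
  then have g': "on_grid (Suc (level P)) i (lo P $ i + h)"
    using on_grid_add[OF g, of 1] by (simp add: h_def)
  show ?thesis
  proof (cases "s \<le> midpt P $ i")
    case True
    then show ?thesis
      using on_grid_between[OF g assms(3)] assms(4) h by (simp add: h_def)
  next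
    case False
    then show ?thesis
      using on_grid_between[OF g' assms(3)] assms(5) h by (simp add: h_def)
  qed
qed

text \<open>\<open>s\<close> enters the dyadic grids at some first level \<open>Suc e\<close>; it is
  not on the grid of \<open>Q\<close>, so \<open>e\<close> is at least \<open>level Q\<close>. The
  step from \<open>e\<close> to \<open>Suc e\<close> halves direction \<open>i\<close>, hence
  \<open>s\<close> is the midpoint of a level-\<open>e\<close> cell whose interval contains it: of
  \<open>Q\<close> itself or of the ancestor of \<open>E\<close>.\<close>

lemma bisected_ancestor:
  assumes A: "ip_mesh A" and E: "E \<in> A" "s \<in> {lo E $ i, hi E $ i}"
    and Q: "Q \<in> A" "lo Q $ i < s" "s < hi Q $ i"
  shows "split_dir (level Q) = i \<and> s = midpt Q $ i \<or>
    (\<exists>P. ip_cell P \<and> graded A P \<and> level Q < level P \<and> split_dir (level P) = i \<and> s = midpt P $ i \<and>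
      (\<forall>j. lo P $ j \<le> lo E $ j \<and> hi E $ j \<le> hi P $ j))"
proof -
  have c: "ip_cell E" "ip_cell Q" using ip_meshD(2)[OF A] E Q by auto
  have gE: "on_grid (level E) i s"
    using E(2) ip_cellD(1,2)[OF c(1), of i] on_grid_add[of "level E" i "lo E $ i" 1] by auto
  have gQ: "\<not> on_grid (level Q) i s"
    using ip_cell_grid_point[OF c(2), of i s] Q by auto
  define e' where "e' = (LEAST k. on_grid k i s)"
  have e': "on_grid e' i s" "e' \<le> level E" "\<And>k. k < e' \<Longrightarrow> \<not> on_grid k i s"
    unfolding e'_def using gE by (auto intro: LeastI Least_le dest: not_less_Least)
  have "level Q < e'"
    using gQ on_grid_mono[OF e'(1)] by (meson not_le)
  then obtain e where e: "e' = Suc e" "level Q \<le> e" by (cases e') auto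
  have ge: "\<not> on_grid e i s" using e' e by auto
  have dir: "split_dir e = i"
    using e'(1) ge unfolding e(1) on_grid_def cell_size_Suc by (auto split: if_splits)
  show ?thesis
  proof (cases "e = level Q")
    case True
    then show ?thesis using midpt_unique[OF c(2), of i s] dir e'(1) e Q by auto
  next
    case False
    have "e < level E" using e' e by simp
    then obtain P where P: "ip_cell P" "level P = e" "graded A P"
        "\<forall>j. lo P $ j \<le> lo E $ j \<and> hi E $ j \<le> hi P $ j"
      using ip_meshD(5)[OF A E(1)] by blast
    have "lo P $ i \<le> s" "s \<le> hi P $ i"
      using E(2) P(4)[rule_format, of i] ip_cellD(5)[OF c(1), of i] by auto
    moreover have "s \<noteq> lo P $ i" "s \<noteq> hi P $ i"
      using ge ip_cellD(1,2)[OF P(1), of i] on_grid_add[of e i "lo P $ i" 1] P(2) by auto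
    ultimately have "s = midpt P $ i"
      using midpt_unique[OF P(1), of i s] P(2) dir e'(1) e by auto
    then show ?thesis using P dir e False by auto
  qed
qed

end

section \<open>Local index vectors near a cell\<close>

locale anchor_setting = spline_setting p n t
  for p n :: "'d::{finite,linorder} \<Rightarrow> nat" and t +
  fixes A :: "'d elem set" and z :: "real ^ 'd::{finite,linorder}"
  assumes A: "ip_mesh A" and finite_extension: "finite (extension A)"
    and anchor: "z \<in> anchors p n (extension A)"
begin

abbreviation "indices j \<equiv> global_indices p n (extension A) j z"
abbreviation "idx j \<equiv> local_indices p n (extension A) j z"
abbreviation "first j \<equiv> idx j ! 0"
abbreviation "final j \<equiv> idx j ! (2 * half_width j)"

lemma anchor_bounds:
  "real (half_width j) + 1 \<le> z $ j \<and> z $ j \<le> real (n j) + real (p j) + 1 - real (half_width j)"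
proof -
  obtain f where f: "p j = 2 * f + 1" using degree_odd[of j] by (elim oddE)
  have "\<lceil>real (p j) / 2\<rceil> = int (half_width j)"
    unfolding half_width_def f by (auto simp: ceiling_eq_iff)
  moreover have "z $ j \<in> {\<lceil>real (p j) / 2\<rceil> + 1 .. real (n j) + real (p j) + 1 - \<lceil>real (p j) / 2\<rceil>}"
    using anchor unfolding anchors_def by blast
  ultimately show ?thesis by simp
qed

lemma anchor_bounds': "1 \<le> z $ j \<and> z $ j \<le> real (n j + p j + 1)"
  using anchor_bounds[of j] by auto

lemma indices_bounds: "s \<in> indices j \<Longrightarrow> 1 \<le> s \<and> s \<le> real (n j + p j + 1)"
  by (simp add: global_indices_def)

lemma finite_indices: "finite (indices j)"
proof (rule finite_subset)
  show "indices j \<subseteq> (\<Union>E\<in>extension A. {lo E $ j, hi E $ j})"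
    by (auto simp: global_indices_def skeleton_def)
qed (use finite_extension in auto)

lemma anchor_in_indices: "z $ j \<in> indices j"
proof -
  obtain E where E: "E \<in> extension A" "\<forall>i. z $ i \<in> {lo E $ i, hi E $ i}"
    using anchor by (auto simp: anchors_def)
  have less: "lo E $ i < hi E $ i" for i by (rule extension_less[OF A E(1)])
  have "lo E $ i \<le> z $ i \<and> z $ i \<le> hi E $ i" for i
    using E(2)[rule_format, of i] less[of i] by auto
  then have "z \<in> closure (elem_box E)" using closure_elem_box[OF less] by blast
  then have "z \<in> skeleton (extension A) j" using E by (auto simp: skeleton_def)
  moreover have "(\<chi> i. if i = j then z $ j else z $ i) = z" by (simp add: vec_eq_iff)
  ultimately show ?thesis using anchor_bounds' by (simp add: global_indices_def)
qed

lemma of_nat_in_indices: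
  assumes "1 \<le> k" "k \<le> n j + p j + 1"
  shows "real k \<in> indices j"
proof -
  define w where "w = (\<chi> i. if i = j then real k else z $ i)"
  obtain E where E: "E \<in> A" "\<forall>i. lo E $ i \<le> proj_ip p n w $ i \<and> proj_ip p n w $ i \<le> hi E $ i"
    using ip_meshD(4)[OF A, of "proj_ip p n w"] proj_ip_bounds by blast
  have "w \<in> skeleton (extension A) j"
  proof (rule skeletonI[OF A E(1)])
    show "1 \<le> w $ i \<and> w $ i \<le> real (n i + p i + 1)" for i
      using anchor_bounds'[of i] assms by (simp add: w_def del: of_nat_add)
    show "on_grid (level E) j (w $ j)"
      using on_grid_of_int[of "level E" j "int k"] by (simp add: w_def)
  qed (use E(2) in \<open>auto simp: w_def\<close>)
  then show ?thesis using assms by (simp add: global_indices_def w_def del: of_nat_add)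
qed

text \<open>The bounds on anchors leave the first \<open>half_width j\<close> integers below and the
  last \<open>half_width j\<close> above, and all integers in range are global indices. So the local
  index vector has full length.\<close>

lemma
  shows card_below: "half_width j \<le> card {s \<in> indices j. s < z $ j}"
    and card_above: "half_width j \<le> card {s \<in> indices j. z $ j < s}"
proof -
  let ?c = "half_width j"
  have "real ` {1..?c} \<subseteq> {s \<in> indices j. s < z $ j}"
  proof
    fix s assume "s \<in> real ` {1..?c}"
    then obtain k where k: "s = real k" "1 \<le> k" "k \<le> ?c" by auto
    have "real k < z $ j" using anchor_bounds[of j] k by linarith
    moreover have "?c \<le> n j + p j + 1" using half_width[of j] by linarith
    ultimately show "s \<in> {s \<in> indices j. s < z $ j}" using of_nat_in_indices[of k j] k by simp
  qed
  then have "card (real ` {1..?c}) \<le> card {s \<in> indices j. s < z $ j}"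
    using finite_indices by (intro card_mono) auto
  then show "?c \<le> card {s \<in> indices j. s < z $ j}" by (simp add: card_image)
  let ?I = "{n j + p j + 2 - ?c..n j + p j + 1}"
  have c: "?c \<le> n j + p j + 1" using half_width[of j] by linarith
  have "real ` ?I \<subseteq> {s \<in> indices j. z $ j < s}"
  proof
    fix s assume "s \<in> real ` ?I"
    then obtain k where k: "s = real k" "n j + p j + 2 - ?c \<le> k" "k \<le> n j + p j + 1" by auto
    have "real (n j + p j + 2 - ?c) \<le> real k" using k(2) by (rule of_nat_mono)
    then have "real (n j) + real (p j) + 2 - real ?c \<le> real k" using c by (simp add: of_nat_diff)
    then have "z $ j < real k" using anchor_bounds[of j] by linarith
    moreover have "1 \<le> k" using k c by linarith
    ultimately show "s \<in> {s \<in> indices j. z $ j < s}" using of_nat_in_indices[of k j] k by simp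
  qed
  then have "card (real ` ?I) \<le> card {s \<in> indices j. z $ j < s}"
    using finite_indices by (intro card_mono) auto
  moreover have "card ?I = ?c" using c by simp
  ultimately show "?c \<le> card {s \<in> indices j. z $ j < s}" by (simp add: card_image)
qed

lemma idx_eq:
  "idx j = take (2 * half_width j + 1)
     (drop (card {s \<in> indices j. s < z $ j} - half_width j) (sorted_list_of_set (indices j)))"
  using half_width(2)[of j] unfolding local_indices_def Let_def half_width_def[symmetric]
  by (simp add: add.commute)

lemmas idx_facts = finite_indices anchor_in_indices card_below card_above idx_eq

lemmas idx_length = consecutive_length[OF idx_facts]
  and idx_strict = consecutive_strict[OF idx_facts]
  and idx_sorted = consecutive_sorted[OF idx_facts]
  and idx_subset = consecutive_subset[OF idx_facts]
  and idx_middle = consecutive_middle[OF idx_facts]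
  and final_le = last_le[OF idx_facts]
  and first_ge = first_ge[OF idx_facts]
  and anchor_le = middle_le[OF idx_facts]
  and anchor_ge = middle_ge[OF idx_facts]

text \<open>Replacing the coordinate by \<open>x\<close> and projecting gives a point of the closed
  neighbourhood of \<open>P\<close>. A cell near \<open>P\<close> contains it, and by grading this
  cell is at least as fine as \<open>P\<close>, so the grid line through \<open>x\<close> can only
  pass along its boundary.\<close>

lemma grid_point_in_indices:
  assumes P: "ip_cell P" "graded A P"
    and x: "on_grid (level P) j x" "real (p j) + 1 \<le> x" "x \<le> real (n j) + 1"
      "\<bar>x - midpt P $ j\<bar> \<le> nb_dist p (level P) j"
    and z: "\<And>i. i \<noteq> j \<Longrightarrow> \<bar>proj_ip p n z $ i - midpt P $ i\<bar> \<le> nb_dist p (level P) i"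
  shows "x \<in> indices j"
proof -
  define w where "w = (\<chi> i. if i = j then x else z $ i)"
  have proj: "proj_ip p n w $ i = (if i = j then x else proj_ip p n z $ i)" for i
    using x by (auto simp: proj_ip_nth w_def)
  obtain E where E: "E \<in> A" "near P E" "\<forall>i. lo E $ i \<le> proj_ip p n w $ i \<and> proj_ip p n w $ i \<le> hi E $ i"
  proof -
    have "\<bar>proj_ip p n w $ i - midpt P $ i\<bar> \<le> nb_dist p (level P) i" for i
      using z[of i] x(4) by (cases "i = j") (simp_all add: proj)
    then show ?thesis
      using near_cell_exists[OF A P(1) proj_ip_bounds] that by blast
  qed
  have "level P \<le> level E" using P(2) E by (auto simp: graded_def)
  have xb: "1 \<le> x" "x \<le> real (n j + p j + 1)" using x by auto
  have "w \<in> skeleton (extension A) j"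
  proof (rule skeletonI[OF A E(1)])
    show "1 \<le> w $ i \<and> w $ i \<le> real (n i + p i + 1)" for i
      using anchor_bounds'[of i] xb by (simp add: w_def)
    show "on_grid (level E) j (w $ j)"
      using on_grid_mono[OF x(1) \<open>level P \<le> level E\<close>] by (simp add: w_def)
  qed (use E(3) x in \<open>auto simp: w_def\<close>)
  then show ?thesis using xb by (simp add: global_indices_def w_def)
qed

lemma card_grid_points:
  fixes a h :: real
  assumes "h \<noteq> 0"
  shows "card ((\<lambda>r. a + real r * h) ` {1..c}) = c"
  using assms by (subst card_image) (auto simp: inj_on_def)

text \<open>In direction \<open>i\<close> nearness of \<open>Q\<close> to \<open>P\<close> is
  immediate, as \<open>s\<close> lies in both. The anchor still has to be located there, because
  grid lines in another direction \<open>j\<close> are known to be global indices only if the anchor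
  is close to \<open>P\<close> in all remaining directions.\<close>

lemma local_index_inside_cell:
  assumes Q: "Q \<in> A" and overlap: "\<And>j. first j < hi Q $ j \<and> lo Q $ j < final j"
    and s: "s \<in> set (idx i)" "lo Q $ i < s" "s < hi Q $ i"
  shows "split_dir (level Q) = i \<and> s = midpt Q $ i"
proof (rule ccontr)
  assume contra: "\<not> ?thesis"
  have cQ: "ip_cell Q" using ip_meshD(2)[OF A Q] .
  define w where "w = (\<chi> j. if j = i then s else z $ j)"
  have "s \<in> indices i" using s(1) idx_subset by blast
  then have w: "w \<in> skeleton (extension A) i" by (simp add: global_indices_def w_def)
  have s_ip: "real (p i) + 1 < s" "s < real (n i) + 1"
    using s ip_cellD(3,4)[OF cQ, of i] by auto
  then obtain E where E: "E \<in> A" "\<forall>j. lo E $ j \<le> proj_ip p n w $ j \<and> proj_ip p n w $ j \<le> hi E $ j"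
      "s \<in> {lo E $ i, hi E $ i}"
    using skeletonD[OF A w] by (auto simp: w_def)
  obtain P where P: "ip_cell P" "graded A P" "level Q < level P" "split_dir (level P) = i" "s = midpt P $ i"
      "\<forall>j. lo P $ j \<le> lo E $ j \<and> hi E $ j \<le> hi P $ j"
    using bisected_ancestor[OF A E(1,3) Q s(2,3)] contra by auto
  define h :: "'d \<Rightarrow> real" where "h j = cell_size (level P) j" for j
  define D :: "'d \<Rightarrow> real" where "D j = nb_dist p (level P) j" for j
  define m :: "'d \<Rightarrow> real" where "m j = midpt P $ j" for j
  have hpos: "0 < h j" for j by (simp add: h_def)
  have Plo: "lo P $ j = m j - h j / 2" and Phi: "hi P $ j = m j + h j / 2" for j
    using ip_cellD(2)[OF P(1), of j] by (auto simp: m_def h_def midpt_nth field_simps)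
  have Pip: "real (p j) + 1 \<le> m j - h j / 2" "m j + h j / 2 \<le> real (n j) + 1" for j
    using ip_cellD(3,4)[OF P(1), of j] Plo Phi by auto
  have Dh: "h j \<le> D j" for j using nb_dist_ge_cell by (simp add: h_def D_def)
  have D1: "real (half_width j) * h j + h j / 2 \<le> D j" if "j \<noteq> i" for j
    using nb_dist_other[of "level P" j] that P(4) by (auto simp: h_def D_def algebra_simps)
  have D2: "real (half_width i) * h i - h i / 2 \<le> D i"
    using nb_dist_ge[of "level P" i] by (simp add: h_def D_def algebra_simps)
  have gridlo: "on_grid (level P) j (m j - h j / 2)" for j
    using ip_cellD(1)[OF P(1), of j] Plo by simp
  have gridhi: "on_grid (level P) j (m j + h j / 2)" for j
    using on_grid_add[OF gridlo[of j], of 1] by (simp add: h_def field_simps)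
  have gridlo': "on_grid (level P) j (m j - h j / 2 + real r * h j)" for j r
    using on_grid_add[OF gridlo[of j], of "int r"] by (simp add: h_def)
  have gridhi': "on_grid (level P) j (m j + h j / 2 + real r * h j)" for j r
    using on_grid_add[OF gridhi[of j], of "int r"] by (simp add: h_def)
  have gridlo'': "on_grid (level P) j (m j - h j / 2 + real r * - h j)" for j r
    using on_grid_add[OF gridlo[of j], of "- int r"] by (simp add: h_def)
  have gridhi'': "on_grid (level P) j (m j + h j / 2 + real r * - h j)" for j r
    using on_grid_add[OF gridhi[of j], of "- int r"] by (simp add: h_def)
  have scaled: "h j \<le> real r * h j \<and> real r * h j \<le> real (half_width j) * h j"
    if "r \<in> {1..half_width j}" for j r
  proof -
    have "1 * h j \<le> real r * h j" "real r * h j \<le> real (half_width j) * h j"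
      using that hpos[of j] by (intro mult_right_mono; simp)+
    then show ?thesis by simp
  qed
  \<comment> \<open>The skeleton point that produces \<open>s\<close> agrees with the anchor outside
    direction \<open>i\<close>, and it projects into \<open>E\<close>, hence into
    \<open>P\<close>.\<close>
  have zj: "m j - h j / 2 \<le> proj_ip p n z $ j \<and> proj_ip p n z $ j \<le> m j + h j / 2" if "j \<noteq> i" for j
  proof -
    have "proj_ip p n w $ j = proj_ip p n z $ j" using that by (simp add: proj_ip_nth w_def)
    then show ?thesis using E(2)[rule_format, of j] P(6)[rule_format, of j] Plo Phi by auto
  qed
  have zj': "\<bar>proj_ip p n z $ j - m j\<bar> \<le> D j" if "j \<noteq> i" for j
    using Dh[of j] hpos[of j] zj[OF that] by linarith
  have zi: "\<bar>proj_ip p n z $ i - m i\<bar> \<le> D i"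
  proof -
    have "proj_ip p n z $ i \<le> m i + D i"
    proof (rule ccontr)
      assume *: "\<not> ?thesis"
      then have *: "m i + D i < proj_ip p n z $ i" by simp
      \<comment> \<open>The c grid lines above the midpoint \<open>s\<close>, the last at (c - 1/2)
        h. The assumption keeps them inside the domain, since a projected anchor does not exceed its
        end.\<close>
      define T where "T = (\<lambda>r. m i - h i / 2 + real r * h i) ` {1..half_width i}"
      have T: "m i < x \<and> x \<le> m i + D i" if x: "x \<in> T" for x
      proof -
        obtain r where r: "r \<in> {1..half_width i}" "x = m i - h i / 2 + real r * h i"
          using x unfolding T_def by blast
        show ?thesis
          unfolding r(2) mult_minus_right using D2 scaled[OF r(1)] hpos[of i] by (intro conjI; linarith)
      qed
      have "T \<subseteq> indices i"
      proof
        fix x assume x: "x \<in> T"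
        show "x \<in> indices i"
        proof (rule grid_point_in_indices[OF P(1,2)])
          show "on_grid (level P) i x" using x gridlo' by (auto simp: T_def)
          show "real (p i) + 1 \<le> x" "x \<le> real (n i) + 1" "\<bar>x - midpt P $ i\<bar> \<le> nb_dist p (level P) i"
            using T[OF x] * proj_ip_bounds[of i z] Pip[of i] hpos[of i] by (auto simp flip: D_def m_def)
        qed (use zj' in \<open>auto simp: D_def m_def\<close>)
      qed
      moreover have "half_width i \<le> card T"
        unfolding T_def using hpos[of i] by (subst card_grid_points) auto
      ultimately have "z $ i \<le> m i + D i"
        by (rule anchor_le[OF _ _ _ s(1)]) (use T P(5) Dh[of i] hpos[of i] in \<open>auto simp: m_def[symmetric]\<close>)
      then show False
        using * Pip[of i] hpos[of i] Dh[of i] by (auto simp: proj_ip_nth)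
    qed
    moreover have "m i - D i \<le> proj_ip p n z $ i"
    proof (rule ccontr)
      assume *: "\<not> ?thesis"
      then have *: "proj_ip p n z $ i < m i - D i" by simp
      define T where "T = (\<lambda>r. m i + h i / 2 + real r * - h i) ` {1..half_width i}"
      have T: "m i - D i \<le> x \<and> x < m i" if x: "x \<in> T" for x
      proof -
        obtain r where r: "r \<in> {1..half_width i}" "x = m i + h i / 2 + real r * - h i"
          using x unfolding T_def by blast
        show ?thesis
          unfolding r(2) mult_minus_right using D2 scaled[OF r(1)] hpos[of i] by (intro conjI; linarith)
      qed
      have "T \<subseteq> indices i"
      proof
        fix x assume x: "x \<in> T"
        show "x \<in> indices i"
        proof (rule grid_point_in_indices[OF P(1,2)])
          show "on_grid (level P) i x" using x gridhi'' by (auto simp: T_def)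
          show "real (p i) + 1 \<le> x" "x \<le> real (n i) + 1" "\<bar>x - midpt P $ i\<bar> \<le> nb_dist p (level P) i"
            using T[OF x] * proj_ip_bounds[of i z] Pip[of i] hpos[of i] by (auto simp flip: D_def m_def)
        qed (use zj' in \<open>auto simp: D_def m_def\<close>)
      qed
      moreover have "half_width i \<le> card T"
        unfolding T_def using hpos[of i] by (subst card_grid_points) auto
      ultimately have "m i - D i \<le> z $ i"
        by (rule anchor_ge[OF _ _ _ s(1)]) (use T P(5) Dh[of i] hpos[of i] in \<open>auto simp: m_def[symmetric]\<close>)
      then show False
        using * Pip[of i] hpos[of i] Dh[of i] by (auto simp: proj_ip_nth)
    qed
    ultimately show ?thesis by (simp add: abs_le_iff)
  qed
  have zall: "\<bar>proj_ip p n z $ j - m j\<bar> \<le> D j" for j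
    using zi zj'[of j] by (cases "j = i") auto
  have "lo Q $ j < m j + D j \<and> m j - D j < hi Q $ j" for j
  proof (cases "j = i")
    case True
    then show ?thesis using s(2,3) P(5) Dh[of i] hpos[of i] by (auto simp: m_def)
  next
    case False
    have "lo Q $ j < m j + D j"
    proof (rule ccontr)
      assume "\<not> ?thesis"
      then have *: "m j + D j \<le> lo Q $ j" by simp
      have Qb: "lo Q $ j < real (n j) + 1" using ip_cellD(4,5)[OF cQ, of j] by linarith
      \<comment> \<open>Now c lines beyond the upper face of \<open>P\<close>, the last at (c + 1/2)
        h from the midpoint. They stay inside the domain because \<open>Q\<close> lies beyond
        them.\<close>
      define T where "T = (\<lambda>r. m j + h j / 2 + real r * h j) ` {1..half_width j}"
      have T: "m j + h j / 2 < x \<and> x \<le> m j + D j" if x: "x \<in> T" for x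
      proof -
        obtain r where r: "r \<in> {1..half_width j}" "x = m j + h j / 2 + real r * h j"
          using x unfolding T_def by blast
        show ?thesis
          unfolding r(2) mult_minus_right using D1[OF False] scaled[OF r(1)] hpos[of j] by (intro conjI; linarith)
      qed
      \<comment> \<open>The bound on the projected anchor passes to the anchor itself: the
        projection is below the end of the domain, so it was not cut off from above.\<close>
      have zle: "z $ j \<le> m j + h j / 2"
        using zj[OF False] * Qb Dh[of j] hpos[of j] by (auto simp: proj_ip_nth)
      have "T \<subseteq> indices j"
      proof
        fix x assume x: "x \<in> T"
        show "x \<in> indices j"
        proof (rule grid_point_in_indices[OF P(1,2)])
          show "on_grid (level P) j x" using x gridhi' by (auto simp: T_def)
          show "real (p j) + 1 \<le> x" "x \<le> real (n j) + 1" "\<bar>x - midpt P $ j\<bar> \<le> nb_dist p (level P) j"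
            using T[OF x] * Qb Pip[of j] hpos[of j] by (auto simp flip: D_def m_def)
        qed (use zall in \<open>auto simp: D_def m_def\<close>)
      qed
      moreover have "half_width j \<le> card T"
        unfolding T_def using hpos[of j] by (subst card_grid_points) auto
      ultimately have "final j \<le> m j + D j"
        by (rule final_le) (use T zle Dh[of j] hpos[of j] in \<open>force+\<close>)
      then show False using * overlap[of j] by linarith
    qed
    moreover have "m j - D j < hi Q $ j"
    proof (rule ccontr)
      assume "\<not> ?thesis"
      then have *: "hi Q $ j \<le> m j - D j" by simp
      have Qb: "real (p j) + 1 < hi Q $ j" using ip_cellD(3,5)[OF cQ, of j] by linarith
      define T where "T = (\<lambda>r. m j - h j / 2 + real r * - h j) ` {1..half_width j}"
      have T: "m j - D j \<le> x \<and> x < m j - h j / 2" if x: "x \<in> T" for x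
      proof -
        obtain r where r: "r \<in> {1..half_width j}" "x = m j - h j / 2 + real r * - h j"
          using x unfolding T_def by blast
        show ?thesis
          unfolding r(2) mult_minus_right using D1[OF False] scaled[OF r(1)] hpos[of j] by (intro conjI; linarith)
      qed
      have zle: "m j - h j / 2 \<le> z $ j"
        using zj[OF False] * Qb Dh[of j] hpos[of j] by (auto simp: proj_ip_nth)
      have "T \<subseteq> indices j"
      proof
        fix x assume x: "x \<in> T"
        show "x \<in> indices j"
        proof (rule grid_point_in_indices[OF P(1,2)])
          show "on_grid (level P) j x" using x gridlo'' by (auto simp: T_def)
          show "real (p j) + 1 \<le> x" "x \<le> real (n j) + 1" "\<bar>x - midpt P $ j\<bar> \<le> nb_dist p (level P) j"
            using T[OF x] * Qb Pip[of j] hpos[of j] by (auto simp flip: D_def m_def)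
        qed (use zall in \<open>auto simp: D_def m_def\<close>)
      qed
      moreover have "half_width j \<le> card T"
        unfolding T_def using hpos[of j] by (subst card_grid_points) auto
      ultimately have "m j - D j \<le> first j"
        by (rule first_ge) (use T zle Dh[of j] hpos[of j] in \<open>force+\<close>)
      then show False using * overlap[of j] by linarith
    qed
    ultimately show ?thesis ..
  qed
  then have "near P Q" by (simp add: near_def m_def D_def)
  then show False using P(2,3) Q by (auto simp: graded_def)
qed

end

section \<open>Blending functions on a cell\<close>

context anchor_setting
begin

text \<open>The local knots, continued by a constant beyond the last one to make the sequence monotone.\<close>

definition knots :: "'d \<Rightarrow> nat \<Rightarrow> real" where
  "knots j k = knot t j (idx j ! min k (p j + 1))"

lemma idx_range: "k \<le> p j + 1 \<Longrightarrow> idx j ! k \<in> set (idx j)"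
  using idx_length[of j] half_width(2)[of j] by simp

lemma idx_in_domain: "s \<in> set (idx j) \<Longrightarrow> 1 \<le> s \<and> s \<le> real (n j) + real (p j) + 1"
  using subsetD[OF idx_subset, of s j] indices_bounds[of s j] by auto

lemma mono_knots: "mono (knots j)"
proof (rule monoI)
  fix k l :: nat assume "k \<le> l"
  then have "idx j ! min k (p j + 1) \<le> idx j ! min l (p j + 1)"
    using half_width(2)[of j] by (intro idx_sorted) auto
  then show "knots j k \<le> knots j l"
    unfolding knots_def
    using idx_in_domain[OF idx_range[of "min k (p j + 1)" j]] idx_in_domain[OF idx_range[of "min l (p j + 1)" j]]
    by (intro knot_mono) auto
qed

lemma knots_0: "knots j 0 = knot t j (first j)"
  and knots_final: "knots j (p j + 1) = knot t j (final j)"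
  and knots_middle: "knots j (half_width j) = knot t j (z $ j)"
  using half_width[of j] idx_middle[of j] by (simp_all add: knots_def)

lemma blending_eq: "blending p n t (extension A) z x = (\<Prod>j\<in>UNIV. bspline (p j) (knots j) 0 (x $ j))"
  unfolding blending_def
proof (intro prod.cong refl bspline_cong)
  fix j k assume "k \<le> 0 + p j + 1"
  then show "local_knots p n t (extension A) j z ! k = knots j k"
    using idx_length[of j] half_width(2)[of j] by (simp add: local_knots_def knots_def)
qed

lemma knot_less_imp_less:
  assumes "knot t j x < knot t j y" "1 \<le> y" "x \<le> real (n j) + real (p j) + 1"
  shows "x < y"
  using knot_mono[of y x j] assms by (meson not_le)

text \<open>If the support misses \<open>Q\<close> in some direction, the B-spline of that direction
  vanishes on \<open>U\<close>. Otherwise the only local index inside \<open>Q\<close> is the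
  midpoint in the split direction, which \<open>split\<close> keeps from lying strictly between
  \<open>l\<close> and \<open>r\<close>, so every factor is a single polynomial.\<close>

lemma blending_polynomial_on:
  assumes Q: "Q \<in> A"
    and U: "\<And>x j. x \<in> U \<Longrightarrow> l j \<le> x $ j \<and> x $ j < r j"
    and lr: "\<And>j. knot t j (lo Q $ j) \<le> l j" "\<And>j. r j \<le> knot t j (hi Q $ j)"
    and split: "\<And>j. j = split_dir (level Q) \<Longrightarrow> \<not> (l j < knot t j (midpt Q $ j) \<and> knot t j (midpt Q $ j) < r j)"
  shows "polynomial_on p U (blending p n t (extension A) z)"
proof -
  have c: "ip_cell Q" using ip_meshD(2)[OF A Q] .
  have Qb: "1 \<le> lo Q $ j" "lo Q $ j \<le> real (n j) + real (p j) + 1"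
    "1 \<le> hi Q $ j" "hi Q $ j \<le> real (n j) + real (p j) + 1" for j
    using ip_cellD(3-5)[OF c, of j] by linarith+
  have ends: "1 \<le> first j" "first j \<le> real (n j) + real (p j) + 1"
    "1 \<le> final j" "final j \<le> real (n j) + real (p j) + 1" for j
    using idx_in_domain[OF idx_range[of 0 j]] idx_in_domain[OF idx_range[of "p j + 1" j]] half_width(2)[of j]
    by auto
  show ?thesis
  proof (cases "\<forall>j. first j < hi Q $ j \<and> lo Q $ j < final j")
    case False
    then obtain j where j: "hi Q $ j \<le> first j \<or> final j \<le> lo Q $ j" by (metis not_less)
    have "blending p n t (extension A) z x = mpoly_eval p (\<lambda>_. 0) x" if x: "x \<in> U" for x
    proof -
      have "x $ j < knots j 0 \<or> knots j (0 + p j + 1) \<le> x $ j"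
        using j
      proof
        assume "hi Q $ j \<le> first j"
        then have "knot t j (hi Q $ j) \<le> knots j 0"
          unfolding knots_0 by (intro knot_mono Qb ends)
        then show ?thesis using U[OF x, of j] lr(2)[of j] by linarith
      next
        assume "final j \<le> lo Q $ j"
        then have "knots j (p j + 1) \<le> knot t j (lo Q $ j)"
          unfolding knots_final by (intro knot_mono Qb ends)
        then show ?thesis using U[OF x, of j] lr(1)[of j] by simp
      qed
      then have "bspline (p j) (knots j) 0 (x $ j) = 0" by (rule bspline_eq_0[OF mono_knots])
      then have "blending p n t (extension A) z x = 0"
        unfolding blending_eq by (intro prod_zero) auto
      then show ?thesis by (simp add: mpoly_eval_def)
    qed
    then show ?thesis by (auto simp: polynomial_on_iff)
  next
    case True
    have "\<exists>P. degree P \<le> p j \<and> (\<forall>x. l j \<le> x \<and> x < r j \<longrightarrow> bspline (p j) (knots j) 0 x = poly P x)" for j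
    proof (rule bspline_polynomial_between_knots)
      fix k assume "k \<le> 0 + p j + 1"
      then have s: "idx j ! k \<in> set (idx j)" "knots j k = knot t j (idx j ! k)"
        using idx_range[of k j] by (auto simp: knots_def min_def)
      show "\<not> (l j < knots j k \<and> knots j k < r j)"
      proof
        assume *: "l j < knots j k \<and> knots j k < r j"
        then have "knot t j (lo Q $ j) < knot t j (idx j ! k)" "knot t j (idx j ! k) < knot t j (hi Q $ j)"
          using lr[of j] s(2) by auto
        then have "lo Q $ j < idx j ! k" "idx j ! k < hi Q $ j"
          using Qb idx_in_domain[OF s(1)] by (auto intro: knot_less_imp_less)
        then have "split_dir (level Q) = j \<and> idx j ! k = midpt Q $ j"
          using local_index_inside_cell[OF Q _ s(1)] True by blast
        then show False using split[of j] * s(2) by simp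
      qed
    qed
    then obtain P where P: "\<And>j. degree (P j) \<le> p j"
      "\<And>j x. l j \<le> x \<and> x < r j \<Longrightarrow> bspline (p j) (knots j) 0 x = poly (P j) x"
      by metis
    obtain c where "\<forall>x. (\<Prod>j\<in>UNIV. poly (P j) (x $ j)) = mpoly_eval p c x"
      using mpoly_eval_prod_poly[of P p] P(1) by blast
    then have "blending p n t (extension A) z x = mpoly_eval p c x" if "x \<in> U" for x
      using P(2) U[OF that] by (simp add: blending_eq)
    then show ?thesis by (auto simp: polynomial_on_iff)
  qed
qed

section \<open>Blending functions of the vertices of a cell\<close>

lemma anchor_between: "first j < z $ j" "z $ j < final j"
  using idx_strict[of 0 "half_width j" j] idx_strict[of "half_width j" "2 * half_width j" j]
    half_width(3)[of j] idx_middle[of j] by auto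

text \<open>At most one local index lies strictly inside \<open>Q\<close> in direction
  \<open>j\<close>, while p >= 3 provides at least two on either side of the anchor. So the support
  reaches the face opposite to the vertex.\<close>

lemma support_of_vertex:
  assumes Q: "Q \<in> A" and vertex: "\<And>j. z $ j = lo Q $ j \<or> z $ j = hi Q $ j"
    and x: "knot t j (lo Q $ j) < x" "x < knot t j (hi Q $ j)"
  shows "knots j 0 \<le> x" "x < knots j (p j + 1)"
proof -
  have c: "ip_cell Q" using ip_meshD(2)[OF A Q] .
  note cQ = ip_cellD(3-5)[OF c, of j]
  have overlap: "first i < hi Q $ i \<and> lo Q $ i < final i" for i
    using vertex[of i] anchor_between[of i] ip_cellD(5)[OF c, of i] by auto
  note half_width[of j]
  have unique: "s = midpt Q $ j" if "s \<in> set (idx j)" "lo Q $ j < s" "s < hi Q $ j" for s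
    using local_index_inside_cell[OF Q overlap that] by blast
  have mem: "idx j ! k \<in> set (idx j)" if "k \<le> 2 * half_width j" for k
    using that idx_length[of j] by simp
  have "knots j 0 \<le> x \<and> x < knots j (p j + 1)"
    using vertex[of j]
  proof
    assume z: "z $ j = lo Q $ j"
    have "hi Q $ j \<le> final j"
    proof (rule ccontr)
      assume *: "\<not> hi Q $ j \<le> final j"
      let ?s = "idx j ! (2 * half_width j - 1)"
      have "?s < final j" "z $ j < ?s"
        using idx_strict[of "2 * half_width j - 1" "2 * half_width j" j]
          idx_strict[of "half_width j" "2 * half_width j - 1" j] half_width(3)[of j] idx_middle[of j] by auto
      then have "?s = midpt Q $ j" "final j = midpt Q $ j"
        using * z by (auto intro!: unique mem)
      then show False using \<open>?s < final j\<close> by simp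
    qed
    then have "knot t j (hi Q $ j) \<le> knots j (p j + 1)"
      unfolding knots_final using cQ idx_in_domain[OF mem[of "2 * half_width j"]] by (intro knot_mono) auto
    moreover have "knots j 0 \<le> knots j (half_width j)"
      using mono_knots by (auto simp: mono_def)
    ultimately show ?thesis using x z knots_middle[of j] by auto
  next
    assume z: "z $ j = hi Q $ j"
    have "first j \<le> lo Q $ j"
    proof (rule ccontr)
      assume *: "\<not> first j \<le> lo Q $ j"
      let ?s = "idx j ! 1"
      have "first j < ?s" "?s < z $ j"
        using idx_strict[of 0 1 j] idx_strict[of 1 "half_width j" j] half_width(3)[of j] idx_middle[of j] by auto
      then have "?s = midpt Q $ j" "first j = midpt Q $ j"
        using * z half_width(3)[of j] by (auto intro!: unique mem)
      then show False using \<open>first j < ?s\<close> by simp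
    qed
    then have "knots j 0 \<le> knot t j (lo Q $ j)"
      unfolding knots_0 using cQ idx_in_domain[OF mem[of 0]] by (intro knot_mono) auto
    moreover have "knots j (half_width j) \<le> knots j (p j + 1)"
      using mono_knots half_width(2)[of j] by (auto simp: mono_def)
    ultimately show ?thesis using x z knots_middle[of j] by auto
  qed
  then show "knots j 0 \<le> x" "x < knots j (p j + 1)" by auto
qed

text \<open>The pieces are known only to the right of \<open>v\<close>, but \<open>v\<close> is in
  the closure of the box with lower corner \<open>v\<close>. So \<open>V\<close> meets that box in a
  nonempty open set, where the identity theorem applies.\<close>

lemma local_polynomial:
  assumes V: "open V" "v \<in> V" "\<And>x. x \<in> V \<Longrightarrow> blending p n t (extension A) z x = mpoly_eval p c x"
    and P: "\<And>j. degree (P j) \<le> p j" "\<And>j. v $ j < r j"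
      "\<And>j u. v $ j \<le> u \<Longrightarrow> u < r j \<Longrightarrow> bspline (p j) (knots j) 0 u = poly (P j) u"
  shows "mpoly_eval p c w = (\<Prod>j\<in>UNIV. poly (P j) (w $ j))"
proof -
  obtain c' where c': "\<And>x. (\<Prod>j\<in>UNIV. poly (P j) (x $ j)) = mpoly_eval p c' x"
    using mpoly_eval_prod_poly[of P p] P(1) by blast
  define B where "B = box v (\<chi> j. r j)"
  have "B \<noteq> {}" using P(2) by (simp add: B_def interval_ne_empty_cart)
  then have "closure B = cbox v (\<chi> j. r j)" by (simp add: B_def)
  then have "v \<in> closure B" using P(2) by (simp add: mem_box_cart less_imp_le)
  then have "V \<inter> B \<noteq> {}" using V(1,2) open_Int_closure_eq_empty by blast
  have eq: "mpoly_eval p c x = mpoly_eval p c' x" if "x \<in> V \<inter> B" for x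
  proof -
    have "blending p n t (extension A) z x = (\<Prod>j\<in>UNIV. poly (P j) (x $ j))"
      unfolding blending_eq
    proof (intro prod.cong refl)
      fix j
      have "v $ j < x $ j" "x $ j < r j" using that by (auto simp: B_def mem_box_cart)
      then show "bspline (p j) (knots j) 0 (x $ j) = poly (P j) (x $ j)" using P(3) by simp
    qed
    then show ?thesis using V(3)[of x] that c' by simp
  qed
  have "open (V \<inter> B)" using V(1) by (auto simp: B_def)
  then have "mpoly_eval p c w = mpoly_eval p c' w"
    by (rule mpoly_eval_eq_on_open[OF _ \<open>V \<inter> B \<noteq> {}\<close> eq])
  then show ?thesis using c' by simp
qed

text \<open>One polynomial on \<open>V\<close> would equal the product of the pieces at
  \<open>x\<close> and also that at \<open>y\<close>. Freezing all coordinates except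
  \<open>i\<close> makes the two pieces in direction \<open>i\<close> proportional, although the
  knot of the anchor lies between \<open>x $ i\<close> and \<open>y $ i\<close>.\<close>

lemma vertex_separates:
  assumes Q: "Q \<in> A" and vertex: "\<And>j. z $ j = lo Q $ j \<or> z $ j = hi Q $ j"
    and V: "open V" "x \<in> V" "y \<in> V" "polynomial_on p V (blending p n t (extension A) z)"
    and x: "x \<in> param_image t Q"
    and y: "z $ i = lo Q $ i \<and> y $ i < knot t i (lo Q $ i) \<or> z $ i = hi Q $ i \<and> knot t i (hi Q $ i) < y $ i"
  shows False
proof -
  obtain c where c: "\<And>v. v \<in> V \<Longrightarrow> blending p n t (extension A) z v = mpoly_eval p c v"
    using V(4) by (auto simp: polynomial_on_iff)
  have p1: "1 \<le> p j" for j using degree_ge_3[of j] by simp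
  have xb: "knot t j (lo Q $ j) < x $ j" "x $ j < knot t j (hi Q $ j)" for j
    using x by (auto simp: param_image_def mem_box_cart)
  have "\<exists>m\<le>p j. knots j m \<le> x $ j \<and> x $ j < knots j (m + 1)" for j
    using support_of_vertex[OF Q vertex xb[of j]] by (intro knot_span_exists) auto
  then obtain m where m: "\<And>j. m j \<le> p j" "\<And>j. knots j (m j) \<le> x $ j" "\<And>j. x $ j < knots j (m j + 1)"
    by metis
  define P where "P j = bspline_piece (p j) (knots j) (m j) 0" for j
  have P0: "P j \<noteq> 0" for j
    unfolding P_def using m[of j] p1 by (intro bspline_piece_nonzero mono_knots) auto
  have evalP: "mpoly_eval p c w = (\<Prod>j\<in>UNIV. poly (P j) (w $ j))" for w
  proof (rule local_polynomial[OF V(1,2) c])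
    show "bspline (p j) (knots j) 0 u = poly (P j) u" if "x $ j \<le> u" "u < knots j (m j + 1)" for j u
      unfolding P_def using m[of j] that by (intro bspline_eq_piece mono_knots) auto
  qed (use m in \<open>auto simp: P_def degree_bspline_piece\<close>)
  \<comment> \<open>Unlike \<open>x\<close>, the point \<open>y\<close> may lie outside the support
    in some directions, where the piece is 0.\<close>
  have "\<exists>R r. (R = 0 \<or> (\<exists>k\<le>p j. knots j k \<le> y $ j \<and> y $ j < knots j (k + 1) \<and> R = bspline_piece (p j) (knots j) k 0)) \<and>
      y $ j < r \<and> (\<forall>u. y $ j \<le> u \<and> u < r \<longrightarrow> bspline (p j) (knots j) 0 u = poly R u)" for j
  proof -
    consider "y $ j < knots j 0" | "knots j (p j + 1) \<le> y $ j" | "knots j 0 \<le> y $ j" "y $ j < knots j (p j + 1)"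
      by linarith
    then show ?thesis
    proof cases
      case 1
      then show ?thesis
        using bspline_eq_0[OF mono_knots[of j], of _ 0 "p j"]
        by (intro exI[of _ 0] exI[of _ "knots j 0"]) auto
    next
      case 2
      then show ?thesis
        using bspline_eq_0[OF mono_knots[of j], of _ 0 "p j"]
        by (intro exI[of _ 0] exI[of _ "y $ j + 1"]) auto
    next
      case 3
      then obtain k where k: "k \<le> p j" "knots j k \<le> y $ j" "y $ j < knots j (k + 1)"
        using knot_span_exists[of "knots j"] by blast
      then show ?thesis
        using bspline_eq_piece[OF mono_knots[of j], of k]
        by (intro exI[of _ "bspline_piece (p j) (knots j) k 0"] exI[of _ "knots j (k + 1)"]) auto
    qed
  qed
  then obtain R r where R: "\<And>j. R j = 0 \<or> (\<exists>k\<le>p j. knots j k \<le> y $ j \<and> y $ j < knots j (k + 1) \<and>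
        R j = bspline_piece (p j) (knots j) k 0)" "\<And>j. y $ j < r j"
      "\<And>j u. y $ j \<le> u \<and> u < r j \<Longrightarrow> bspline (p j) (knots j) 0 u = poly (R j) u"
    by metis
  have "mpoly_eval p c w = (\<Prod>j\<in>UNIV. poly (R j) (w $ j))" for w
  proof (rule local_polynomial[OF V(1,3) c])
    show "degree (R j) \<le> p j" for j using R(1)[of j] degree_bspline_piece by auto
  qed (use R(2,3) in auto)
  then have PR: "(\<Prod>j\<in>UNIV. poly (P j) (w $ j)) = (\<Prod>j\<in>UNIV. poly (R j) (w $ j))" for w
    using evalP by simp
  have "\<exists>u. poly (P j) u \<noteq> 0" for j using P0[of j] poly_all_0_iff_0 by blast
  then obtain v where v: "\<And>j. poly (P j) (v j) \<noteq> 0" by metis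
  define C where "C = (\<Prod>j\<in>UNIV - {i}. poly (P j) (v j))"
  define C' where "C' = (\<Prod>j\<in>UNIV - {i}. poly (R j) (v j))"
  have "C \<noteq> 0" using v by (simp add: C_def)
  have "poly (smult C (P i)) u = poly (smult C' (R i)) u" for u
  proof -
    define w where "w = (\<chi> j. if j = i then u else v j)"
    have "(\<Prod>j\<in>UNIV. poly (F j) (w $ j)) = poly (F i) u * (\<Prod>j\<in>UNIV - {i}. poly (F j) (v j))" for F
    proof -
      have "(\<Prod>j\<in>UNIV. poly (F j) (w $ j)) = poly (F i) (w $ i) * (\<Prod>j\<in>UNIV - {i}. poly (F j) (w $ j))"
        by (rule prod.remove) auto
      moreover have "(\<Prod>j\<in>UNIV - {i}. poly (F j) (w $ j)) = (\<Prod>j\<in>UNIV - {i}. poly (F j) (v j))"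
        by (intro prod.cong) (auto simp: w_def)
      ultimately show ?thesis by (simp add: w_def)
    qed
    from this[of P] this[of R] PR[of w] show ?thesis by (simp add: C_def C'_def mult.commute)
  qed
  then have pieces_eq: "smult C (P i) = smult C' (R i)" by (intro poly_ext)
  show False using R(1)[of i]
  proof
    assume "R i = 0"
    then show False using pieces_eq P0[of i] \<open>C \<noteq> 0\<close> by simp
  next
    assume "\<exists>k\<le>p i. knots i k \<le> y $ i \<and> y $ i < knots i (k + 1) \<and> R i = bspline_piece (p i) (knots i) k 0"
    then obtain k where k: "k \<le> p i" "knots i k \<le> y $ i" "y $ i < knots i (k + 1)"
        "R i = bspline_piece (p i) (knots i) k 0" by blast
    have spans: "knots i k < knots i (k + 1)" "knots i (m i) < knots i (m i + 1)"
      using k(2,3) m(2,3)[of i] by linarith+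
    have mono: "knots i a \<le> knots i b" if "a \<le> b" for a b using mono_knots that by (auto simp: mono_def)
    \<comment> \<open>The knot of the anchor has position \<open>half_width i\<close>. It separates
      the two spans, so their numbers differ.\<close>
    have "k < m i \<or> m i < k" using y
    proof
      assume z: "z $ i = lo Q $ i \<and> y $ i < knot t i (lo Q $ i)"
      then have "knots i k < knots i (half_width i)" "knots i (half_width i) < knots i (m i + 1)"
        using k(2) xb(1)[of i] m(3)[of i] knots_middle[of i] by auto
      then have "k < half_width i" "half_width i < m i + 1"
        using mono by (meson not_le)+
      then show ?thesis by auto
    next
      assume z: "z $ i = hi Q $ i \<and> knot t i (hi Q $ i) < y $ i"
      then have "knots i (half_width i) < knots i (k + 1)" "knots i (m i) < knots i (half_width i)"
        using k(3) xb(2)[of i] m(2)[of i] knots_middle[of i] by auto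
      then have "half_width i < k + 1" "m i < half_width i"
        using mono by (meson not_le)+
      then show ?thesis by auto
    qed
    then show False
    proof
      assume "k < m i"
      then show False
        using bspline_piece_not_proportional[OF mono_knots spans _ m(1)] pieces_eq \<open>C \<noteq> 0\<close> k(4)
        unfolding P_def by metis
    next
      assume "m i < k"
      then show False
        using bspline_piece_not_proportional[OF mono_knots spans(2,1) _ k(1)] pieces_eq \<open>C \<noteq> 0\<close> k(4)
        unfolding P_def by metis
    qed
  qed
qed

end

section \<open>Bezier elements in a parametric element\<close>

context spline_setting
begin

lemma bezier_candidate_inside:
  assumes A: "ip_mesh A" "finite (extension A)" and Q: "Q \<in> A"
    and V: "bezier_candidate p n t (extension A) V" "V \<inter> param_image t Q \<noteq> {}"
  shows "V \<subseteq> param_image t Q"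
proof (rule ccontr)
  assume contra: "\<not> V \<subseteq> param_image t Q"
  have c: "ip_cell Q" using ip_meshD(2)[OF A(1) Q] .
  define a where "a = (\<chi> j. knot t j (lo Q $ j))"
  define b where "b = (\<chi> j. knot t j (hi Q $ j))"
  have img: "param_image t Q = box a b" by (simp add: param_image_def a_def b_def)
  have V': "open V" "\<And>z. z \<in> anchors p n (extension A) \<Longrightarrow> polynomial_on p V (blending p n t (extension A) z)"
    using V(1) by (auto simp: bezier_candidate_def)
  obtain x where x: "x \<in> V" "x \<in> param_image t Q" using V(2) by blast
  \<comment> \<open>An open set inside the closed box is inside the open one, so some point of
    \<open>V\<close> lies strictly beyond a face.\<close>
  have "\<not> V \<subseteq> cbox a b"
    using contra interior_maximal[of V "cbox a b"] V'(1) unfolding img by (auto simp: interior_cbox)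
  then obtain y where y: "y \<in> V" "y \<notin> cbox a b" by blast
  then obtain i where i: "y $ i < knot t i (lo Q $ i) \<or> knot t i (hi Q $ i) < y $ i"
    by (auto simp: mem_box_cart a_def b_def not_le)
  \<comment> \<open>Any vertex on that face would do: the lower corner, moved to the upper side in
    direction \<open>i\<close> if \<open>y\<close> lies beyond that side.\<close>
  define z where "z = (\<chi> j. if j = i \<and> knot t i (hi Q $ i) < y $ i then hi Q $ j else lo Q $ j)"
  have vertex: "z $ j = lo Q $ j \<or> z $ j = hi Q $ j" for j by (simp add: z_def)
  have "z \<in> anchors p n (extension A)"
  proof -
    have "z $ j \<in> {\<lceil>real (p j) / 2\<rceil> + 1 .. real (n j) + real (p j) + 1 - \<lceil>real (p j) / 2\<rceil>}" for j
    proof -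
      have "\<lceil>real (p j) / 2\<rceil> \<le> int (p j)" by (simp add: ceiling_le_iff)
      then have "real_of_int \<lceil>real (p j) / 2\<rceil> \<le> real (p j)" by linarith
      then show ?thesis using vertex[of j] ip_cellD(3-5)[OF c, of j] by auto
    qed
    moreover have "Q \<in> extension A" using Q extension_superset by blast
    moreover have "\<forall>j. z $ j \<in> {lo Q $ j, hi Q $ j}" using vertex by simp
    ultimately show ?thesis unfolding anchors_def by blast
  qed
  then interpret anchor_setting p n t A z
    using A by unfold_locales
  have "z $ i = lo Q $ i \<and> y $ i < knot t i (lo Q $ i) \<or> z $ i = hi Q $ i \<and> knot t i (hi Q $ i) < y $ i"
    using i by (auto simp: z_def)
  from vertex_separates[OF Q vertex V'(1) x(1) y(1) V'(2)[OF anchor] x(2) this] show False .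
qed

text \<open>An inner cell does not cross an integer, because integers are on every grid. So
  \<open>knot\<close> is affine on each of its intervals.\<close>

lemma knot_midpt:
  assumes "ip_cell E"
  shows "knot t j (midpt E $ j) = (knot t j (lo E $ j) + knot t j (hi E $ j)) / 2"
proof -
  note c = ip_cellD[OF assms, of j]
  define k where "k = nat \<lfloor>lo E $ j\<rfloor>"
  have k: "real k \<le> lo E $ j" "lo E $ j < real k + 1" using c(3) by (auto simp: k_def)
  have "on_grid (level E) j (real k + 1)" using on_grid_of_int[of "level E" j "int k + 1"] by simp
  then have hi: "hi E $ j \<le> real k + 1"
    using ip_cell_grid_point[OF assms, of j "real k + 1"] k by linarith
  show ?thesis
    using knot_affine[of k "lo E $ j" t j] knot_affine[of k "hi E $ j" t j] knot_affine[of k "midpt E $ j" t j]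
      k hi c(5) by (simp add: midpt_nth field_simps)
qed

lemma bezier_elements_of_cell:
  assumes A: "ip_mesh A" "finite (extension A)" and E: "E \<in> A"
  defines "Q \<equiv> param_image t E"
  shows "consists_of_bezier p n t (extension A) Q {Q} \<or>
    (\<exists>B\<^sub>1 B\<^sub>2. B\<^sub>1 \<noteq> B\<^sub>2 \<and> consists_of_bezier p n t (extension A) Q {B\<^sub>1, B\<^sub>2} \<and>
       measure lborel B\<^sub>1 = measure lborel Q / 2 \<and>
       measure lborel B\<^sub>2 = measure lborel Q / 2)"
proof -
  have c: "ip_cell E" using ip_meshD(2)[OF A(1) E] .
  define a where "a = (\<chi> j. knot t j (lo E $ j))"
  define b where "b = (\<chi> j. knot t j (hi E $ j))"
  define s :: 'd where "s = split_dir (level E)"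
  have img: "Q = box a b" by (simp add: Q_def param_image_def a_def b_def)
  have mid: "knot t j (midpt E $ j) = (a $ j + b $ j) / 2" for j
    by (simp add: a_def b_def knot_midpt[OF c])
  show ?thesis unfolding img
  proof (rule one_or_two_bezier_elements[where j = s])
    show "a $ i < b $ i" for i by (simp add: a_def b_def ip_cell_knots_less[OF c])
    show "box a b \<subseteq> param_domain"
    proof -
      have "0 \<le> a $ i" "b $ i \<le> 1" for i
        using knot_mono[of "real (p i) + 1" "lo E $ i" i] knot_mono[of "hi E $ i" "real (n i) + 1" i]
          ip_cellD(3-5)[OF c, of i] by (auto simp: a_def b_def knot_ip_ends)
      then show ?thesis
        unfolding param_domain_def by (auto simp: mem_box_cart) (meson le_less_trans less_le_trans)+
    qed
    show "V \<subseteq> box a b" if "bezier_candidate p n t (extension A) V" "V \<inter> box a b \<noteq> {}" for V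
      using bezier_candidate_inside[OF A E that(1)] that(2) img Q_def by simp
    fix z assume z: "z \<in> anchors p n (extension A)"
    interpret anchor_setting p n t A z using A z by unfold_locales
    show "polynomial_on p {x \<in> box a b. x $ s < (a $ s + b $ s) / 2} (blending p n t (extension A) z)"
    proof (rule blending_polynomial_on[OF E])
      show "a $ j \<le> x $ j \<and> x $ j < (if j = s then (a $ s + b $ s) / 2 else b $ j)"
        if "x \<in> {x \<in> box a b. x $ s < (a $ s + b $ s) / 2}" for x j
        using that by (auto simp: mem_box_cart less_imp_le)
      show "(if j = s then (a $ s + b $ s) / 2 else b $ j) \<le> knot t j (hi E $ j)" for j
        using ip_cell_knots_less[OF c, of j] by (cases "j = s") (simp_all add: a_def b_def)
    qed (simp_all add: a_def mid s_def)
    show "polynomial_on p {x \<in> box a b. (a $ s + b $ s) / 2 \<le> x $ s} (blending p n t (extension A) z)"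
    proof (rule blending_polynomial_on[OF E])
      show "(if j = s then (a $ s + b $ s) / 2 else a $ j) \<le> x $ j \<and> x $ j < b $ j"
        if "x \<in> {x \<in> box a b. (a $ s + b $ s) / 2 \<le> x $ s}" for x j
        using that by (auto simp: mem_box_cart less_imp_le)
      show "knot t j (lo E $ j) \<le> (if j = s then (a $ s + b $ s) / 2 else a $ j)" for j
        using ip_cell_knots_less[OF c, of j] by (cases "j = s") (simp_all add: a_def b_def)
    qed (simp_all add: b_def mid s_def)
  qed
qed

end

theorem lemma2:
  fixes p n :: "'d::{finite,linorder} \<Rightarrow> nat"
    and t :: "'d \<Rightarrow> nat \<Rightarrow> real"
    and \<Q> :: "(real ^ 'd::{finite,linorder}) set set"
    and M :: "'d elem set"
    and Q :: "(real ^ 'd::{finite,linorder}) set"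
  assumes "CARD('d) \<in> {2, 3}"
    and "\<And>j. odd (p j) \<and> 3 \<le> p j"
    and "\<And>j. open_knots (p j) (n j) (t j)"
    and "\<Q> \<in> admissible_meshes p n t"
    and "associated_index_mesh p n t \<Q> M"
    and "Q \<in> \<Q>"
  shows "consists_of_bezier p n t M Q {Q} \<or>
    (\<exists>B\<^sub>1 B\<^sub>2. B\<^sub>1 \<noteq> B\<^sub>2 \<and> consists_of_bezier p n t M Q {B\<^sub>1, B\<^sub>2} \<and>
       measure lborel B\<^sub>1 = measure lborel Q / 2 \<and>
       measure lborel B\<^sub>2 = measure lborel Q / 2)"
proof -
  interpret spline_setting p n t
    using assms(1-3) by unfold_locales auto
  have "admissible_index_mesh p n t M" "param_mesh t M = \<Q>"
    using assms(5) by (auto simp: associated_index_mesh_def)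
  then obtain A where A: "finite M" "ip_mesh A" "M = extension A"
    using admissible_eq_extension by blast
  obtain E where "E \<in> M" "measure lborel (param_image t E) > 0" "Q = param_image t E"
    using assms(6) \<open>param_mesh t M = \<Q>\<close> by (auto simp: param_mesh_def)
  moreover from this have "E \<in> A" using param_mesh_cell A by blast
  ultimately show ?thesis using bezier_elements_of_cell[of A E] A by simp
qed

end
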